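(* The following are equivalent: (1) For every regular cardinal $\mu$, every $\mu$-AEC is fully tame and short (that is, fully $(<\kappa)$-tame and short for some cardinal $\kappa$). (2) Every AEC is tame (that is, $(<\kappa)$-tame for some cardinal $\kappa$). (3) There exists a proper class of almost strongly compact cardinals.
   Context: For an infinite cardinal $\mu$, a $\mu$-ary language $L$ consists of function and relation symbols, each with an arity that is an ordinal $<\mu$. A $\mu$-abstract class is a pair $(\mathcal{K}, \le_{\mathcal{K}})$ where $\mathcal{K}$ is a class of $L$-structures for a fixed $\mu$-ary language $L = L(\mathcal{K})$, $\le_{\mathcal{K}}$ is a reflexive and transitive relation on $\mathcal{K}$ such that $M \le_{\mathcal{K}} N$ implies $M$ is an $L$-substructure of $N$, and which respects isomorphisms. A poset $I$ is $\mu$-directed if every subset of size $<\mu$ has an upper bound. For $\mu$ regular, a $\mu$-abstract class is a $\mu$-AEC if: (Coherence) if $M_0, M_1, M_2 \in \mathcal{K}$, $M_0 \le_{\mathcal{K}} M_2$, $M_1 \le_{\mathcal{K}} M_2$ and $M_0 \subseteq M_1$, then $M_0 \le_{\mathcal{K}} M_1$; (Tarski–Vaught) if $\{M_i : i \in I\} \subseteq \mathcal{K}$ with $I$ $\mu$-directed and $i \le j \Rightarrow M_i \le_{\mathcal{K}} M_j$, then (a) $\bigcup_i M_i \in \mathcal{K}$ and $M_j \le_{\mathcal{K}} \bigcup_i M_i$ for all $j$, and (b) if $N \in \mathcal{K}$ with $M_i \le_{\mathcal{K}} N$ for all $i$, then $\bigcup_i M_i \le_{\mathcal{K}} N$; (Löwenheim–Skolem–Tarski)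 there is a cardinal $\lambda = \lambda^{<\mu} \ge |L(\mathcal{K})| + \mu$ such that for every $M \in \mathcal{K}$ and $A \subseteq |M|$ there is $N \le_{\mathcal{K}} M$ with $A \subseteq |N|$ and $|N| \le |A|^{<\mu} + \lambda$. An AEC (abstract elementary class) is exactly an $\aleph_0$-AEC (so all symbols are finitary). A $\mathcal{K}$-embedding $f: M \to N$ is an $L$-isomorphism from $M$ onto some $f[M] \le_{\mathcal{K}} N$. Galois types: for $N_1, N_2 \in \mathcal{K}$, a set $A \subseteq |N_1| \cap |N_2|$ and sequences $\mathbf{a}_\ell \in {}^{\alpha}|N_\ell|$, write $(\mathbf{a}_1, A, N_1) E_{at} (\mathbf{a}_2, A, N_2)$ if there are $N \in \mathcal{K}$ and $\mathcal{K}$-embeddings $f_\ell : N_\ell \to N$ fixing $A$ pointwise with $f_1(\mathbf{a}_1) = f_2(\mathbf{a}_2)$; let $E$ be the transitive closure of $E_{at}$, and $\mathrm{gtp}(\mathbf{a}/A; N)$ the $E$-class of $(\mathbf{a}, A, N)$. For $M \in \mathcal{K}$, $\mathrm{gS}^\alpha(M) = \{\mathrm{gtp}(\mathbf{a}/|M|; N) : M \le_{\mathcal{K}} N, \mathbf{a} \in {}^\alpha|N|\}$ and $\mathrm{gS}(M) = \mathrm{gS}^1(M)$. For $p = \mathrm{gtp}(\mathbf{a}/|M|;N)$, $I \subseteq \alpha$ and $A \subseteq |M|$, $p^I \upharpoonright A := \mathrm{gtp}(\mathbf{a}\upharpoonright I / A; N)$ and $p \upharpoonright A := p^\alpha \upharpoonright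 A$. $\mathcal{K}$ is $(<\kappa)$-tame if for every $M \in \mathcal{K}$ and distinct $p, q \in \mathrm{gS}(M)$ there is $A \subseteq |M|$ with $|A| < \kappa$ and $p \upharpoonright A \ne q \upharpoonright A$. $\mathcal{K}$ is fully $(<\kappa)$-tame and short if for every $M \in \mathcal{K}$, every ordinal $\alpha$ and all distinct $p, q \in \mathrm{gS}^\alpha(M)$ there are $I \subseteq \alpha$ and $A \subseteq |M|$ with $|I| + |A| < \kappa$ and $p^I \upharpoonright A \ne q^I \upharpoonright A$. An uncountable limit cardinal $\kappa$ is almost strongly compact if for every $\mu < \kappa$, every $\kappa$-complete filter extends to a $\mu$-complete ultrafilter. *)

theory Defs
  imports Main "HOL-Library.FuncSet" "HOL-Library.Equipollence"
begin

text \<open>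
  The theorem is about proper classes, so it is stated over a type that carries the axioms of ZFC.
  Separation and replacement range over arbitrary HOL sets and functions, and choice comes from HOL,
  as in the usual HOL axiomatisation of a type of all sets.  A class is an arbitrary
  HOL set or predicate over the universe, and a HOL set of elements of the universe is small if it
  is the extension of an element.
\<close>

class zfc_universe =
  fixes elts :: "'a \<Rightarrow> 'a set"
  assumes extensionality: "elts x = elts y \<Longrightarrow> x = y"
    and foundation: "wf {(x, y). x \<in> elts y}"
    and pairing: "\<exists>z. elts z = {x, y}"
    and union: "\<exists>y. elts y = (\<Union>z \<in> elts x. elts z)"
    and powerset: "\<exists>y. elts y = {z. elts z \<subseteq> elts x}"
    and separation: "X \<subseteq> elts x \<Longrightarrow> \<exists>y. elts y = X"
    and replacement: "\<exists>y. elts y = f ` elts x"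
    and infinity: "\<exists>x. (\<exists>z \<in> elts x. elts z = {}) \<and>
      (\<forall>y \<in> elts x. \<exists>s \<in> elts x. elts s = insert y (elts y))"

definition small :: "'v::zfc_universe set \<Rightarrow> bool" where
  "small X \<longleftrightarrow> (\<exists>x. elts x = X)"

definition vset :: "'v::zfc_universe set \<Rightarrow> 'v" where
  "vset X = (THE x. elts x = X)"

text \<open>
  Ordinals are von Neumann ordinals: for ordinals, \<open>\<alpha> < \<beta>\<close> is \<open>\<alpha> \<in> elts \<beta>\<close>.
  Cardinals are initial ordinals, and \<open>|X| < \<kappa>\<close> is \<open>X \<prec> elts \<kappa>\<close>.
\<close>

definition Ord :: "'v::zfc_universe \<Rightarrow> bool" where
  "Ord \<alpha> \<longleftrightarrow> (\<forall>\<beta> \<in> elts \<alpha>. elts \<beta> \<subseteq> elts \<alpha>) \<and>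
              (\<forall>\<beta> \<in> elts \<alpha>. \<forall>\<gamma> \<in> elts \<beta>. elts \<gamma> \<subseteq> elts \<beta>)"

definition ord_one :: "'v::zfc_universe" where
  "ord_one = vset {vset {}}"

definition omega :: "'v::zfc_universe" where
  "omega = (THE w. Ord w \<and> infinite (elts w) \<and> (\<forall>n \<in> elts w. finite (elts n)))"

definition Card :: "'v::zfc_universe \<Rightarrow> bool" where
  "Card \<kappa> \<longleftrightarrow> Ord \<kappa> \<and> (\<forall>\<alpha> \<in> elts \<kappa>. elts \<alpha> \<prec> elts \<kappa>)"

definition regular_card :: "'v::zfc_universe \<Rightarrow> bool" where
  "regular_card \<mu> \<longleftrightarrow> Card \<mu> \<and> infinite (elts \<mu>) \<and>
     (\<forall>X \<subseteq> elts \<mu>. (\<forall>\<beta> \<in> elts \<mu>. \<exists>x \<in> X. \<beta> = x \<or> \<beta> \<in> elts x) \<longrightarrow> X \<approx> elts \<mu>)"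

definition limit_card :: "'v::zfc_universe \<Rightarrow> bool" where
  "limit_card \<kappa> \<longleftrightarrow> Card \<kappa> \<and> infinite (elts \<kappa>) \<and>
     (\<forall>\<nu> \<in> elts \<kappa>. Card \<nu> \<longrightarrow> (\<exists>\<nu>' \<in> elts \<kappa>. Card \<nu>' \<and> \<nu> \<in> elts \<nu>'))"

text \<open>
  The sequences of length \<open>< \<mu>\<close> from \<open>A\<close>.  For infinite \<open>\<mu>\<close> and \<open>2 \<le> |A|\<close> their number is the
  supremum of the cardinals \<open>|A| ^ \<alpha>\<close> for \<open>\<alpha> < \<mu>\<close>; for \<open>|A| \<le> 1\<close> it is at most \<open>\<mu>\<close>, which is
  immaterial in a sum with some \<open>\<lambda> \<ge> \<mu>\<close>.
\<close>

definition seqs_lt :: "'v::zfc_universe \<Rightarrow> 'v set \<Rightarrow> ('v \<times> ('v \<Rightarrow> 'v)) set" where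
  "seqs_lt \<mu> A = (SIGMA \<alpha> : elts \<mu>. elts \<alpha> \<rightarrow>\<^sub>E A)"

definition filter_on_set :: "'v set \<Rightarrow> 'v set set \<Rightarrow> bool" where
  "filter_on_set X F \<longleftrightarrow> F \<subseteq> Pow X \<and> X \<in> F \<and> {} \<notin> F \<and>
     (\<forall>A \<in> F. \<forall>B. A \<subseteq> B \<and> B \<subseteq> X \<longrightarrow> B \<in> F) \<and> (\<forall>A \<in> F. \<forall>B \<in> F. A \<inter> B \<in> F)"

definition ultrafilter_on_set :: "'v set \<Rightarrow> 'v set set \<Rightarrow> bool" where
  "ultrafilter_on_set X U \<longleftrightarrow> filter_on_set X U \<and> (\<forall>A \<subseteq> X. A \<in> U \<or> X - A \<in> U)"

definition complete_family :: "'v::zfc_universe \<Rightarrow> 'v set set \<Rightarrow> bool" where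
  "complete_family \<kappa> F \<longleftrightarrow> (\<forall>S \<subseteq> F. S \<noteq> {} \<and> S \<prec> elts \<kappa> \<longrightarrow> \<Inter>S \<in> F)"

definition almost_strongly_compact :: "'v::zfc_universe \<Rightarrow> bool" where
  "almost_strongly_compact \<kappa> \<longleftrightarrow> limit_card \<kappa> \<and> elts (omega :: 'v) \<prec> elts \<kappa> \<and>
     (\<forall>\<mu> \<in> elts \<kappa>. Card \<mu> \<longrightarrow>
        (\<forall>X F. small X \<and> filter_on_set X F \<and> complete_family \<kappa> F \<longrightarrow>
           (\<exists>U. F \<subseteq> U \<and> ultrafilter_on_set X U \<and> complete_family \<mu> U)))"

record 'v language =
  fsyms :: "'v set"
  rsyms :: "'v set"
  far :: "'v \<Rightarrow> 'v"
  rar :: "'v \<Rightarrow> 'v"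

definition mu_ary :: "'v::zfc_universe \<Rightarrow> 'v language \<Rightarrow> bool" where
  "mu_ary \<mu> L \<longleftrightarrow> small (fsyms L) \<and> small (rsyms L) \<and>
     (\<forall>s \<in> fsyms L. far L s \<in> elts \<mu>) \<and> (\<forall>s \<in> rsyms L. rar L s \<in> elts \<mu>)"

record 'v struc =
  univ :: "'v set"
  fint :: "'v \<Rightarrow> ('v \<Rightarrow> 'v) \<Rightarrow> 'v"
  rint :: "'v \<Rightarrow> ('v \<Rightarrow> 'v) set"

text \<open>
  The interpretations are extensional functions, so that HOL equality of structures is
  equality of their universes and of the interpretations of all symbols.
\<close>

definition is_struc :: "'v::zfc_universe language \<Rightarrow> 'v struc \<Rightarrow> bool" where
  "is_struc L M \<longleftrightarrow> small (univ M) \<and> univ M \<noteq> {} \<and>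
     fint M \<in> (\<Pi>\<^sub>E s \<in> fsyms L. (elts (far L s) \<rightarrow>\<^sub>E univ M) \<rightarrow>\<^sub>E univ M) \<and>
     rint M \<in> (\<Pi>\<^sub>E s \<in> rsyms L. Pow (elts (rar L s) \<rightarrow>\<^sub>E univ M))"

definition substruc :: "'v::zfc_universe language \<Rightarrow> 'v struc \<Rightarrow> 'v struc \<Rightarrow> bool" where
  "substruc L M N \<longleftrightarrow> is_struc L M \<and> is_struc L N \<and> univ M \<subseteq> univ N \<and>
     (\<forall>s \<in> fsyms L. \<forall>x \<in> elts (far L s) \<rightarrow>\<^sub>E univ M. fint M s x = fint N s x) \<and>
     (\<forall>s \<in> rsyms L. \<forall>x \<in> elts (rar L s) \<rightarrow>\<^sub>E univ M. x \<in> rint M s \<longleftrightarrow> x \<in> rint N s)"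

definition struc_iso ::
  "'v::zfc_universe language \<Rightarrow> ('v \<Rightarrow> 'v) \<Rightarrow> 'v struc \<Rightarrow> 'v struc \<Rightarrow> bool" where
  "struc_iso L f M N \<longleftrightarrow> is_struc L M \<and> is_struc L N \<and> bij_betw f (univ M) (univ N) \<and>
     (\<forall>s \<in> fsyms L. \<forall>x \<in> elts (far L s) \<rightarrow>\<^sub>E univ M.
        f (fint M s x) = fint N s (compose (elts (far L s)) f x)) \<and>
     (\<forall>s \<in> rsyms L. \<forall>x \<in> elts (rar L s) \<rightarrow>\<^sub>E univ M.
        x \<in> rint M s \<longleftrightarrow> compose (elts (rar L s)) f x \<in> rint N s)"

text \<open>
  The union of a \<open>\<mu>\<close>-directed system of substructures of a \<open>\<mu>\<close>-ary language: by directedness,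
  every argument tuple of a function symbol already lies in some \<open>M i\<close>, and all such \<open>M i\<close> agree
  on the value.
\<close>

definition union_struc ::
  "'v::zfc_universe language \<Rightarrow> 'v set \<Rightarrow> ('v \<Rightarrow> 'v struc) \<Rightarrow> 'v struc" where
  "union_struc L I M =
     \<lparr>univ = (\<Union>i \<in> I. univ (M i)),
      fint = (\<lambda>s \<in> fsyms L. \<lambda>x \<in> elts (far L s) \<rightarrow>\<^sub>E (\<Union>i \<in> I. univ (M i)).
        THE y. \<exists>i \<in> I. x \<in> elts (far L s) \<rightarrow>\<^sub>E univ (M i) \<and> y = fint (M i) s x),
      rint = (\<lambda>s \<in> rsyms L. \<Union>i \<in> I. rint (M i) s)\<rparr>"

record 'v absclass =
  lang :: "'v language"
  models :: "'v struc set"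
  leK :: "'v struc \<Rightarrow> 'v struc \<Rightarrow> bool"

definition mu_abstract_class :: "'v::zfc_universe \<Rightarrow> 'v absclass \<Rightarrow> bool" where
  "mu_abstract_class \<mu> K \<longleftrightarrow>
     mu_ary \<mu> (lang K) \<and>
     (\<forall>M \<in> models K. is_struc (lang K) M) \<and>
     (\<forall>M N. leK K M N \<longrightarrow> M \<in> models K \<and> N \<in> models K \<and> substruc (lang K) M N) \<and>
     (\<forall>M \<in> models K. leK K M M) \<and>
     (\<forall>M N P. leK K M N \<and> leK K N P \<longrightarrow> leK K M P) \<and>
     (\<forall>M N f. M \<in> models K \<and> struc_iso (lang K) f M N \<longrightarrow> N \<in> models K) \<and>
     (\<forall>M N M' N' f. leK K M N \<and> struc_iso (lang K) f N N' \<and>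
        struc_iso (lang K) f M M' \<longrightarrow> leK K M' N')"

definition mu_directed :: "'v::zfc_universe \<Rightarrow> 'v set \<Rightarrow> 'v rel \<Rightarrow> bool" where
  "mu_directed \<mu> I r \<longleftrightarrow> partial_order_on I r \<and>
     (\<forall>X \<subseteq> I. X \<prec> elts \<mu> \<longrightarrow> (\<exists>u \<in> I. \<forall>x \<in> X. (x, u) \<in> r))"

definition coherence :: "'v::zfc_universe absclass \<Rightarrow> bool" where
  "coherence K \<longleftrightarrow> (\<forall>M0 \<in> models K. \<forall>M1 \<in> models K. \<forall>M2 \<in> models K.
     leK K M0 M2 \<and> leK K M1 M2 \<and> substruc (lang K) M0 M1 \<longrightarrow> leK K M0 M1)"

definition tarski_vaught :: "'v::zfc_universe \<Rightarrow> 'v absclass \<Rightarrow> bool" where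
  "tarski_vaught \<mu> K \<longleftrightarrow>
     (\<forall>I r M. small I \<and> mu_directed \<mu> I r \<and> (\<forall>i \<in> I. M i \<in> models K) \<and>
        (\<forall>i j. (i, j) \<in> r \<longrightarrow> leK K (M i) (M j)) \<longrightarrow>
          union_struc (lang K) I M \<in> models K \<and>
          (\<forall>j \<in> I. leK K (M j) (union_struc (lang K) I M)) \<and>
          (\<forall>N \<in> models K. (\<forall>i \<in> I. leK K (M i) N) \<longrightarrow> leK K (union_struc (lang K) I M) N))"

definition lowenheim_skolem_tarski :: "'v::zfc_universe \<Rightarrow> 'v absclass \<Rightarrow> bool" where
  "lowenheim_skolem_tarski \<mu> K \<longleftrightarrow>
     (\<exists>l. Card l \<and> elts l \<approx> seqs_lt \<mu> (elts l) \<and>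
        (fsyms (lang K) <+> rsyms (lang K)) <+> elts \<mu> \<lesssim> elts l \<and>
        (\<forall>M \<in> models K. \<forall>A \<subseteq> univ M.
           \<exists>N. leK K N M \<and> A \<subseteq> univ N \<and> univ N \<lesssim> seqs_lt \<mu> A <+> elts l))"

definition mu_aec :: "'v::zfc_universe \<Rightarrow> 'v absclass \<Rightarrow> bool" where
  "mu_aec \<mu> K \<longleftrightarrow> regular_card \<mu> \<and> mu_abstract_class \<mu> K \<and> coherence K \<and>
     tarski_vaught \<mu> K \<and> lowenheim_skolem_tarski \<mu> K"

definition aec :: "'v::zfc_universe absclass \<Rightarrow> bool" where
  "aec K \<longleftrightarrow> mu_aec omega K"

definition K_embedding ::
  "'v::zfc_universe absclass \<Rightarrow> ('v \<Rightarrow> 'v) \<Rightarrow> 'v struc \<Rightarrow> 'v struc \<Rightarrow> bool" where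
  "K_embedding K f M N \<longleftrightarrow> (\<exists>M'. struc_iso (lang K) f M M' \<and> leK K M' N)"

text \<open>
  Sequences are indexed by an arbitrary set \<open>J\<close>, as the restriction of a sequence of length \<open>\<alpha>\<close>
  to \<open>I \<subseteq> \<alpha>\<close> is needed.  The index set is a parameter since it cannot be recovered from the
  extensional function that represents the sequence.
\<close>

type_synonym 'v pretype = "('v \<Rightarrow> 'v) \<times> 'v set \<times> 'v struc"

definition E_at ::
  "'v::zfc_universe absclass \<Rightarrow> 'v set \<Rightarrow> 'v pretype \<Rightarrow> 'v pretype \<Rightarrow> bool" where
  "E_at K J = (\<lambda>(a1, A1, N1) (a2, A2, N2).
     N1 \<in> models K \<and> N2 \<in> models K \<and> A1 = A2 \<and> A1 \<subseteq> univ N1 \<inter> univ N2 \<and>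
     a1 \<in> J \<rightarrow>\<^sub>E univ N1 \<and> a2 \<in> J \<rightarrow>\<^sub>E univ N2 \<and>
     (\<exists>N \<in> models K. \<exists>f1 f2. K_embedding K f1 N1 N \<and> K_embedding K f2 N2 N \<and>
        (\<forall>x \<in> A1. f1 x = x \<and> f2 x = x) \<and> (\<forall>j \<in> J. f1 (a1 j) = f2 (a2 j))))"

definition gtp ::
  "'v::zfc_universe absclass \<Rightarrow> 'v set \<Rightarrow> ('v \<Rightarrow> 'v) \<Rightarrow> 'v set \<Rightarrow> 'v struc \<Rightarrow> 'v pretype set" where
  "gtp K J a A N = {t. (E_at K J)\<^sup>+\<^sup>+ (a, A, N) t}"

definition gS :: "'v::zfc_universe absclass \<Rightarrow> 'v \<Rightarrow> 'v struc \<Rightarrow> 'v pretype set set" where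
  "gS K \<alpha> M = {gtp K (elts \<alpha>) a (univ M) N | a N. leK K M N \<and> a \<in> elts \<alpha> \<rightarrow>\<^sub>E univ N}"

text \<open>
  \<open>p\<^sup>I \<restriction> A\<close>, as the union over all representatives of \<open>p\<close>; they all give the same class.
\<close>

definition gtp_restrict ::
  "'v::zfc_universe absclass \<Rightarrow> 'v set \<Rightarrow> 'v set \<Rightarrow> 'v pretype set \<Rightarrow> 'v pretype set" where
  "gtp_restrict K I A p = (\<Union>(a, B, N) \<in> p. gtp K I (restrict a I) A N)"

lemma E_at_sym: "E_at K J s t \<Longrightarrow> E_at K J t s"
  unfolding E_at_def by (auto split: prod.splits) metis

lemma E_at_restrict:
  assumes "E_at K J (a, B, N) (a', B', N')" "I \<subseteq> J" "A \<subseteq> B"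
  shows "E_at K I (restrict a I, A, N) (restrict a' I, A, N')"
proof -
  obtain P f1 f2 where P: "P \<in> models K" "K_embedding K f1 N P" "K_embedding K f2 N' P"
    "\<forall>x \<in> B. f1 x = x \<and> f2 x = x" "\<forall>j \<in> J. f1 (a j) = f2 (a' j)"
    using assms(1) unfolding E_at_def by auto
  have "\<forall>x \<in> A. f1 x = x \<and> f2 x = x" "\<forall>j \<in> I. f1 (restrict a I j) = f2 (restrict a' I j)"
    using P(4,5) assms(2,3) by auto
  moreover have "N \<in> models K" "N' \<in> models K" "A \<subseteq> univ N \<inter> univ N'"
    "restrict a I \<in> I \<rightarrow>\<^sub>E univ N" "restrict a' I \<in> I \<rightarrow>\<^sub>E univ N'"
    using assms unfolding E_at_def by (auto simp: PiE_iff)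
  ultimately show ?thesis
    using P(1-3) unfolding E_at_def by auto
qed

lemma gtp_restrict_gtp:
  assumes refl: "E_at K J (a, B, N) (a, B, N)" and "I \<subseteq> J" "A \<subseteq> B"
  shows "gtp_restrict K I A (gtp K J a B N) = gtp K I (restrict a I) A N"
proof -
  have same: "C = B" if "E_at K J (c, B, Q) (c', C, Q')" for c c' C Q Q'
    using that by (simp add: E_at_def)
  have step: "fst (snd t) = B \<and>
      (E_at K I)\<^sup>+\<^sup>+ (restrict a I, A, N) (restrict (fst t) I, A, snd (snd t))"
    if "(E_at K J)\<^sup>+\<^sup>+ (a, B, N) t" for t
    using that
  proof (induction rule: tranclp_induct)
    case (base t)
    obtain c C Q where t: "t = (c, C, Q)" by (cases t)
    show ?case
      using tranclp.r_into_trancl[of "E_at K I", OF E_at_restrict[OF base[unfolded t] assms(2,3)]]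
        same[OF base[unfolded t]]
      unfolding t fst_conv snd_conv by blast
  next
    case (step s t)
    obtain c C Q where s: "s = (c, C, Q)" by (cases s)
    obtain d D R where t: "t = (d, D, R)" by (cases t)
    have CB: "C = B" using step.IH s by simp
    have e: "E_at K J (c, B, Q) (d, D, R)" using step.hyps(2) s t CB by simp
    have "E_at K I (restrict c I, A, Q) (restrict d I, A, R)"
      using E_at_restrict[OF e assms(2,3)] .
    with step.IH have "(E_at K I)\<^sup>+\<^sup>+ (restrict a I, A, N) (restrict d I, A, R)"
      unfolding s by (metis fst_conv snd_conv tranclp.trancl_into_trancl)
    moreover have "D = B" using e by (simp add: E_at_def)
    ultimately show ?case unfolding t fst_conv snd_conv by blast
  qed
  have sym: "(E_at K I)\<^sup>+\<^sup>+ t s" if "(E_at K I)\<^sup>+\<^sup>+ s t" for s t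
    using that by (induction) (meson E_at_sym tranclp.r_into_trancl tranclp_trans)+
  have "gtp K I (restrict a' I) A N' = gtp K I (restrict a I) A N"
    if "(E_at K J)\<^sup>+\<^sup>+ (a, B, N) (a', B', N')" for a' B' N'
    using step[OF that] sym unfolding gtp_def fst_conv snd_conv
    by (intro Collect_cong) (meson tranclp_trans)
  then show ?thesis
    using refl unfolding gtp_restrict_def gtp_def[of K J] by fast
qed

definition tame :: "'v::zfc_universe \<Rightarrow> 'v absclass \<Rightarrow> bool" where
  "tame \<kappa> K \<longleftrightarrow>
     (\<forall>M \<in> models K. \<forall>p \<in> gS K ord_one M. \<forall>q \<in> gS K ord_one M. p \<noteq> q \<longrightarrow>
        (\<exists>A \<subseteq> univ M. A \<prec> elts \<kappa> \<and>
           gtp_restrict K (elts ord_one) A p \<noteq> gtp_restrict K (elts ord_one) A q))"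

definition fully_tame_and_short :: "'v::zfc_universe \<Rightarrow> 'v absclass \<Rightarrow> bool" where
  "fully_tame_and_short \<kappa> K \<longleftrightarrow>
     (\<forall>M \<in> models K. \<forall>\<alpha>. Ord \<alpha> \<longrightarrow>
        (\<forall>p \<in> gS K \<alpha> M. \<forall>q \<in> gS K \<alpha> M. p \<noteq> q \<longrightarrow>
           (\<exists>I \<subseteq> elts \<alpha>. \<exists>A \<subseteq> univ M. I <+> A \<prec> elts \<kappa> \<and>
              gtp_restrict K I A p \<noteq> gtp_restrict K I A q)))"

end

theory Submission
  imports Defs
begin

text \<open>
  From compactness to tameness: for a class with Loewenheim-Skolem-Tarski number \<open>\<lambda>\<close> and an ultrafilter \<open>U\<close>
  that is complete enough relative to \<open>\<lambda>\<close>, the ultraproduct of a family of models is the directed union of the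
  ultraproducts of families of submodels of size at most \<open>\<lambda>\<close>.  Each of those is isomorphic to almost all of
  its factors, so the union axioms put the ultraproduct into the class, and the same argument shows that
  ultraproducts of embeddings and diagonal maps are embeddings.  If the restrictions of two types to all
  small sets agree, then the ultraproduct of the witnessing chains, along an ultrafilter that contains the
  cones of small sets, witnesses that the types agree.

  From tameness to compactness: fix a set \<open>T\<close> with as many elements as countable sequences from it, and a
  filter \<open>F\<close> on \<open>X\<close>.  Over the functions \<open>f : X \<rightarrow> T\<close> put torsors for the group of finite subsets of \<open>T\<close> under
  symmetric difference, related along \<open>f' = \<pi> \<circ> f\<close> modulo \<open>F\<close> by the push-forward of parities.  Two structures
  of this kind that differ in one parity predicate realise the same type iff there are odd finite sets
  \<open>\<phi> f \<subseteq> T\<close> with \<open>\<phi> f' = \<pi>\<^sub>* (\<phi> f)\<close> along these relations.  Over a small set of parameters a single point \<open>x\<close> of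
  \<open>X\<close> provides \<open>\<phi> f = {f x}\<close>.  A global \<open>\<phi>\<close> yields a complete ultrafilter extending \<open>F\<close>: pass to an \<open>f\<^sub>0\<close> for
  which \<open>\<phi> f\<^sub>0\<close> has maximal size, choose a point of it and follow it through all refinements of \<open>f\<^sub>0\<close>.
\<close>

section \<open>Small sets\<close>

text \<open>An abstract class comes without formulas, so Los's theorem is replaced by counting
  isomorphism types modulo an ultrafilter. Amalgamation is not assumed, so equality of types means a
  finite chain of common extensions, and both directions must carry data along such chains: link by
  link through an ultraproduct, or as a section of fibres pulled back at each link.

  Parity has two uses in the converse. Translating each fibre by one generator exchanges even and
  odd, so one point of \<open>X\<close> identifies the two structures over few parameters; yet an
  odd set is nonempty, so a global selector still points at something. Coding countable sequences in
  \<open>T\<close> lets one function refine countably many; this bounds the sizes of the selected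
  sets, and beyond a set of maximal size push-forwards cannot cancel.

  Tameness of one class yields only, for each k, a k' such that k'-complete filters extend to
  k-complete ultrafilters. The two cardinals differ, which is why the limit of \<omega> such steps
  is almost strongly compact and not visibly strongly compact.\<close>

lemma elts_eq_iff: "elts x = elts y \<longleftrightarrow> x = (y :: 'v::zfc_universe)"
  by (metis extensionality)

lemma vset_elts [simp]: "vset (elts x) = x"
  unfolding vset_def elts_eq_iff by simp

lemma elts_vset: "small X \<Longrightarrow> elts (vset X) = X"
  unfolding small_def by (metis vset_elts)

lemma small_elts [simp]: "small (elts x)"
  by (auto simp: small_def)

lemma vset_eq_iff: "small X \<Longrightarrow> small Y \<Longrightarrow> vset X = vset Y \<longleftrightarrow> X = Y"
  by (metis elts_vset)

lemma small_subset: "small Y \<Longrightarrow> X \<subseteq> Y \<Longrightarrow> small X"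
  unfolding small_def by (metis separation)

lemma small_image: "small X \<Longrightarrow> small (f ` X)" for f :: "'v::zfc_universe \<Rightarrow> 'v"
  unfolding small_def by (metis replacement)

lemma small_UN:
  fixes f :: "'v::zfc_universe \<Rightarrow> 'v set"
  assumes "small I" "\<And>i. i \<in> I \<Longrightarrow> small (f i)"
  shows "small (\<Union>i\<in>I. f i)"
proof -
  define z where "z = vset ((\<lambda>i. vset (f i)) ` I)"
  have "elts z = (\<lambda>i. vset (f i)) ` I"
    unfolding z_def by (rule elts_vset) (rule small_image[OF assms(1)])
  then have "(\<Union>y \<in> elts z. elts y) = (\<Union>i\<in>I. f i)"
    using assms(2) by (auto simp: elts_vset)
  with union[of z] show ?thesis
    unfolding small_def by simp
qed

lemma small_empty [simp]: "small ({} :: 'v::zfc_universe set)"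
  by (rule small_subset[OF small_elts]) simp

lemma small_doubleton [simp]: "small {x, y}"
  unfolding small_def by (rule pairing)

lemma small_singleton [simp]: "small {x}"
  using small_doubleton[of x x] by simp

lemma small_Un: 
  fixes A B :: "'v::zfc_universe set"
  assumes "small A" "small B" shows "small (A \<union> B)"
proof -
  have "small (\<Union>i \<in> {vset A, vset B}. elts i)"
    by (rule small_UN) auto
  then show ?thesis using assms by (simp add: elts_vset)
qed

lemma small_insert: "small A \<Longrightarrow> small (insert a A)"
  using small_Un[OF small_singleton[of a]] by simp

lemma small_lepoll:
  fixes A B :: "'v::zfc_universe set"
  assumes "A \<lesssim> B" "small B" shows "small A"
proof -
  obtain g where "A \<subseteq> g ` B" using assms(1) unfolding lepoll_iff by blast
  then show ?thesis by (rule small_subset[OF small_image[OF assms(2)]])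
qed

lemma not_small_UNIV: "\<not> small (UNIV :: 'v::zfc_universe set)"
proof
  assume u: "small (UNIV :: 'v set)"
  define r :: 'v where "r = vset {x. x \<notin> elts x}"
  have "elts r = {x. x \<notin> elts x}"
    unfolding r_def by (rule elts_vset) (rule small_subset[OF u], simp)
  then show False by blast
qed

lemma elts_induct [case_names less]:
  fixes a :: "'v::zfc_universe"
  assumes "\<And>x. (\<And>y. y \<in> elts x \<Longrightarrow> P y) \<Longrightarrow> P x"
  shows "P a"
  using foundation assms by (rule wf_induct_rule) simp

lemma elts_minimal:
  fixes a :: "'v::zfc_universe"
  assumes "P a" obtains m where "P m" "\<And>y. y \<in> elts m \<Longrightarrow> \<not> P y"
  using wfE_min[OF foundation, of a "Collect P"] assms by auto

lemma elts_irrefl: "x \<notin> elts x" for x :: "'v::zfc_universe"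
  using foundation by (metis case_prodI mem_Collect_eq wf_not_refl)

text \<open>\<open>small\<close> speaks about sets of elements of the universe only. This variant
  measures sets of any type by cardinality, so that pairs, functions, families of sets and datatype
  values can be counted and then coded by elements of the universe.\<close>

definition setlike :: "'v::zfc_universe itself \<Rightarrow> 'b set \<Rightarrow> bool" where
  "setlike _ A \<longleftrightarrow> (\<exists>x :: 'v. A \<lesssim> elts x)"

lemma setlike_lepoll: "A \<lesssim> B \<Longrightarrow> setlike TYPE('v::zfc_universe) B \<Longrightarrow> setlike TYPE('v::zfc_universe) A"
  unfolding setlike_def using lepoll_trans by blast

lemma setlike_subset: "setlike TYPE('v::zfc_universe) B \<Longrightarrow> A \<subseteq> B \<Longrightarrow> setlike TYPE('v::zfc_universe) A"
  using setlike_lepoll subset_imp_lepoll by blast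

lemma setlike_image: "setlike TYPE('v::zfc_universe) A \<Longrightarrow> setlike TYPE('v::zfc_universe) (f ` A)"
  using setlike_lepoll image_lepoll by blast

lemma setlike_small:
  fixes A :: "'v::zfc_universe set"
  shows "setlike TYPE('v::zfc_universe) A \<longleftrightarrow> small A"
  unfolding setlike_def using small_lepoll[OF _ small_elts] lepoll_refl
  by (auto simp: small_def)

lemma setlikeE:
  assumes "setlike TYPE('v::zfc_universe) A"
  obtains c :: "_ \<Rightarrow> 'v::zfc_universe" where "inj_on c A" "small (c ` A)"
proof -
  obtain x :: 'v and c where c: "inj_on c A" "c ` A \<subseteq> elts x"
    using assms unfolding setlike_def lepoll_def by blast
  show ?thesis by (rule that[OF c(1) small_subset[OF small_elts c(2)]])
qed

lemma setlike_inj_on: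
  fixes c :: "_ \<Rightarrow> 'v::zfc_universe"
  assumes "inj_on c A" "small (c ` A)" shows "setlike TYPE('v::zfc_universe) A"
proof -
  have "c ` A \<subseteq> elts (vset (c ` A))" by (simp add: elts_vset assms(2))
  with assms(1) show ?thesis unfolding setlike_def lepoll_def by blast
qed

lemma setlike_Pow: 
  assumes "setlike TYPE('v::zfc_universe) A" shows "setlike TYPE('v::zfc_universe) (Pow A)"
proof -
  obtain x :: 'v and c where c: "inj_on c A" "c ` A \<subseteq> elts x"
    using assms unfolding setlike_def lepoll_def by blast
  obtain y where y: "elts y = {z. elts z \<subseteq> elts x}"
    using powerset by blast
  have s: "small (c ` B)" if "B \<subseteq> A" for B
    using that c(2) by (intro small_subset[OF small_elts[of x]]) auto
  have "inj_on (\<lambda>B. vset (c ` B)) (Pow A)"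
  proof (rule inj_onI)
    fix B C assume BC: "B \<in> Pow A" "C \<in> Pow A" "vset (c ` B) = vset (c ` C)"
    then have "c ` B = c ` C" using s by (simp add: vset_eq_iff)
    with BC show "B = C" using inj_on_image_eq_iff[OF c(1)] by auto
  qed
  moreover have "(\<lambda>B. vset (c ` B)) ` Pow A \<subseteq> elts y"
    using c(2) s unfolding y by (fastforce simp: elts_vset)
  ultimately show ?thesis
    unfolding setlike_def lepoll_def by blast
qed

text \<open>Kuratowski pairs.\<close>

definition vpair :: "'v::zfc_universe \<Rightarrow> 'v \<Rightarrow> 'v" where
  "vpair a b = vset {vset {a}, vset {a, b}}"

lemma vpair_eq_iff [simp]: "vpair a b = vpair c d \<longleftrightarrow> a = c \<and> b = d"
  unfolding vpair_def by (auto simp: vset_eq_iff doubleton_eq_iff)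

lemma setlike_Times:
  assumes "setlike TYPE('v::zfc_universe) A" "setlike TYPE('v::zfc_universe) B" shows "setlike TYPE('v::zfc_universe) (A \<times> B)"
proof -
  obtain c :: "_ \<Rightarrow> 'v" where c: "inj_on c A" "small (c ` A)" using assms(1) by (rule setlikeE)
  obtain d :: "_ \<Rightarrow> 'v" where d: "inj_on d B" "small (d ` B)" using assms(2) by (rule setlikeE)
  have "small (\<Union>a \<in> c ` A. vpair a ` d ` B)"
    by (intro small_UN c small_image d)
  moreover have "(\<lambda>(a, b). vpair (c a) (d b)) ` (A \<times> B) \<subseteq> (\<Union>a \<in> c ` A. vpair a ` d ` B)"
    by auto
  moreover have "inj_on (\<lambda>(a, b). vpair (c a) (d b)) (A \<times> B)"
    using c(1) d(1) by (auto simp: inj_on_def)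
  ultimately show ?thesis
    using setlike_inj_on small_subset by metis
qed

lemma setlike_Sigma:
  assumes "setlike TYPE('v::zfc_universe) I" "\<And>i. i \<in> I \<Longrightarrow> setlike TYPE('v::zfc_universe) (A i)"
  shows "setlike TYPE('v::zfc_universe) (Sigma I A)"
proof -
  obtain c :: "_ \<Rightarrow> 'v" where c: "inj_on c I" "small (c ` I)" using assms(1) by (rule setlikeE)
  have "\<forall>i. \<exists>d. i \<in> I \<longrightarrow> inj_on d (A i) \<and> small (d ` A i :: 'v set)"
    using assms(2) setlikeE by metis
  then obtain d :: "_ \<Rightarrow> _ \<Rightarrow> 'v" where d: "\<And>i. i \<in> I \<Longrightarrow> inj_on (d i) (A i) \<and> small (d i ` A i)"
    by metis
  \<comment> \<open>The codings of the fibres are chosen independently and may overlap;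
    \<open>S\<close> collects all their values, and the index kept as first coordinate tells the
    fibres apart.\<close>
  define S where "S = (\<Union>j \<in> c ` I. d (inv_into I c j) ` A (inv_into I c j))"
  have "small S"
    unfolding S_def using c d by (intro small_UN) auto
  have sub: "d i ` A i \<subseteq> S" if "i \<in> I" for i
    using that c unfolding S_def by (auto intro!: bexI[of _ i])
  have "inj_on (\<lambda>(i, a). (i, d i a)) (Sigma I A)"
    using d by (auto simp: inj_on_def)
  moreover have "(\<lambda>(i, a). (i, d i a)) ` Sigma I A \<subseteq> I \<times> S"
    using sub by auto
  ultimately have "Sigma I A \<lesssim> I \<times> S"
    unfolding lepoll_def by blast
  moreover have "setlike TYPE('v::zfc_universe) (I \<times> S)"
    using assms(1) \<open>small S\<close> by (intro setlike_Times) (simp_all add: setlike_small)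
  ultimately show ?thesis by (rule setlike_lepoll)
qed

lemma setlike_UN:
  assumes "setlike TYPE('v::zfc_universe) I" "\<And>i. i \<in> I \<Longrightarrow> setlike TYPE('v::zfc_universe) (A i)"
  shows "setlike TYPE('v::zfc_universe) (\<Union>i\<in>I. A i)"
proof -
  have "(\<Union>i\<in>I. A i) = snd ` Sigma I A" by force
  then show ?thesis using setlike_image[OF setlike_Sigma[OF assms]] by simp
qed

text \<open>An extensional function is determined by its graph, a subset of the dependent
  sum.\<close>

lemma setlike_PiE:
  assumes "setlike TYPE('v::zfc_universe) I" "\<And>i. i \<in> I \<Longrightarrow> setlike TYPE('v::zfc_universe) (A i)"
  shows "setlike TYPE('v::zfc_universe) (Pi\<^sub>E I A)"
proof -
  have "inj_on (\<lambda>f. (\<lambda>i. (i, f i)) ` I) (Pi\<^sub>E I A)"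
  proof (rule inj_onI)
    fix f g assume fg: "f \<in> Pi\<^sub>E I A" "g \<in> Pi\<^sub>E I A" 
      and "(\<lambda>i. (i, f i)) ` I = (\<lambda>i. (i, g i)) ` I"
    then have "f i = g i" if "i \<in> I" for i using that by auto
    with fg show "f = g" by (rule PiE_ext)
  qed
  moreover have "(\<lambda>f. (\<lambda>i. (i, f i)) ` I) ` Pi\<^sub>E I A \<subseteq> Pow (Sigma I A)"
    by auto
  ultimately have "Pi\<^sub>E I A \<lesssim> Pow (Sigma I A)"
    unfolding lepoll_def by blast
  then show ?thesis
    using setlike_Pow[OF setlike_Sigma[OF assms]] by (rule setlike_lepoll)
qed

lemma setlike_Un:
  assumes "setlike TYPE('v::zfc_universe) A" "setlike TYPE('v::zfc_universe) B" shows "setlike TYPE('v::zfc_universe) (A \<union> B)"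
proof -
  have two: "setlike TYPE('v::zfc_universe) (UNIV :: bool set)"
    by (rule setlike_inj_on[where c = "\<lambda>b. if b then vset {} else vset {vset {}}"])
      (auto simp: inj_on_def vset_eq_iff UNIV_bool)
  have "setlike TYPE('v::zfc_universe) (\<Union>b \<in> UNIV. if b then A else B)"
    by (rule setlike_UN[OF two]) (use assms in auto)
  then show ?thesis by (simp add: UNIV_bool Un_commute)
qed

lemma setlike_Plus:
  assumes "setlike TYPE('v::zfc_universe) A" "setlike TYPE('v::zfc_universe) B" shows "setlike TYPE('v::zfc_universe) (A <+> B)"
  unfolding Plus_def using assms by (intro setlike_Un setlike_image)

lemma setlike_nat: "setlike TYPE('v::zfc_universe) (UNIV :: nat set)"
proof -
  obtain x :: 'v where x: "(\<exists>z \<in> elts x. elts z = {}) \<and>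
      (\<forall>y \<in> elts x. \<exists>s \<in> elts x. elts s = insert y (elts y))"
    using infinity by (rule exE)
  then obtain z where z: "z \<in> elts x" "elts z = {}" by blast
  have s: "\<And>y. y \<in> elts x \<Longrightarrow> \<exists>s \<in> elts x. elts s = insert y (elts y)"
    using x by blast
  obtain f where f: "\<And>y. y \<in> elts x \<Longrightarrow> f y \<in> elts x \<and> elts (f y) = insert y (elts y)"
    using s by metis
  define h where "h n = (f ^^ n) z" for n :: nat
  have h: "h n \<in> elts x" for n
    by (induction n) (use z f in \<open>auto simp: h_def\<close>)
  have e: "elts (h (Suc n)) = insert (h n) (elts (h n))" for n
    using f[OF h[of n]] by (simp add: h_def)
  have lt: "m < n \<Longrightarrow> h m \<in> elts (h n)" for m n
    by (induction n) (auto simp: e less_Suc_eq)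
  \<comment> \<open>Iterated successors are distinct because each one contains all earlier ones and
    membership is irreflexive.\<close>
  have "inj h"
    by (rule linorder_injI) (metis lt elts_irrefl)
  then show ?thesis
    unfolding setlike_def lepoll_def using h by blast
qed

lemma setlike_countable: "countable A \<Longrightarrow> setlike TYPE('v::zfc_universe) A"
  by (meson countable_def lepoll_def setlike_lepoll setlike_nat subset_UNIV)

text \<open>Pairing all codes with one tag \<open>a\<close> gives a disjoint copy for a suitable
  \<open>a\<close>: if every tag met \<open>A\<close>, the universe would inject into
  \<open>A\<close>.\<close>

lemma fresh_copy:
  fixes A :: "'v::zfc_universe set"
  assumes "small A" "setlike TYPE('v::zfc_universe) Y"
  obtains c :: "_ \<Rightarrow> 'v::zfc_universe" where "inj_on c Y" "c ` Y \<inter> A = {}" "small (c ` Y)"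
proof -
  obtain d :: "_ \<Rightarrow> 'v" where d: "inj_on d Y" "small (d ` Y)" using assms(2) by (rule setlikeE)
  have "\<exists>a. \<forall>y \<in> Y. vpair a (d y) \<notin> A"
  proof (rule ccontr)
    assume "\<not> ?thesis"
    then have "\<forall>a. \<exists>y \<in> Y. vpair a (d y) \<in> A" by blast
    then obtain y where y: "\<And>a. vpair a (d (y a)) \<in> A" by metis
    have "inj (\<lambda>a. vpair a (d (y a)))" by (auto simp: inj_on_def)
    then have "(UNIV :: 'v set) \<lesssim> A" unfolding lepoll_def using y by blast
    with assms(1) show False using small_lepoll not_small_UNIV by blast
  qed
  then obtain a where a: "\<And>y. y \<in> Y \<Longrightarrow> vpair a (d y) \<notin> A" by blast
  show ?thesis
  proof
    show "inj_on (\<lambda>y. vpair a (d y)) Y" using d(1) by (auto simp: inj_on_def)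
    show "(\<lambda>y. vpair a (d y)) ` Y \<inter> A = {}" using a by auto
    show "small ((\<lambda>y. vpair a (d y)) ` Y)"
      using small_image[OF d(2), of "vpair a"] by (simp add: image_image)
  qed
qed

section \<open>Ordinals and cardinals\<close>

lemma Ord_mem: "Ord \<alpha> \<Longrightarrow> \<beta> \<in> elts \<alpha> \<Longrightarrow> Ord \<beta>"
  unfolding Ord_def by (meson in_mono)

lemma Ord_trans: "Ord \<alpha> \<Longrightarrow> \<beta> \<in> elts \<alpha> \<Longrightarrow> \<gamma> \<in> elts \<beta> \<Longrightarrow> \<gamma> \<in> elts \<alpha>"
  unfolding Ord_def by blast

lemma Ord_elts_subset: "Ord \<alpha> \<Longrightarrow> \<beta> \<in> elts \<alpha> \<Longrightarrow> elts \<beta> \<subseteq> elts \<alpha>"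
  unfolding Ord_def by blast

lemma Ord_vset: "small X \<Longrightarrow> (\<And>x. x \<in> X \<Longrightarrow> Ord x) \<Longrightarrow> (\<And>x y. x \<in> X \<Longrightarrow> y \<in> elts x \<Longrightarrow> y \<in> X) \<Longrightarrow> Ord (vset X)"
  unfolding Ord_def by (auto simp: elts_vset)

lemma Ord_linear:
  assumes "Ord \<alpha>" "Ord \<beta>" shows "\<alpha> \<in> elts \<beta> \<or> \<alpha> = \<beta> \<or> \<beta> \<in> elts \<alpha>"
  using assms
proof (induction \<alpha> arbitrary: \<beta> rule: elts_induct)
  case (less \<alpha>)
  note outer = less
  from less.prems(2) show ?case
  proof (induction \<beta> rule: elts_induct)
    case (less \<beta>)
    have "elts \<alpha> \<subseteq> elts \<beta> \<and> elts \<beta> \<subseteq> elts \<alpha>" if "\<alpha> \<notin> elts \<beta>" "\<beta> \<notin> elts \<alpha>"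
    proof (intro conjI subsetI)
      fix x assume "x \<in> elts \<alpha>"
      then show "x \<in> elts \<beta>"
        using outer(1)[OF _ Ord_mem[OF outer(2)] less.prems] that Ord_trans[OF outer(2)] by metis
    next
      fix x assume "x \<in> elts \<beta>"
      then show "x \<in> elts \<alpha>"
        using less.IH[OF _ Ord_mem[OF less.prems]] that Ord_trans[OF less.prems] by metis
    qed
    then show ?case using extensionality by blast
  qed
qed

text \<open>Burali-Forti: the set of all ordinals would be an ordinal that contains itself.\<close>

lemma not_small_Ord: "\<not> small {\<alpha> :: 'v::zfc_universe. Ord \<alpha>}"
proof
  assume s: "small {\<alpha> :: 'v. Ord \<alpha>}"
  have "Ord (vset {\<alpha> :: 'v. Ord \<alpha>})"
    by (rule Ord_vset[OF s]) (auto intro: Ord_mem)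
  then have "vset {\<alpha> :: 'v. Ord \<alpha>} \<in> elts (vset {\<alpha> :: 'v. Ord \<alpha>})"
    by (simp add: elts_vset[OF s])
  then show False using elts_irrefl by blast
qed

text \<open>Enumerate \<open>A\<close> along the ordinals; injectivity on all ordinals would make them a set.\<close>

lemma ex_Ord_eqpoll:
  fixes A :: "'v::zfc_universe set"
  assumes "small A" shows "\<exists>\<alpha> :: 'v. Ord \<alpha> \<and> elts \<alpha> \<approx> A"
proof -
  define g where "g B = (SOME a. a \<in> A - B)" for B
  define f :: "'v \<Rightarrow> 'v" where "f = wfrec {(x, y). x \<in> elts y} (\<lambda>f x. g (f ` elts x))"
  have f: "f x = g (f ` elts x)" for x :: 'v
    unfolding f_def by (subst wfrec[OF foundation]) (auto simp: cut_def intro!: arg_cong[where f=g])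
  have fm: "f x \<in> A - f ` elts x" if "\<not> A \<subseteq> f ` elts x" for x
    using that unfolding f[of x] g_def by (metis DiffI someI_ex subsetI)
  have inj: "inj_on f X" if X: "\<And>x. x \<in> X \<Longrightarrow> Ord x \<and> \<not> A \<subseteq> f ` elts x" for X
  proof (rule inj_onI)
    fix x y assume xy: "x \<in> X" "y \<in> X" "f x = f y"
    then have "x \<notin> elts y" "y \<notin> elts x" using fm X by (metis DiffD2 imageI)+
    then show "x = y" using Ord_linear X xy by blast
  qed
  have "\<exists>\<alpha>. Ord \<alpha> \<and> A \<subseteq> f ` elts \<alpha>"
  proof (rule ccontr)
    assume no: "\<not> ?thesis"
    then have "inj_on f {\<alpha>. Ord \<alpha>}" using inj by blast
    moreover have "f ` {\<alpha>. Ord \<alpha>} \<subseteq> A" using no fm by blast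
    ultimately have "{\<alpha> :: 'v. Ord \<alpha>} \<lesssim> A" unfolding lepoll_def by (intro exI conjI)
    with assms show False using small_lepoll not_small_Ord by blast
  qed
  then obtain \<alpha>\<^sub>0 where "Ord \<alpha>\<^sub>0 \<and> A \<subseteq> f ` elts \<alpha>\<^sub>0" ..
  then obtain \<alpha> where \<alpha>: "Ord \<alpha> \<and> A \<subseteq> f ` elts \<alpha>" 
    and min: "\<And>\<beta>. \<beta> \<in> elts \<alpha> \<Longrightarrow> \<not> (Ord \<beta> \<and> A \<subseteq> f ` elts \<beta>)"
    by (rule elts_minimal[where P = "\<lambda>\<alpha>. Ord \<alpha> \<and> A \<subseteq> f ` elts \<alpha>"]) (rule that)
  have m: "Ord \<beta> \<and> \<not> A \<subseteq> f ` elts \<beta>" if "\<beta> \<in> elts \<alpha>" for \<beta>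
    using min[OF that] \<alpha> Ord_mem that by blast
  have "f ` elts \<alpha> = A" using \<alpha> fm m by blast
  with inj[OF m] show ?thesis using \<alpha> unfolding eqpoll_def bij_betw_def by blast
qed

section \<open>Cardinals and arithmetic of infinite sizes\<close>

lemma ex_Card_eqpoll:
  assumes "setlike TYPE('v::zfc_universe) A" obtains \<kappa> :: "'v::zfc_universe" where "Card \<kappa>" "elts \<kappa> \<approx> A"
proof -
  obtain c :: "_ \<Rightarrow> 'v" where c: "inj_on c A" "small (c ` A)" using assms by (rule setlikeE)
  obtain \<alpha> :: 'v where "Ord \<alpha>" "elts \<alpha> \<approx> c ` A" using ex_Ord_eqpoll[OF c(2)] by blast
  then have "Ord \<alpha> \<and> elts \<alpha> \<approx> A" using c(1) by simp
  then obtain \<kappa> :: 'v where \<kappa>: "Ord \<kappa> \<and> elts \<kappa> \<approx> A"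
    and min: "\<And>\<beta>. \<beta> \<in> elts \<kappa> \<Longrightarrow> \<not> (Ord \<beta> \<and> elts \<beta> \<approx> A)"
    by (rule elts_minimal[where P = "\<lambda>\<alpha>. Ord \<alpha> \<and> elts \<alpha> \<approx> A"]) (rule that)
  have "elts \<beta> \<prec> elts \<kappa>" if \<beta>: "\<beta> \<in> elts \<kappa>" for \<beta>
  proof -
    have "elts \<beta> \<lesssim> elts \<kappa>" using \<beta> \<kappa> Ord_elts_subset subset_imp_lepoll by blast
    moreover have "\<not> elts \<beta> \<approx> elts \<kappa>" 
      using min[OF \<beta>] \<kappa> Ord_mem \<beta> eqpoll_trans by blast
    ultimately show ?thesis by (simp add: lesspoll_def)
  qed
  then have "Card \<kappa>" using \<kappa> unfolding Card_def by blast
  then show ?thesis using that \<kappa> by blast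
qed

lemma Card_Ord: "Card \<kappa> \<Longrightarrow> Ord \<kappa>" by (simp add: Card_def)

lemma Card_mem_lesspoll: "Card \<kappa> \<Longrightarrow> \<alpha> \<in> elts \<kappa> \<Longrightarrow> elts \<alpha> \<prec> elts \<kappa>"
  by (simp add: Card_def)

lemma Card_mem_iff_lesspoll: 
  assumes "Card \<kappa>" "Card \<nu>" shows "\<nu> \<in> elts \<kappa> \<longleftrightarrow> elts \<nu> \<prec> elts \<kappa>"
proof
  assume l: "elts \<nu> \<prec> elts \<kappa>"
  have "\<kappa> \<notin> elts \<nu>" "\<kappa> \<noteq> \<nu>"
    using l Card_mem_lesspoll[OF assms(2)] lesspoll_trans lesspoll_not_refl by blast+
  then show "\<nu> \<in> elts \<kappa>" using Ord_linear assms Card_Ord by blast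
qed (use assms Card_mem_lesspoll in blast)

lemma infinite_Times_lepoll:
  assumes "infinite C" "A \<lesssim> C" "B \<lesssim> C" shows "A \<times> B \<lesssim> C"
proof -
  have "C \<times> C \<approx> C"
    unfolding eqpoll_iff_card_of_ordIso
    using card_of_Times_same_infinite[OF assms(1)] by blast
  then show ?thesis using times_lepoll_mono[OF assms(2,3)] lepoll_trans2 by blast
qed

lemma infinite_UN_lepoll:
  assumes "infinite C" "I \<lesssim> C" "\<And>i. i \<in> I \<Longrightarrow> A i \<lesssim> C" shows "(\<Union>i\<in>I. A i) \<lesssim> C"
  using card_of_UNION_ordLeq_infinite[OF assms(1), of I A] assms(2,3)
  unfolding lepoll_def card_of_ordLeq by blast

lemma infinite_Un_lepoll:
  assumes "infinite C" "A \<lesssim> C" "B \<lesssim> C" shows "A \<union> B \<lesssim> C"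
proof -
  have "(\<Union>b \<in> UNIV. if b then A else B) \<lesssim> C"
    by (rule infinite_UN_lepoll[OF assms(1)]) (use assms in \<open>auto simp: finite_lepoll_infinite\<close>)
  then show ?thesis by (simp add: UNIV_bool Un_commute)
qed

lemma infinite_Plus_lepoll:
  assumes "infinite C" "A \<lesssim> C" "B \<lesssim> C" shows "A <+> B \<lesssim> C"
  unfolding Plus_def
  by (intro infinite_Un_lepoll assms lepoll_trans[OF image_lepoll])

lemma lepoll_Plus1: "A \<lesssim> A <+> B" and lepoll_Plus2: "B \<lesssim> A <+> B"
  unfolding lepoll_def by (rule exI[of _ Inl], auto) (rule exI[of _ Inr], auto)

section \<open>Substructures and embeddings\<close>

text \<open>Submodels are treated as subsets of one ambient structure. The interpretations are cut
  down to extensional functions on \<open>B\<close>, so that a substructure is literally equal to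
  the restriction to its universe (\<open>substruc_eq_restr\<close>).\<close>

definition restr_struc :: "'v::zfc_universe language \<Rightarrow> 'v struc \<Rightarrow> 'v set \<Rightarrow> 'v struc" where
  "restr_struc L N B = \<lparr>univ = B,
     fint = (\<lambda>s \<in> fsyms L. \<lambda>x \<in> elts (far L s) \<rightarrow>\<^sub>E B. fint N s x),
     rint = (\<lambda>s \<in> rsyms L. rint N s \<inter> (elts (rar L s) \<rightarrow>\<^sub>E B))\<rparr>"

definition closed_in :: "'v::zfc_universe language \<Rightarrow> 'v struc \<Rightarrow> 'v set \<Rightarrow> bool" where
  "closed_in L N B \<longleftrightarrow> B \<subseteq> univ N \<and> B \<noteq> {} \<and>
     (\<forall>s \<in> fsyms L. \<forall>x \<in> elts (far L s) \<rightarrow>\<^sub>E B. fint N s x \<in> B)"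

lemma univ_restr [simp]: "univ (restr_struc L N B) = B"
  by (simp add: restr_struc_def)

lemma fint_restr: "s \<in> fsyms L \<Longrightarrow> x \<in> elts (far L s) \<rightarrow>\<^sub>E B \<Longrightarrow> fint (restr_struc L N B) s x = fint N s x"
  by (simp add: restr_struc_def)

lemma rint_restr: "s \<in> rsyms L \<Longrightarrow> rint (restr_struc L N B) s = rint N s \<inter> (elts (rar L s) \<rightarrow>\<^sub>E B)"
  by (simp add: restr_struc_def)

lemma PiE_range_mono: "A \<subseteq> B \<Longrightarrow> x \<in> I \<rightarrow>\<^sub>E A \<Longrightarrow> x \<in> I \<rightarrow>\<^sub>E B"
  by (auto simp: PiE_iff)

lemma is_struc_fint: 
  "is_struc L N \<Longrightarrow> s \<in> fsyms L \<Longrightarrow> x \<in> elts (far L s) \<rightarrow>\<^sub>E univ N \<Longrightarrow> fint N s x \<in> univ N"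
proof -
  assume N: "is_struc L N" and s: "s \<in> fsyms L" and x: "x \<in> elts (far L s) \<rightarrow>\<^sub>E univ N"
  have "fint N \<in> (\<Pi>\<^sub>E s \<in> fsyms L. (elts (far L s) \<rightarrow>\<^sub>E univ N) \<rightarrow>\<^sub>E univ N)"
    using N by (simp add: is_struc_def)
  from PiE_mem[OF PiE_mem[OF this s] x] show ?thesis .
qed

lemma is_struc_rint: "is_struc L N \<Longrightarrow> s \<in> rsyms L \<Longrightarrow> rint N s \<subseteq> (elts (rar L s) \<rightarrow>\<^sub>E univ N)"
  unfolding is_struc_def by (meson PiE_mem PowD)

lemma closed_in_subset: "closed_in L N B \<Longrightarrow> B \<subseteq> univ N"
  by (simp add: closed_in_def)

lemma is_struc_restr:
  assumes "is_struc L N" "closed_in L N B" shows "is_struc L (restr_struc L N B)"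
proof -
  have "small B" using assms unfolding is_struc_def closed_in_def by (metis small_subset)
  then show ?thesis
    using assms(2) unfolding is_struc_def closed_in_def restr_struc_def by auto
qed

lemma substruc_restr:
  assumes "is_struc L N" "closed_in L N B" shows "substruc L (restr_struc L N B) N"
  unfolding substruc_def using assms is_struc_restr[OF assms]
  by (auto simp: fint_restr rint_restr closed_in_def)

lemma substruc_restr_mono:
  assumes "is_struc L N" "closed_in L N B" "closed_in L N C" "B \<subseteq> C"
  shows "substruc L (restr_struc L N B) (restr_struc L N C)"
  unfolding substruc_def using assms is_struc_restr[OF assms(1)]
  by (auto simp: fint_restr rint_restr PiE_range_mono[OF assms(4)])

lemma restr_restr: "B \<subseteq> C \<Longrightarrow> restr_struc L (restr_struc L N C) B = restr_struc L N B"
  unfolding restr_struc_def by (auto simp: PiE_range_mono intro!: restrict_ext)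

lemma substruc_closed_in: 
  assumes "substruc L M N" shows "closed_in L N (univ M)"
  using assms is_struc_fint[of L M] unfolding closed_in_def substruc_def 
  by (auto simp: is_struc_def) 

lemma struc_eqI:
  assumes M: "is_struc L M" and N: "is_struc L N" and u: "univ M = univ N"
    and f: "\<And>s x. s \<in> fsyms L \<Longrightarrow> x \<in> elts (far L s) \<rightarrow>\<^sub>E univ M \<Longrightarrow> fint M s x = fint N s x"
    and r: "\<And>s x. s \<in> rsyms L \<Longrightarrow> x \<in> elts (rar L s) \<rightarrow>\<^sub>E univ M \<Longrightarrow> x \<in> rint M s \<longleftrightarrow> x \<in> rint N s"
  shows "M = N"
proof -
  have fM: "fint M \<in> (\<Pi>\<^sub>E s \<in> fsyms L. (elts (far L s) \<rightarrow>\<^sub>E univ M) \<rightarrow>\<^sub>E univ M)"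
    and fN: "fint N \<in> (\<Pi>\<^sub>E s \<in> fsyms L. (elts (far L s) \<rightarrow>\<^sub>E univ M) \<rightarrow>\<^sub>E univ M)"
    and rM: "rint M \<in> (\<Pi>\<^sub>E s \<in> rsyms L. Pow (elts (rar L s) \<rightarrow>\<^sub>E univ M))"
    and rN: "rint N \<in> (\<Pi>\<^sub>E s \<in> rsyms L. Pow (elts (rar L s) \<rightarrow>\<^sub>E univ M))"
    using M N u unfolding is_struc_def by auto
  have "fint M = fint N"
  proof (rule PiE_ext[OF fM fN])
    fix s assume "s \<in> fsyms L"
    then show "fint M s = fint N s"
      by (intro PiE_ext[OF PiE_mem[OF fM] PiE_mem[OF fN]] f)
  qed
  moreover have "rint M = rint N"
  proof (rule PiE_ext[OF rM rN])
    fix s assume "s \<in> rsyms L"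
    then show "rint M s = rint N s"
      using PiE_mem[OF rM] PiE_mem[OF rN] r by blast
  qed
  ultimately show ?thesis using u by simp
qed

lemma substruc_eq_restr:
  assumes "substruc L M N" shows "M = restr_struc L N (univ M)"
proof (rule struc_eqI)
  have N: "is_struc L N" using assms by (simp add: substruc_def)
  show "is_struc L M" using assms by (simp add: substruc_def)
  show "is_struc L (restr_struc L N (univ M))"
    by (rule is_struc_restr[OF N substruc_closed_in[OF assms]])
qed (use assms in \<open>auto simp: substruc_def fint_restr rint_restr\<close>)

lemma substruc_refl: "is_struc L M \<Longrightarrow> substruc L M M"
  by (simp add: substruc_def)

lemma restr_univ: "is_struc L N \<Longrightarrow> restr_struc L N (univ N) = N"
  using substruc_eq_restr[OF substruc_refl] by metis

lemma substruc_trans: 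
  assumes "substruc L M N" "substruc L N P" shows "substruc L M P"
proof -
  have sub: "univ M \<subseteq> univ N" using assms(1) by (simp add: substruc_def)
  note T = PiE_range_mono[OF sub]
  show ?thesis
    using assms unfolding substruc_def by (simp add: T) blast
qed

lemma compose_PiE: "(\<And>a. a \<in> A \<Longrightarrow> f a \<in> B) \<Longrightarrow> x \<in> I \<rightarrow>\<^sub>E A \<Longrightarrow> compose I f x \<in> I \<rightarrow>\<^sub>E B"
  by (auto simp: compose_def PiE_iff)

lemma compose_inj_on:
  assumes "inj_on f A" "x \<in> I \<rightarrow>\<^sub>E A" "y \<in> I \<rightarrow>\<^sub>E A" "compose I f x = compose I f y" shows "x = y"
proof (rule PiE_ext[OF assms(2,3)])
  fix i assume i: "i \<in> I"
  then have "f (x i) = f (y i)" using fun_cong[OF assms(4), of i] by (simp add: compose_def)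
  then show "x i = y i" using inj_onD[OF assms(1)] PiE_mem[OF assms(2) i] PiE_mem[OF assms(3) i] by blast
qed

lemma PiE_image_compose:
  assumes "y \<in> I \<rightarrow>\<^sub>E f ` A" obtains x where "x \<in> I \<rightarrow>\<^sub>E A" "y = compose I f x"
proof
  let ?x = "\<lambda>i\<in>I. inv_into A f (y i)"
  show "?x \<in> I \<rightarrow>\<^sub>E A" using assms by (auto simp: PiE_iff inv_into_into)
  show "y = compose I f ?x"
  proof (rule PiE_ext[OF assms])
    show "compose I f ?x \<in> I \<rightarrow>\<^sub>E f ` A"
      using assms by (auto simp: PiE_iff compose_def inv_into_into)
    show "y i = compose I f ?x i" if "i \<in> I" for i
      using that assms by (auto simp: PiE_iff compose_def f_inv_into_f)
  qed
qed

section \<open>Isomorphisms and transport of structure\<close>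

lemma struc_isoD:
  assumes "struc_iso L f M N"
  shows "is_struc L M" "is_struc L N" "inj_on f (univ M)" "f ` univ M = univ N"
    "s \<in> fsyms L \<Longrightarrow> x \<in> elts (far L s) \<rightarrow>\<^sub>E univ M \<Longrightarrow>
      f (fint M s x) = fint N s (compose (elts (far L s)) f x)"
    "s \<in> rsyms L \<Longrightarrow> x \<in> elts (rar L s) \<rightarrow>\<^sub>E univ M \<Longrightarrow>
      x \<in> rint M s \<longleftrightarrow> compose (elts (rar L s)) f x \<in> rint N s"
  using assms unfolding struc_iso_def bij_betw_def by blast+

lemma struc_iso_restr:
  assumes "struc_iso L f M N" "closed_in L M B"
  shows "closed_in L N (f ` B)" "struc_iso L f (restr_struc L M B) (restr_struc L N (f ` B))"
proof -
  have B: "B \<subseteq> univ M" using assms(2) by (simp add: closed_in_def)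
  note T = PiE_range_mono[OF B]
  have fB: "f ` univ M = univ N" and inj: "inj_on f (univ M)" and MN: "is_struc L M" "is_struc L N"
    using assms(1) by (auto simp: struc_iso_def bij_betw_def)
  have F: "f (fint M s x) = fint N s (compose (elts (far L s)) f x)" 
    if "s \<in> fsyms L" "x \<in> elts (far L s) \<rightarrow>\<^sub>E B" for s x
    using assms(1) that T unfolding struc_iso_def by blast
  have R: "x \<in> rint M s \<longleftrightarrow> compose (elts (rar L s)) f x \<in> rint N s"
    if "s \<in> rsyms L" "x \<in> elts (rar L s) \<rightarrow>\<^sub>E B" for s x
    using assms(1) that T unfolding struc_iso_def by blast
  show c: "closed_in L N (f ` B)"
    unfolding closed_in_def
  proof (intro conjI ballI)
    show "f ` B \<subseteq> univ N" using B fB by blast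
    show "f ` B \<noteq> {}" using assms(2) by (simp add: closed_in_def)
    fix s y assume s: "s \<in> fsyms L" and y: "y \<in> elts (far L s) \<rightarrow>\<^sub>E f ` B"
    obtain x where x: "x \<in> elts (far L s) \<rightarrow>\<^sub>E B" "y = compose (elts (far L s)) f x" 
      using y by (rule PiE_image_compose)
    then show "fint N s y \<in> f ` B"
      using F[OF s x(1)] assms(2) s unfolding closed_in_def by (metis image_eqI)
  qed
  show "struc_iso L f (restr_struc L M B) (restr_struc L N (f ` B))"
    unfolding struc_iso_def
    using is_struc_restr[OF MN(1) assms(2)] is_struc_restr[OF MN(2) c] inj_on_subset[OF inj B]
    by (auto simp: fint_restr rint_restr bij_betw_def F R compose_PiE[of B f "f ` B"])
qed

lemma struc_iso_refl: "is_struc L M \<Longrightarrow> struc_iso L (\<lambda>x. x) M M"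
  by (auto simp: struc_iso_def bij_betw_def compose_def PiE_restrict cong: restrict_cong)

lemma struc_iso_comp:
  assumes "struc_iso L f M N" "struc_iso L g N P" shows "struc_iso L (g \<circ> f) M P"
proof -
  have fN: "\<And>x. x \<in> univ M \<Longrightarrow> f x \<in> univ N" using assms(1) by (auto simp: struc_iso_def bij_betw_def)
  have c: "compose I (g \<circ> f) x = compose I g (compose I f x)" for I :: "'a set" and x
    by (auto simp: compose_def)
  note fx = compose_PiE[of "univ M" f "univ N", OF fN]
  note a = struc_isoD[OF assms(1)] and b = struc_isoD[OF assms(2)]
  show ?thesis
    unfolding struc_iso_def
  proof (intro conjI ballI)
    show "bij_betw (g \<circ> f) (univ M) (univ P)"
      using assms unfolding struc_iso_def by (blast intro: bij_betw_trans)
  qed (use a(1) b(2) in \<open>simp_all add: c a(5,6) b(5,6) fx\<close>)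
qed

lemma struc_iso_inv:
  assumes "struc_iso L f M N" shows "struc_iso L (inv_into (univ M) f) N M"
proof -
  let ?g = "inv_into (univ M) f"
  have b: "bij_betw f (univ M) (univ N)" and MN: "is_struc L M" "is_struc L N"
    using assms by (auto simp: struc_iso_def)
  then have im: "f ` univ M = univ N" by (simp add: bij_betw_def)
  have gf: "\<And>a. a \<in> univ M \<Longrightarrow> ?g (f a) = a" using b by (simp add: bij_betw_def)
  have c: "compose I ?g (compose I f x) = x" if "x \<in> I \<rightarrow>\<^sub>E univ M" for I :: "'a set" and x
    using that gf by (auto simp: compose_def PiE_iff fun_eq_iff extensional_def)
  show ?thesis
    unfolding struc_iso_def
  proof (intro conjI ballI)
    show "bij_betw ?g (univ N) (univ M)" using b by (rule bij_betw_inv_into)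
  next
    fix s y assume s: "s \<in> fsyms L" and "y \<in> elts (far L s) \<rightarrow>\<^sub>E univ N"
    then obtain x where x: "x \<in> elts (far L s) \<rightarrow>\<^sub>E univ M" "y = compose (elts (far L s)) f x" 
      using im by (metis PiE_image_compose)
    have "fint N s y = f (fint M s x)" using assms s x by (simp add: struc_iso_def)
    then show "?g (fint N s y) = fint M s (compose (elts (far L s)) ?g y)"
      using gf is_struc_fint[OF MN(1) s x(1)] by (simp add: x(2) c[OF x(1)])
  next
    fix s y assume s: "s \<in> rsyms L" and "y \<in> elts (rar L s) \<rightarrow>\<^sub>E univ N"
    then obtain x where x: "x \<in> elts (rar L s) \<rightarrow>\<^sub>E univ M" "y = compose (elts (rar L s)) f x" 
      using im by (metis PiE_image_compose)
    then show "y \<in> rint N s \<longleftrightarrow> compose (elts (rar L s)) ?g y \<in> rint M s"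
      using assms s x by (simp add: struc_iso_def c[OF x(1)])
  qed (use MN in auto)
qed

lemma ex_struc_iso:
  fixes M :: "'a::zfc_universe struc"
  assumes "is_struc L M" "inj_on f (univ M)" obtains N where "struc_iso L f M N" "univ N = f ` univ M"
proof -
  let ?g = "inv_into (univ M) f"
  let ?N = "\<lparr>univ = f ` univ M,
     fint = (\<lambda>s \<in> fsyms L. \<lambda>x \<in> elts (far L s) \<rightarrow>\<^sub>E f ` univ M. f (fint M s (compose (elts (far L s)) ?g x))),
     rint = (\<lambda>s \<in> rsyms L. compose (elts (rar L s)) f ` rint M s)\<rparr>"
  have gf: "\<And>a. a \<in> univ M \<Longrightarrow> ?g (f a) = a" using assms(2) by simp
  have c: "compose I ?g (compose I f x) = x" if "x \<in> I \<rightarrow>\<^sub>E univ M" for I :: "'a set" and x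
    using that gf by (auto simp: compose_def PiE_iff fun_eq_iff extensional_def)
  have cg: "compose I ?g y \<in> I \<rightarrow>\<^sub>E univ M" if "y \<in> I \<rightarrow>\<^sub>E f ` univ M" for I :: "'a set" and y
    using that by (rule compose_PiE[rotated]) (simp add: inv_into_into)
  have cf: "compose I f x \<in> I \<rightarrow>\<^sub>E f ` univ M" if "x \<in> I \<rightarrow>\<^sub>E univ M" for I :: "'a set" and x
    using that by (rule compose_PiE[rotated]) simp
  have N: "is_struc L ?N"
    unfolding is_struc_def
  proof (intro conjI)
    show "fint ?N \<in> (\<Pi>\<^sub>E s \<in> fsyms L. (elts (far L s) \<rightarrow>\<^sub>E univ ?N) \<rightarrow>\<^sub>E univ ?N)"
      using is_struc_fint[OF assms(1)] cg by auto
    show "rint ?N \<in> (\<Pi>\<^sub>E s \<in> rsyms L. Pow (elts (rar L s) \<rightarrow>\<^sub>E univ ?N))"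
      by (simp add: restrict_PiE_iff Pi_iff image_subset_iff) (metis cf subsetD[OF is_struc_rint[OF assms(1)]])
  qed (use assms(1) small_image in \<open>auto simp: is_struc_def\<close>)
  have "struc_iso L f M ?N"
    unfolding struc_iso_def
  proof (intro conjI ballI)
    fix s x assume s: "s \<in> rsyms L" and x: "x \<in> elts (rar L s) \<rightarrow>\<^sub>E univ M"
    have "x \<in> rint M s" if "compose (elts (rar L s)) f x = compose (elts (rar L s)) f y" "y \<in> rint M s" for y
      using compose_inj_on[OF assms(2) x _ that(1)] is_struc_rint[OF assms(1) s] that(2) by blast
    then show "x \<in> rint M s \<longleftrightarrow> compose (elts (rar L s)) f x \<in> rint ?N s"
      using s by auto
  qed (use assms N in \<open>auto simp: bij_betw_def cf c\<close>)
  then show ?thesis by (rule that) simp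
qed

text \<open>The universes of submodels in the sense of \<open>leK\<close>. As a relation on subsets
  it turns chains and directed systems in the class into inclusions of sets.\<close>

definition strong :: "'v::zfc_universe absclass \<Rightarrow> 'v struc \<Rightarrow> 'v set \<Rightarrow> bool" where
  "strong K N B \<longleftrightarrow> B \<subseteq> univ N \<and> leK K (restr_struc (lang K) N B) N"

locale mu_class =
  fixes \<mu> :: "'v::zfc_universe" and K :: "'v absclass"
  assumes aec: "mu_aec \<mu> K"
begin

abbreviation "L \<equiv> lang K"

lemma abstract_class: "mu_abstract_class \<mu> K"
  using aec by (simp add: mu_aec_def)

lemma Card_mu: "Card \<mu>" and infinite_mu: "infinite (elts \<mu>)"
  using aec by (simp_all add: mu_aec_def regular_card_def)

lemmas abstract_class_unfolded = abstract_class[unfolded mu_abstract_class_def]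

lemmas abstract_classD =
  abstract_class_unfolded[THEN conjunct1]
  abstract_class_unfolded[THEN conjunct2, THEN conjunct1]
  abstract_class_unfolded[THEN conjunct2, THEN conjunct2, THEN conjunct1]
  abstract_class_unfolded[THEN conjunct2, THEN conjunct2, THEN conjunct2, THEN conjunct1]
  abstract_class_unfolded[THEN conjunct2, THEN conjunct2, THEN conjunct2, THEN conjunct2, THEN conjunct1]
  abstract_class_unfolded[THEN conjunct2, THEN conjunct2, THEN conjunct2, THEN conjunct2, THEN conjunct2,
    THEN conjunct1]
  abstract_class_unfolded[THEN conjunct2, THEN conjunct2, THEN conjunct2, THEN conjunct2, THEN conjunct2,
    THEN conjunct2]

lemma models_struc: "M \<in> models K \<Longrightarrow> is_struc L M"
  using abstract_classD(2,4) by blast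

lemma leK_models: "leK K M N \<Longrightarrow> M \<in> models K" "leK K M N \<Longrightarrow> N \<in> models K"
  and leK_substruc: "leK K M N \<Longrightarrow> substruc L M N"
  using abstract_classD(3) by blast+

lemma leK_refl: "M \<in> models K \<Longrightarrow> leK K M M"
  using abstract_classD(2,4) by blast

lemma leK_trans: "leK K M N \<Longrightarrow> leK K N P \<Longrightarrow> leK K M P"
  using abstract_classD(5) by blast

lemma models_iso: "M \<in> models K \<Longrightarrow> struc_iso L f M N \<Longrightarrow> N \<in> models K"
  using abstract_classD(6) by blast

lemma leK_iso: 
  "leK K M N \<Longrightarrow> struc_iso L f N N' \<Longrightarrow> struc_iso L f M M' \<Longrightarrow> leK K M' N'"
  using abstract_classD(7) by blast

lemma far_lesspoll: "s \<in> fsyms L \<Longrightarrow> elts (far L s) \<prec> elts \<mu>"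
  and rar_lesspoll: "s \<in> rsyms L \<Longrightarrow> elts (rar L s) \<prec> elts \<mu>"
  using abstract_classD(1) Card_mem_lesspoll[OF Card_mu] unfolding mu_ary_def by blast+

lemma strong_models: "strong K N B \<Longrightarrow> N \<in> models K" 
  "strong K N B \<Longrightarrow> restr_struc L N B \<in> models K"
  unfolding strong_def using leK_models by blast+

lemma strong_subset: "strong K N B \<Longrightarrow> B \<subseteq> univ N"
  by (simp add: strong_def)

lemma strong_closed: "strong K N B \<Longrightarrow> closed_in L N B"
  unfolding strong_def using substruc_closed_in[OF leK_substruc] by force

lemma leK_imp_strong: "leK K M N \<Longrightarrow> strong K N (univ M)"
  and leK_eq_restr: "leK K M N \<Longrightarrow> M = restr_struc L N (univ M)"
proof -
  assume l: "leK K M N"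
  show e: "M = restr_struc L N (univ M)" by (rule substruc_eq_restr[OF leK_substruc[OF l]])
  have "univ M \<subseteq> univ N" using leK_substruc[OF l] by (simp add: substruc_def)
  then show "strong K N (univ M)" using l e unfolding strong_def by simp
qed

lemma strong_univ: "N \<in> models K \<Longrightarrow> strong K N (univ N)"
  by (rule leK_imp_strong[OF leK_refl])

lemma coherenceD: "leK K M\<^sub>0 M\<^sub>2 \<Longrightarrow> leK K M\<^sub>1 M\<^sub>2 \<Longrightarrow> substruc L M\<^sub>0 M\<^sub>1 \<Longrightarrow> leK K M\<^sub>0 M\<^sub>1"
  using aec leK_models unfolding mu_aec_def coherence_def by blast

lemma strong_mono:
  assumes "strong K N B" "strong K N C" "B \<subseteq> C"
  shows "leK K (restr_struc L N B) (restr_struc L N C)"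
proof (rule coherenceD)
  show "substruc L (restr_struc L N B) (restr_struc L N C)"
    by (rule substruc_restr_mono[OF models_struc[OF strong_models(1)[OF assms(1)]]])
      (use assms strong_closed in auto)
qed (use assms in \<open>auto simp: strong_def\<close>)

lemma strong_restr:
  assumes "strong K N C" "strong K (restr_struc L N C) B" shows "strong K N B"
  using assms leK_trans unfolding strong_def by (auto simp: restr_restr)

lemma strong_restrI:
  assumes "strong K N C" "strong K N B" "B \<subseteq> C" shows "strong K (restr_struc L N C) B"
  using strong_mono[OF assms(2,1,3)] assms unfolding strong_def by (auto simp: restr_restr)

lemma strong_iso:
  assumes "struc_iso L f M N" "strong K M B" shows "strong K N (f ` B)"
proof -
  have "struc_iso L f (restr_struc L M B) (restr_struc L N (f ` B))"
    by (rule struc_iso_restr(2)[OF assms(1) strong_closed[OF assms(2)]])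
  then have "leK K (restr_struc L N (f ` B)) N"
    using assms leK_iso unfolding strong_def by blast
  then show ?thesis
    using assms struc_isoD(4)[OF assms(1)] unfolding strong_def by blast
qed

text \<open>The intermediate structure in \<open>K_embedding\<close> can only be the restriction to
  the image, so an embedding amounts to an isomorphism onto a strong subset.\<close>

lemma K_embedding_iff:
  "K_embedding K f M N \<longleftrightarrow> strong K N (f ` univ M) \<and> struc_iso L f M (restr_struc L N (f ` univ M))"
proof
  assume "K_embedding K f M N"
  then obtain M' where M': "struc_iso L f M M'" "leK K M' N" by (auto simp: K_embedding_def)
  then have "univ M' = f ` univ M" using struc_isoD(4) by blast
  then show "strong K N (f ` univ M) \<and> struc_iso L f M (restr_struc L N (f ` univ M))"
    using M' leK_imp_strong[OF M'(2)] leK_eq_restr[OF M'(2)] by simp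
qed (auto simp: K_embedding_def strong_def)

lemma K_embedding_models:
  assumes "K_embedding K f M N" shows "M \<in> models K" "N \<in> models K"
  using assms models_iso[OF _ struc_iso_inv] leK_models unfolding K_embedding_def by blast+

lemma K_embedding_comp:
  assumes "K_embedding K f M N" "K_embedding K g N P" shows "K_embedding K (g \<circ> f) M P"
proof -
  have f: "strong K N (f ` univ M)" "struc_iso L f M (restr_struc L N (f ` univ M))"
    and g: "strong K P (g ` univ N)" "struc_iso L g N (restr_struc L P (g ` univ N))"
    using assms by (auto simp: K_embedding_iff)
  have sub: "g ` f ` univ M \<subseteq> g ` univ N" using strong_subset[OF f(1)] by auto
  have "strong K P (g ` f ` univ M)"
    by (rule strong_restr[OF g(1) strong_iso[OF g(2) f(1)]])
  moreover have "struc_iso L (g \<circ> f) M (restr_struc L P (g ` f ` univ M))"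
    using struc_iso_comp[OF f(2)] struc_iso_restr(2)[OF g(2) strong_closed[OF f(1)]] restr_restr[OF sub]
    by metis
  ultimately show ?thesis by (simp add: K_embedding_iff image_comp)
qed

lemma K_embedding_iso: 
  assumes "M \<in> models K" "struc_iso L f M N" shows "K_embedding K f M N"
  using assms leK_refl models_iso unfolding K_embedding_def by blast

lemma K_embedding_inj_on: "K_embedding K f M N \<Longrightarrow> inj_on f (univ M)"
  and K_embedding_image: "K_embedding K f M N \<Longrightarrow> f ` univ M \<subseteq> univ N"
  unfolding K_embedding_iff using struc_isoD(3) strong_subset by blast+

lemma K_embedding_incl: "leK K M N \<Longrightarrow> K_embedding K (\<lambda>x. x) M N"
  using struc_iso_refl[OF models_struc[OF leK_models(1)]] unfolding K_embedding_def by blast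

section \<open>Directed unions inside one structure\<close>

lemma directed_PiE:
  assumes "\<And>C. C \<subseteq> D \<Longrightarrow> C \<prec> elts \<mu> \<Longrightarrow> \<exists>B \<in> D. \<forall>c \<in> C. c \<subseteq> B"
    and "J \<prec> elts \<mu>" "x \<in> J \<rightarrow>\<^sub>E \<Union>D"
  shows "\<exists>B \<in> D. x \<in> J \<rightarrow>\<^sub>E B"
proof -
  have "\<forall>j \<in> J. \<exists>B \<in> D. x j \<in> B" using assms(3) by (auto simp: PiE_iff)
  then obtain b where b: "\<And>j. j \<in> J \<Longrightarrow> b j \<in> D \<and> x j \<in> b j" by metis
  have "b ` J \<prec> elts \<mu>" using image_lepoll assms(2) by (rule lesspoll_trans1)
  then obtain B where "B \<in> D" "\<forall>c \<in> b ` J. c \<subseteq> B" using assms(1)[of "b ` J"] b by blast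
  then show ?thesis using b assms(3) by (auto simp: PiE_iff)
qed

text \<open>The union axioms for a family of subsets directed by inclusion, with codes of the
  subsets as index poset. Arities are below \<mu>, so each argument tuple already lies in one
  member, and \<open>union_struc\<close> agrees with the restriction to the union. The ambient
  \<open>N\<close> is only a structure: for ultraproducts, membership in the class is what has to be
  shown.\<close>

lemma tarski_vaught_restr:
  assumes N: "is_struc L N" and D: "D \<subseteq> Pow (univ N)"
    and dir: "\<And>C. C \<subseteq> D \<Longrightarrow> C \<prec> elts \<mu> \<Longrightarrow> \<exists>B \<in> D. \<forall>c \<in> C. c \<subseteq> B"
    and mod: "\<And>B. B \<in> D \<Longrightarrow> restr_struc L N B \<in> models K"
    and le: "\<And>B C. B \<in> D \<Longrightarrow> C \<in> D \<Longrightarrow> B \<subseteq> C \<Longrightarrow> leK K (restr_struc L N B) (restr_struc L N C)"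
  shows "restr_struc L N (\<Union>D) \<in> models K"
    and "B \<in> D \<Longrightarrow> leK K (restr_struc L N B) (restr_struc L N (\<Union>D))"
    and "P \<in> models K \<Longrightarrow> (\<And>B. B \<in> D \<Longrightarrow> leK K (restr_struc L N B) P) \<Longrightarrow> leK K (restr_struc L N (\<Union>D)) P"
proof -
  have small_univ: "small (univ N)" using N by (simp add: is_struc_def)
  have sB: "small B" if "B \<in> D" for B using that D small_univ small_subset by blast
  define I where "I = vset ` D"
  define M where "M i = restr_struc L N (elts i)" for i
  define r where "r = {(i, j). i \<in> I \<and> j \<in> I \<and> elts i \<subseteq> elts j}"
  have eI: "elts i \<in> D" if "i \<in> I" for i using that sB by (auto simp: I_def elts_vset)
  have vI: "vset B \<in> I \<and> elts (vset B) = B" if "B \<in> D" for B using that sB by (auto simp: I_def elts_vset)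
  have UI: "(\<Union>i\<in>I. elts i) = \<Union>D" using eI vI by blast
  have "setlike TYPE('v) D"
    by (rule setlike_subset[OF setlike_Pow D]) (simp add: setlike_small small_univ)
  then have sI: "small I" unfolding I_def using setlike_image setlike_small by blast
  have po: "partial_order_on I r"
    unfolding r_def partial_order_on_def preorder_on_def refl_on_def trans_def antisym_def
    by (auto simp: elts_eq_iff[symmetric])
  have "mu_directed \<mu> I r"
    unfolding mu_directed_def
  proof (intro conjI po allI impI)
    fix X assume X: "X \<subseteq> I" "X \<prec> elts \<mu>"
    have "elts ` X \<prec> elts \<mu>" using image_lepoll X(2) by (rule lesspoll_trans1)
    moreover have "elts ` X \<subseteq> D" using X(1) eI by blast
    ultimately obtain B where "B \<in> D" "\<forall>c \<in> elts ` X. c \<subseteq> B" using dir by blast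
    then show "\<exists>u\<in>I. \<forall>x\<in>X. (x, u) \<in> r"
      using vI X(1) unfolding r_def by (intro bexI[of _ "vset B"]) auto
  qed
  moreover have "\<forall>i\<in>I. M i \<in> models K" using mod eI by (simp add: M_def)
  moreover have "\<forall>i j. (i, j) \<in> r \<longrightarrow> leK K (M i) (M j)" using le eI by (simp add: M_def r_def)
  ultimately have TV: "union_struc L I M \<in> models K \<and>
          (\<forall>j \<in> I. leK K (M j) (union_struc L I M)) \<and>
          (\<forall>N \<in> models K. (\<forall>i \<in> I. leK K (M i) N) \<longrightarrow> leK K (union_struc L I M) N)"
    using aec sI unfolding mu_aec_def tarski_vaught_def by blast
  have ex: "\<exists>i \<in> I. x \<in> J \<rightarrow>\<^sub>E elts i" if "J \<prec> elts \<mu>" "x \<in> J \<rightarrow>\<^sub>E \<Union>D" for x and J :: "'v set"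
    using directed_PiE[OF dir that] vI by metis
  have "union_struc L I M = restr_struc L N (\<Union>D)"
  proof -
    have "(THE y. \<exists>i\<in>I. x \<in> elts (far L s) \<rightarrow>\<^sub>E elts i \<and> y = fint (M i) s x) = fint N s x"
      if s: "s \<in> fsyms L" and x: "x \<in> elts (far L s) \<rightarrow>\<^sub>E \<Union>D" for s x
    proof (rule the_equality)
      show "\<exists>i\<in>I. x \<in> elts (far L s) \<rightarrow>\<^sub>E elts i \<and> fint N s x = fint (M i) s x"
        using ex[OF far_lesspoll[OF s] x] s by (auto simp: M_def fint_restr)
    qed (use s in \<open>auto simp: M_def fint_restr\<close>)
    moreover have "(\<Union>i\<in>I. rint (M i) s) = rint N s \<inter> (elts (rar L s) \<rightarrow>\<^sub>E \<Union>D)" if s: "s \<in> rsyms L" for s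
    proof -
      have "(\<Union>i\<in>I. rint (M i) s) = (\<Union>i\<in>I. rint N s \<inter> (elts (rar L s) \<rightarrow>\<^sub>E elts i))"
        using s by (simp add: M_def rint_restr)
      also have "\<dots> = rint N s \<inter> (elts (rar L s) \<rightarrow>\<^sub>E \<Union>D)"
      proof (intro equalityI subsetI)
        fix x assume "x \<in> (\<Union>i\<in>I. rint N s \<inter> (elts (rar L s) \<rightarrow>\<^sub>E elts i))"
        then obtain i where i: "i \<in> I" "x \<in> rint N s" "x \<in> elts (rar L s) \<rightarrow>\<^sub>E elts i" by blast
        then have "elts i \<subseteq> \<Union>D" using eI by blast
        then show "x \<in> rint N s \<inter> (elts (rar L s) \<rightarrow>\<^sub>E \<Union>D)"
          using PiE_range_mono[OF _ i(3)] i(2) by blast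
      qed (use ex[OF rar_lesspoll[OF s]] in blast)
      finally show ?thesis .
    qed
    ultimately show ?thesis
      unfolding union_struc_def restr_struc_def by (simp add: UI M_def cong: restrict_cong)
  qed
  note TV = TV[unfolded this]
  show "restr_struc L N (\<Union>D) \<in> models K" using TV by blast
  show "B \<in> D \<Longrightarrow> leK K (restr_struc L N B) (restr_struc L N (\<Union>D))"
    using TV vI[of B] by (auto simp: M_def)
  show "P \<in> models K \<Longrightarrow> (\<And>B. B \<in> D \<Longrightarrow> leK K (restr_struc L N B) P) \<Longrightarrow> leK K (restr_struc L N (\<Union>D)) P"
    using TV eI by (simp add: M_def)
qed

lemma strong_Union:
  assumes N: "N \<in> models K" and D: "\<And>B. B \<in> D \<Longrightarrow> strong K N B"
    and dir: "\<And>C. C \<subseteq> D \<Longrightarrow> C \<prec> elts \<mu> \<Longrightarrow> \<exists>B \<in> D. \<forall>c \<in> C. c \<subseteq> B"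
  shows "strong K N (\<Union>D)"
proof -
  have "leK K (restr_struc L N (\<Union>D)) N"
    by (rule tarski_vaught_restr(3)[OF models_struc[OF N] _ dir _ _ N])
      (use D strong_models strong_mono strong_subset in \<open>auto simp: strong_def\<close>)
  then show ?thesis unfolding strong_def using D strong_subset by blast
qed

end

section \<open>Ultraproducts\<close>

text \<open>The bound on intersections is "at most \<theta>", in contrast to the strict bound in
  \<open>complete_family\<close>. This suits families indexed by a set of size \<theta>, such as
  argument places or isomorphism types.\<close>

locale ultra =
  fixes X :: "'v::zfc_universe set" and U :: "'v set set" and \<theta> :: 'v
  assumes small_X: "small X" and ultrafilter: "ultrafilter_on_set X U"
    and complete: "S \<subseteq> U \<Longrightarrow> S \<noteq> {} \<Longrightarrow> S \<lesssim> elts \<theta> \<Longrightarrow> \<Inter>S \<in> U"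
    and infinite_\<theta>: "infinite (elts \<theta>)"
begin

definition ae :: "('v \<Rightarrow> bool) \<Rightarrow> bool" where
  "ae P \<longleftrightarrow> {x \<in> X. P x} \<in> U"

lemma filter: "X \<in> U" "{} \<notin> U" "A \<in> U \<Longrightarrow> A \<subseteq> B \<Longrightarrow> B \<subseteq> X \<Longrightarrow> B \<in> U" 
    "A \<in> U \<Longrightarrow> B \<in> U \<Longrightarrow> A \<inter> B \<in> U" "A \<in> U \<Longrightarrow> A \<subseteq> X"
  using ultrafilter unfolding ultrafilter_on_set_def filter_on_set_def by blast+

lemma ae_mono: "ae P \<Longrightarrow> (\<And>x. x \<in> X \<Longrightarrow> P x \<Longrightarrow> Q x) \<Longrightarrow> ae Q"
  unfolding ae_def by (erule filter(3)) auto

lemma ae_all': "(\<And>x. x \<in> X \<Longrightarrow> P x) \<Longrightarrow> ae P"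
  unfolding ae_def using filter(1) by (metis (mono_tags, lifting) Collect_cong Collect_mem_eq)

lemma ae_conj: "ae P \<Longrightarrow> ae Q \<Longrightarrow> ae (\<lambda>x. P x \<and> Q x)"
  unfolding ae_def using filter(4)[of "{x \<in> X. P x}" "{x \<in> X. Q x}"]
    filter(3)[of "{x \<in> X. P x} \<inter> {x \<in> X. Q x}" "{x \<in> X. P x \<and> Q x}"] by auto

lemma ae_ex: "ae P \<Longrightarrow> \<exists>x \<in> X. P x"
  unfolding ae_def using filter(2) by (metis (mono_tags, lifting) Collect_empty_eq)

lemma ae_not: "ae (\<lambda>x. \<not> P x) \<longleftrightarrow> \<not> ae P"
proof
  assume "ae (\<lambda>x. \<not> P x)" then show "\<not> ae P"
    using ae_conj[of P "\<lambda>x. \<not> P x"] ae_ex by blast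
next
  have "X - {x \<in> X. P x} = {x \<in> X. \<not> P x}" by auto
  then show "\<not> ae P \<Longrightarrow> ae (\<lambda>x. \<not> P x)"
    using ultrafilter unfolding ae_def ultrafilter_on_set_def
    by (metis (no_types, lifting) mem_Collect_eq subsetI)
qed

lemma ae_cong: "(\<And>x. x \<in> X \<Longrightarrow> P x \<longleftrightarrow> Q x) \<Longrightarrow> ae P \<longleftrightarrow> ae Q"
  using ae_mono by metis

lemma ae_iff: "ae (\<lambda>x. P x \<longleftrightarrow> Q x) \<Longrightarrow> ae P \<longleftrightarrow> ae Q"
  using ae_mono[OF ae_conj[of "\<lambda>x. P x \<longleftrightarrow> Q x" P], of Q] ae_mono[OF ae_conj[of "\<lambda>x. P x \<longleftrightarrow> Q x" Q], of P] by blast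

lemma ae_Ball:
  assumes "J \<lesssim> elts \<theta>" "\<And>j. j \<in> J \<Longrightarrow> ae (P j)" shows "ae (\<lambda>x. \<forall>j \<in> J. P j x)"
proof (cases "J = {}")
  case False
  let ?S = "(\<lambda>j. {x \<in> X. P j x}) ` J"
  have "\<Inter>?S \<in> U"
  proof (rule complete)
    show "?S \<lesssim> elts \<theta>" using image_lepoll assms(1) by (rule lepoll_trans)
  qed (use assms False in \<open>auto simp: ae_def\<close>)
  moreover have "\<Inter>?S = {x \<in> X. \<forall>j \<in> J. P j x}" using False by auto
  ultimately show ?thesis by (simp add: ae_def)
qed (simp add: ae_all')

text \<open>Otherwise each of the at most \<theta> values is avoided almost everywhere, hence all of
  them simultaneously.\<close>

lemma ae_pigeonhole:
  assumes "B \<lesssim> elts \<theta>" "ae (\<lambda>x. h x \<in> B)" obtains b where "b \<in> B" "ae (\<lambda>x. h x = b)"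
proof -
  have "\<exists>b \<in> B. ae (\<lambda>x. h x = b)"
  proof (rule ccontr)
    assume "\<not> ?thesis"
    then have "ae (\<lambda>x. \<forall>b \<in> B. h x \<noteq> b)" using assms(1) by (intro ae_Ball) (auto simp: ae_not)
    then show False using ae_ex[OF ae_conj[OF assms(2)]] by blast
  qed
  then show ?thesis using that by blast
qed

text \<open>For passing to a set of \<open>U\<close> on which some quantity is constant.\<close>

lemma ultra_restrict:
  assumes "Y \<in> U" shows "ultra Y (U \<inter> Pow Y) \<theta>"
proof
  have Y: "Y \<subseteq> X" using filter(5) assms by blast
  show "small Y" by (rule small_subset[OF small_X Y])
  have "A \<in> U \<or> Y - A \<in> U" if "A \<subseteq> Y" for A
  proof -
    have "X - A \<in> U \<Longrightarrow> Y - A \<in> U" 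
      using filter(4)[OF assms, of "X - A"] Y by (metis Int_Diff inf.absorb1)
    then show ?thesis using ultrafilter that Y unfolding ultrafilter_on_set_def by blast
  qed
  then show "ultrafilter_on_set Y (U \<inter> Pow Y)"
    unfolding ultrafilter_on_set_def filter_on_set_def 
    using assms filter(2,4) filter(3)[OF _ _ order_trans[OF _ Y]] by auto
  show "\<Inter>S \<in> U \<inter> Pow Y" if "S \<subseteq> U \<inter> Pow Y" "S \<noteq> {}" "S \<lesssim> elts \<theta>" for S
    using complete[of S] that by blast
  show "infinite (elts \<theta>)" by (rule infinite_\<theta>)
qed

end

section \<open>Ultraproducts of sets\<close>

locale ultra_dom = ultra X U \<theta> for X :: "'v::zfc_universe set" and U \<theta> +
  fixes V :: "'v set"
  assumes small_V: "small V"
begin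

text \<open>Classes of functions modulo \<open>U\<close> have the wrong type to be elements of a
  structure, so a coding by elements of the universe is chosen. All universes of the factors lie in
  one small \<open>V\<close>: a single coding then serves for all ultraproducts in play, and maps
  and submodels can be compared.\<close>

definition cls :: "('v \<Rightarrow> 'v) \<Rightarrow> 'v" where
  "cls = (SOME c. (\<forall>f \<in> X \<rightarrow>\<^sub>E V. \<forall>g \<in> X \<rightarrow>\<^sub>E V. c f = c g \<longleftrightarrow> ae (\<lambda>x. f x = g x)) \<and> small (c ` (X \<rightarrow>\<^sub>E V)))"

lemma cls: "(\<forall>f \<in> X \<rightarrow>\<^sub>E V. \<forall>g \<in> X \<rightarrow>\<^sub>E V. cls f = cls g \<longleftrightarrow> ae (\<lambda>x. f x = g x)) \<and> small (cls ` (X \<rightarrow>\<^sub>E V))"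
proof -
  let ?q = "\<lambda>f. {g \<in> X \<rightarrow>\<^sub>E V. ae (\<lambda>x. f x = g x)}"
  have "setlike TYPE('v) (Pow (X \<rightarrow>\<^sub>E V))"
    using small_X small_V by (intro setlike_Pow setlike_PiE) (simp_all add: setlike_small)
  then obtain e :: "_ \<Rightarrow> 'v" where e: "inj_on e (Pow (X \<rightarrow>\<^sub>E V))" "small (e ` Pow (X \<rightarrow>\<^sub>E V))" by (rule setlikeE)
  have q: "?q f = ?q g \<longleftrightarrow> ae (\<lambda>x. f x = g x)" if "f \<in> X \<rightarrow>\<^sub>E V" "g \<in> X \<rightarrow>\<^sub>E V" for f g
  proof
    assume "?q f = ?q g"
    moreover have "g \<in> ?q g" using that ae_all' by simp
    ultimately show "ae (\<lambda>x. f x = g x)" by blast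
  next
    assume a: "ae (\<lambda>x. f x = g x)"
    have "ae (\<lambda>x. f x = h x) \<longleftrightarrow> ae (\<lambda>x. g x = h x)" for h
      by (rule ae_iff) (rule ae_mono[OF a], simp)
    then show "?q f = ?q g" by blast
  qed
  have ex: "\<exists>c :: ('v \<Rightarrow> 'v) \<Rightarrow> 'v. (\<forall>f \<in> X \<rightarrow>\<^sub>E V. \<forall>g \<in> X \<rightarrow>\<^sub>E V. c f = c g \<longleftrightarrow> ae (\<lambda>x. f x = g x)) \<and> small (c ` (X \<rightarrow>\<^sub>E V))"
  proof (rule exI[of _ "\<lambda>f. e (?q f)"], intro conjI ballI)
    fix f g assume fg: "f \<in> X \<rightarrow>\<^sub>E V" "g \<in> X \<rightarrow>\<^sub>E V"
    have "e (?q f) = e (?q g) \<longleftrightarrow> ?q f = ?q g"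
      by (rule inj_on_eq_iff[OF e(1)]) auto
    then show "e (?q f) = e (?q g) \<longleftrightarrow> ae (\<lambda>x. f x = g x)" using q[OF fg] by simp
  next
    show "small ((\<lambda>f. e (?q f)) ` (X \<rightarrow>\<^sub>E V))" by (rule small_subset[OF e(2)]) auto
  qed
  show ?thesis unfolding cls_def by (rule someI_ex[OF ex])
qed

lemma cls_eq_iff: "f \<in> X \<rightarrow>\<^sub>E V \<Longrightarrow> g \<in> X \<rightarrow>\<^sub>E V \<Longrightarrow> cls f = cls g \<longleftrightarrow> ae (\<lambda>x. f x = g x)"
  using cls by blast

abbreviation bar :: "('v \<Rightarrow> 'v set) \<Rightarrow> 'v set" where
  "bar S \<equiv> cls ` Pi\<^sub>E X S"

lemma PiE_V: "(\<And>x. x \<in> X \<Longrightarrow> S x \<subseteq> V) \<Longrightarrow> f \<in> Pi\<^sub>E X S \<Longrightarrow> f \<in> X \<rightarrow>\<^sub>E V"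
  by (auto simp: PiE_iff)

lemma small_bar: "(\<And>x. x \<in> X \<Longrightarrow> S x \<subseteq> V) \<Longrightarrow> small (bar S)"
  using cls PiE_V by (meson image_mono small_subset subsetI)

lemma bar_mono: "(\<And>x. x \<in> X \<Longrightarrow> S x \<subseteq> T x) \<Longrightarrow> bar S \<subseteq> bar T"
  by (intro image_mono PiE_mono)

lemma bar_nonempty: "(\<And>x. x \<in> X \<Longrightarrow> S x \<noteq> {}) \<Longrightarrow> bar S \<noteq> {}"
  by (simp add: PiE_eq_empty_iff)

text \<open>The test function chooses a point outside \<open>T x\<close> wherever the inclusion
  fails; its class lies in \<open>bar T\<close> only if this happens on a null set. Conversely a
  representative can be altered on a null set, and nonempty factors supply the new values.\<close>

lemma bar_subset_iff:
  assumes "\<And>x. x \<in> X \<Longrightarrow> S x \<subseteq> V" "\<And>x. x \<in> X \<Longrightarrow> T x \<subseteq> V" "\<And>x. x \<in> X \<Longrightarrow> S x \<noteq> {}" "\<And>x. x \<in> X \<Longrightarrow> T x \<noteq> {}"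
  shows "bar S \<subseteq> bar T \<longleftrightarrow> ae (\<lambda>x. S x \<subseteq> T x)"
proof
  assume sub: "bar S \<subseteq> bar T"
  have "\<forall>x \<in> X. \<exists>y. y \<in> S x \<and> (\<not> S x \<subseteq> T x \<longrightarrow> y \<notin> T x)" using assms(3) by blast
  then obtain y where y: "\<And>x. x \<in> X \<Longrightarrow> y x \<in> S x \<and> (\<not> S x \<subseteq> T x \<longrightarrow> y x \<notin> T x)" by metis
  have yS: "restrict y X \<in> Pi\<^sub>E X S" using y by auto
  then obtain z where z: "z \<in> Pi\<^sub>E X T" "cls (restrict y X) = cls z" using sub by blast
  then have "ae (\<lambda>x. restrict y X x = z x)"
    using cls_eq_iff[of "restrict y X" z] PiE_V[OF _ yS] PiE_V[OF _ z(1)] assms(1,2) by blast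
  then show "ae (\<lambda>x. S x \<subseteq> T x)"
  proof (rule ae_mono)
    fix x assume x: "x \<in> X" "restrict y X x = z x"
    then have "y x \<in> T x" using PiE_mem[OF z(1) x(1)] by simp
    then show "S x \<subseteq> T x" using y[OF x(1)] by blast
  qed
next
  assume a: "ae (\<lambda>x. S x \<subseteq> T x)"
  have "\<forall>x \<in> X. \<exists>y. y \<in> T x" using assms(4) by blast
  then obtain t where t: "\<And>x. x \<in> X \<Longrightarrow> t x \<in> T x" by metis
  show "bar S \<subseteq> bar T"
  proof (rule image_subsetI)
    fix f assume f: "f \<in> Pi\<^sub>E X S"
    define g where "g = (\<lambda>x\<in>X. if S x \<subseteq> T x then f x else t x)"
    have g: "g \<in> Pi\<^sub>E X T" using f t by (auto simp: g_def PiE_iff)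
    have "ae (\<lambda>x. f x = g x)" by (rule ae_mono[OF a]) (simp add: g_def)
    then have "cls f = cls g"
      using cls_eq_iff[of f g] PiE_V[OF _ f] PiE_V[OF _ g] assms(1,2) by blast
    then show "cls f \<in> bar T" using g by blast
  qed
qed

lemma bar_eqI:
  assumes "\<And>x. x \<in> X \<Longrightarrow> S x \<subseteq> V" "\<And>x. x \<in> X \<Longrightarrow> T x \<subseteq> V" "\<And>x. x \<in> X \<Longrightarrow> S x \<noteq> {}" "\<And>x. x \<in> X \<Longrightarrow> T x \<noteq> {}"
    and "ae (\<lambda>x. S x = T x)"
  shows "bar S = bar T"
  using bar_subset_iff[of S T] bar_subset_iff[of T S] assms ae_mono[OF assms(5)] by simp

lemma bar_tuple:
  assumes "y \<in> J \<rightarrow>\<^sub>E bar S" obtains h where "\<And>j. j \<in> J \<Longrightarrow> h j \<in> Pi\<^sub>E X S" "y = (\<lambda>j\<in>J. cls (h j))"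
proof -
  have "\<forall>j \<in> J. \<exists>f. f \<in> Pi\<^sub>E X S \<and> y j = cls f" using PiE_mem[OF assms] by blast
  then obtain h where h: "\<And>j. j \<in> J \<Longrightarrow> h j \<in> Pi\<^sub>E X S \<and> y j = cls (h j)" by metis
  then have "y = (\<lambda>j\<in>J. cls (h j))" using assms by (auto simp: PiE_iff fun_eq_iff extensional_def)
  then show ?thesis using that h by blast
qed

section \<open>Ultraproducts of structures\<close>

definition rep :: "('v \<Rightarrow> 'v struc) \<Rightarrow> 'v \<Rightarrow> 'v \<Rightarrow> 'v" where
  "rep N y = (SOME h. h \<in> (\<Pi>\<^sub>E x\<in>X. univ (N x)) \<and> cls h = y)"

definition ultraprod :: "'v language \<Rightarrow> ('v \<Rightarrow> 'v struc) \<Rightarrow> 'v struc" where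
  "ultraprod L N = \<lparr>univ = bar (\<lambda>x. univ (N x)),
     fint = (\<lambda>s \<in> fsyms L. \<lambda>y \<in> elts (far L s) \<rightarrow>\<^sub>E bar (\<lambda>x. univ (N x)).
       cls (\<lambda>x\<in>X. fint (N x) s (\<lambda>j \<in> elts (far L s). rep N (y j) x))),
     rint = (\<lambda>s \<in> rsyms L. {y \<in> elts (rar L s) \<rightarrow>\<^sub>E bar (\<lambda>x. univ (N x)).
       ae (\<lambda>x. (\<lambda>j \<in> elts (rar L s). rep N (y j) x) \<in> rint (N x) s)})\<rparr>"

lemma univ_ultraprod [simp]: "univ (ultraprod L N) = bar (\<lambda>x. univ (N x))"
  by (simp add: ultraprod_def)

end

locale ultra_lang = ultra_dom X U \<theta> V for X :: "'v::zfc_universe set" and U \<theta> V +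
  fixes L :: "'v language"
  assumes far_lepoll: "s \<in> fsyms L \<Longrightarrow> elts (far L s) \<lesssim> elts \<theta>"
    and rar_lepoll: "s \<in> rsyms L \<Longrightarrow> elts (rar L s) \<lesssim> elts \<theta>"
begin

definition fam :: "('v \<Rightarrow> 'v struc) \<Rightarrow> bool" where
  "fam N \<longleftrightarrow> (\<forall>x \<in> X. is_struc L (N x) \<and> univ (N x) \<subseteq> V)"

lemma famD: "fam N \<Longrightarrow> x \<in> X \<Longrightarrow> is_struc L (N x)" "fam N \<Longrightarrow> x \<in> X \<Longrightarrow> univ (N x) \<subseteq> V"
    "fam N \<Longrightarrow> x \<in> X \<Longrightarrow> univ (N x) \<noteq> {}"
  by (auto simp: fam_def is_struc_def)

lemma fam_cls_eq_iff: "fam N \<Longrightarrow> f \<in> (\<Pi>\<^sub>E x\<in>X. univ (N x)) \<Longrightarrow> g \<in> (\<Pi>\<^sub>E x\<in>X. univ (N x)) \<Longrightarrow>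
    cls f = cls g \<longleftrightarrow> ae (\<lambda>x. f x = g x)"
  by (rule cls_eq_iff) (erule PiE_V[rotated], erule (1) famD(2))+

lemma rep: 
  assumes "fam N" "h \<in> (\<Pi>\<^sub>E x\<in>X. univ (N x))" 
  shows "rep N (cls h) \<in> (\<Pi>\<^sub>E x\<in>X. univ (N x))" "ae (\<lambda>x. rep N (cls h) x = h x)"
proof -
  have r: "rep N (cls h) \<in> (\<Pi>\<^sub>E x\<in>X. univ (N x)) \<and> cls (rep N (cls h)) = cls h"
    unfolding rep_def by (rule someI[where P = "\<lambda>k. k \<in> (\<Pi>\<^sub>E x\<in>X. univ (N x)) \<and> cls k = cls h"]) (use assms in simp)
  then show "rep N (cls h) \<in> (\<Pi>\<^sub>E x\<in>X. univ (N x))" by blast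
  show "ae (\<lambda>x. rep N (cls h) x = h x)" using r fam_cls_eq_iff[OF assms(1) _ assms(2)] by blast
qed

text \<open>Each coordinate of a tuple has its own exceptional null set; completeness merges at most
  \<theta> of them. This makes the interpretation of infinitary symbols independent of
  representatives.\<close>

lemma ae_rep_tuple:
  assumes "fam N" "J \<lesssim> elts \<theta>" "\<And>j. j \<in> J \<Longrightarrow> h j \<in> (\<Pi>\<^sub>E x\<in>X. univ (N x))"
  shows "ae (\<lambda>x. (\<lambda>j \<in> J. rep N ((\<lambda>j\<in>J. cls (h j)) j) x) = (\<lambda>j\<in>J. h j x))"
proof -
  have "ae (\<lambda>x. \<forall>j \<in> J. rep N (cls (h j)) x = h j x)"
    by (rule ae_Ball[OF assms(2)]) (rule rep(2)[OF assms(1,3)])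
  then show ?thesis by (rule ae_mono) (auto simp: fun_eq_iff)
qed

lemma fint_ultraprod:
  assumes N: "fam N" and s: "s \<in> fsyms L" and h: "\<And>j. j \<in> elts (far L s) \<Longrightarrow> h j \<in> (\<Pi>\<^sub>E x\<in>X. univ (N x))"
  shows "fint (ultraprod L N) s (\<lambda>j \<in> elts (far L s). cls (h j)) =
      cls (\<lambda>x\<in>X. fint (N x) s (\<lambda>j \<in> elts (far L s). h j x))"
    and "(\<lambda>x\<in>X. fint (N x) s (\<lambda>j \<in> elts (far L s). h j x)) \<in> (\<Pi>\<^sub>E x\<in>X. univ (N x))"
proof -
  let ?y = "\<lambda>j \<in> elts (far L s). cls (h j)"
  have y: "?y \<in> elts (far L s) \<rightarrow>\<^sub>E bar (\<lambda>x. univ (N x))" using h by auto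
  have m: "(\<lambda>x\<in>X. fint (N x) s (\<lambda>j \<in> elts (far L s). k j x)) \<in> (\<Pi>\<^sub>E x\<in>X. univ (N x))"
    if "\<And>j. j \<in> elts (far L s) \<Longrightarrow> k j \<in> (\<Pi>\<^sub>E x\<in>X. univ (N x))" for k
  proof (rule restrict_PiE_iff[THEN iffD2], rule ballI)
    fix x assume x: "x \<in> X"
    have "(\<lambda>j \<in> elts (far L s). k j x) \<in> elts (far L s) \<rightarrow>\<^sub>E univ (N x)"
      using PiE_mem[OF that x] by auto
    then show "fint (N x) s (\<lambda>j \<in> elts (far L s). k j x) \<in> univ (N x)"
      by (rule is_struc_fint[OF famD(1)[OF N x] s])
  qed
  show "(\<lambda>x\<in>X. fint (N x) s (\<lambda>j \<in> elts (far L s). h j x)) \<in> (\<Pi>\<^sub>E x\<in>X. univ (N x))"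
    by (rule m[OF h])
  have "fint (ultraprod L N) s ?y = cls (\<lambda>x\<in>X. fint (N x) s (\<lambda>j \<in> elts (far L s). rep N (?y j) x))"
    using s y by (simp add: ultraprod_def)
  also have "\<dots> = cls (\<lambda>x\<in>X. fint (N x) s (\<lambda>j \<in> elts (far L s). h j x))"
  proof (subst fam_cls_eq_iff[OF N])
    show "(\<lambda>x\<in>X. fint (N x) s (\<lambda>j \<in> elts (far L s). rep N (?y j) x)) \<in> (\<Pi>\<^sub>E x\<in>X. univ (N x))"
      by (rule m) (use rep(1)[OF N h] in simp)
    show "(\<lambda>x\<in>X. fint (N x) s (\<lambda>j \<in> elts (far L s). h j x)) \<in> (\<Pi>\<^sub>E x\<in>X. univ (N x))"
      by (rule m[OF h])
    show "ae (\<lambda>x. (\<lambda>x\<in>X. fint (N x) s (\<lambda>j \<in> elts (far L s). rep N (?y j) x)) x = 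
      (\<lambda>x\<in>X. fint (N x) s (\<lambda>j \<in> elts (far L s). h j x)) x)"
      by (rule ae_mono[OF ae_rep_tuple[OF N far_lepoll[OF s] h]]) auto
  qed
  finally show "fint (ultraprod L N) s ?y = cls (\<lambda>x\<in>X. fint (N x) s (\<lambda>j \<in> elts (far L s). h j x))" .
qed

lemma rint_ultraprod:
  assumes N: "fam N" and s: "s \<in> rsyms L" and h: "\<And>j. j \<in> elts (rar L s) \<Longrightarrow> h j \<in> (\<Pi>\<^sub>E x\<in>X. univ (N x))"
  shows "(\<lambda>j \<in> elts (rar L s). cls (h j)) \<in> rint (ultraprod L N) s \<longleftrightarrow>
      ae (\<lambda>x. (\<lambda>j \<in> elts (rar L s). h j x) \<in> rint (N x) s)"
proof -
  let ?y = "\<lambda>j \<in> elts (rar L s). cls (h j)"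
  have y: "?y \<in> elts (rar L s) \<rightarrow>\<^sub>E bar (\<lambda>x. univ (N x))" using h by auto
  then have "?y \<in> rint (ultraprod L N) s \<longleftrightarrow> ae (\<lambda>x. (\<lambda>j \<in> elts (rar L s). rep N (?y j) x) \<in> rint (N x) s)"
    using s by (simp add: ultraprod_def)
  also have "\<dots> \<longleftrightarrow> ae (\<lambda>x. (\<lambda>j \<in> elts (rar L s). h j x) \<in> rint (N x) s)"
    by (rule ae_iff) (rule ae_mono[OF ae_rep_tuple[OF N rar_lepoll[OF s] h]], auto)
  finally show ?thesis .
qed

lemma is_struc_ultraprod:
  assumes N: "fam N" shows "is_struc L (ultraprod L N)"
  unfolding is_struc_def
proof (intro conjI)
  let ?N = "ultraprod L N"
  show "small (univ ?N)" using small_bar famD(2)[OF N] by simp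
  show "univ ?N \<noteq> {}" using bar_nonempty famD(3)[OF N] by simp
  show "fint ?N \<in> (\<Pi>\<^sub>E s\<in>fsyms L. (elts (far L s) \<rightarrow>\<^sub>E univ ?N) \<rightarrow>\<^sub>E univ ?N)"
  proof (rule PiE_I, rule PiE_I)
    fix s y assume s: "s \<in> fsyms L" and y: "y \<in> elts (far L s) \<rightarrow>\<^sub>E univ ?N"
    obtain h where h: "\<And>j. j \<in> elts (far L s) \<Longrightarrow> h j \<in> (\<Pi>\<^sub>E x\<in>X. univ (N x))" "y = (\<lambda>j \<in> elts (far L s). cls (h j))"
      using y unfolding univ_ultraprod by (rule bar_tuple) (rule that)
    show "fint ?N s y \<in> univ ?N"
      using fint_ultraprod[OF N s h(1)] h(2) by simp
  qed (auto simp: ultraprod_def)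
  show "rint ?N \<in> (\<Pi>\<^sub>E s\<in>rsyms L. Pow (elts (rar L s) \<rightarrow>\<^sub>E univ ?N))"
    by (auto simp: ultraprod_def)
qed

lemma closed_in_bar:
  assumes N: "fam N" and S: "\<And>x. x \<in> X \<Longrightarrow> closed_in L (N x) (S x)"
  shows "closed_in L (ultraprod L N) (bar S)"
  unfolding closed_in_def
proof (intro conjI ballI)
  have sub: "\<And>x. x \<in> X \<Longrightarrow> S x \<subseteq> univ (N x)" using S by (simp add: closed_in_def)
  show "bar S \<subseteq> univ (ultraprod L N)" using bar_mono sub by simp
  show "bar S \<noteq> {}" by (rule bar_nonempty) (use S in \<open>simp add: closed_in_def\<close>)
  fix s y assume s: "s \<in> fsyms L" and y: "y \<in> elts (far L s) \<rightarrow>\<^sub>E bar S"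
  obtain h where h: "\<And>j. j \<in> elts (far L s) \<Longrightarrow> h j \<in> Pi\<^sub>E X S" "y = (\<lambda>j \<in> elts (far L s). cls (h j))"
    using y by (rule bar_tuple) (rule that)
  have h': "h j \<in> (\<Pi>\<^sub>E x\<in>X. univ (N x))" if "j \<in> elts (far L s)" for j
    using h(1)[OF that] by (rule subsetD[OF PiE_mono[OF sub], rotated])
  have "(\<lambda>x\<in>X. fint (N x) s (\<lambda>j \<in> elts (far L s). h j x)) \<in> Pi\<^sub>E X S"
  proof (rule restrict_PiE_iff[THEN iffD2], rule ballI)
    fix x assume x: "x \<in> X"
    have "(\<lambda>j \<in> elts (far L s). h j x) \<in> elts (far L s) \<rightarrow>\<^sub>E S x"
      using PiE_mem[OF h(1) x] by auto
    then show "fint (N x) s (\<lambda>j \<in> elts (far L s). h j x) \<in> S x"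
      using S[OF x] s by (simp add: closed_in_def)
  qed
  then show "fint (ultraprod L N) s y \<in> bar S"
    using fint_ultraprod(1)[OF N s h'] h(2) by simp
qed

lemma fam_restr: "fam N \<Longrightarrow> (\<And>x. x \<in> X \<Longrightarrow> closed_in L (N x) (S x)) \<Longrightarrow> fam (\<lambda>x. restr_struc L (N x) (S x))"
  unfolding fam_def using closed_in_subset by (simp add: is_struc_restr) blast

text \<open>Ultraproducts of submodels thus live on subsets of the form \<open>bar S\<close> of one
  ultraproduct, and questions about \<open>leK\<close> between them can be asked inside a fixed
  structure.\<close>

lemma ultraprod_restr:
  assumes N: "fam N" and S: "\<And>x. x \<in> X \<Longrightarrow> closed_in L (N x) (S x)"
  shows "ultraprod L (\<lambda>x. restr_struc L (N x) (S x)) = restr_struc L (ultraprod L N) (bar S)"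
proof (rule struc_eqI)
  note R = fam_restr[OF N S, simplified]
  show "is_struc L (ultraprod L (\<lambda>x. restr_struc L (N x) (S x)))" by (rule is_struc_ultraprod[OF R])
  show "is_struc L (restr_struc L (ultraprod L N) (bar S))"
    by (rule is_struc_restr[OF is_struc_ultraprod[OF N] closed_in_bar[OF N S]])
  show "univ (ultraprod L (\<lambda>x. restr_struc L (N x) (S x))) = univ (restr_struc L (ultraprod L N) (bar S))" by simp
next
  have sub: "\<And>x. x \<in> X \<Longrightarrow> S x \<subseteq> univ (N x)" using S by (simp add: closed_in_def)
  note R = fam_restr[OF N S, simplified]
  fix s y assume s: "s \<in> fsyms L" and "y \<in> elts (far L s) \<rightarrow>\<^sub>E univ (ultraprod L (\<lambda>x. restr_struc L (N x) (S x)))"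
  then have y: "y \<in> elts (far L s) \<rightarrow>\<^sub>E bar S" by simp
  obtain h where h: "\<And>j. j \<in> elts (far L s) \<Longrightarrow> h j \<in> Pi\<^sub>E X S" "y = (\<lambda>j \<in> elts (far L s). cls (h j))"
    using y by (rule bar_tuple) (rule that)
  have h': "h j \<in> (\<Pi>\<^sub>E x\<in>X. univ (N x))" if "j \<in> elts (far L s)" for j
    using h(1)[OF that] by (rule subsetD[OF PiE_mono[OF sub], rotated])
  have e: "fint (restr_struc L (N x) (S x)) s (\<lambda>j \<in> elts (far L s). h j x) = fint (N x) s (\<lambda>j \<in> elts (far L s). h j x)"
    if x: "x \<in> X" for x
    by (rule fint_restr[OF s]) (use PiE_mem[OF h(1) x] in auto)
  have "fint (ultraprod L (\<lambda>x. restr_struc L (N x) (S x))) s y =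
      cls (\<lambda>x\<in>X. fint (restr_struc L (N x) (S x)) s (\<lambda>j \<in> elts (far L s). h j x))"
    unfolding h(2) by (rule fint_ultraprod(1)[OF R s]) (use h(1) in simp)
  also have "\<dots> = cls (\<lambda>x\<in>X. fint (N x) s (\<lambda>j \<in> elts (far L s). h j x))"
    using e by (metis (no_types, lifting) restrict_ext)
  also have "\<dots> = fint (ultraprod L N) s y"
    unfolding h(2) by (rule fint_ultraprod(1)[OF N s h', symmetric])
  finally show "fint (ultraprod L (\<lambda>x. restr_struc L (N x) (S x))) s y = fint (restr_struc L (ultraprod L N) (bar S)) s y"
    by (simp add: fint_restr[OF s y])
next
  have sub: "\<And>x. x \<in> X \<Longrightarrow> S x \<subseteq> univ (N x)" using S by (simp add: closed_in_def)
  note R = fam_restr[OF N S, simplified]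
  fix s y assume s: "s \<in> rsyms L" and "y \<in> elts (rar L s) \<rightarrow>\<^sub>E univ (ultraprod L (\<lambda>x. restr_struc L (N x) (S x)))"
  then have y: "y \<in> elts (rar L s) \<rightarrow>\<^sub>E bar S" by simp
  obtain h where h: "\<And>j. j \<in> elts (rar L s) \<Longrightarrow> h j \<in> Pi\<^sub>E X S" "y = (\<lambda>j \<in> elts (rar L s). cls (h j))"
    using y by (rule bar_tuple) (rule that)
  have h': "h j \<in> (\<Pi>\<^sub>E x\<in>X. univ (N x))" if "j \<in> elts (rar L s)" for j
    using h(1)[OF that] by (rule subsetD[OF PiE_mono[OF sub], rotated])
  have "y \<in> rint (ultraprod L (\<lambda>x. restr_struc L (N x) (S x))) s \<longleftrightarrow>
      ae (\<lambda>x. (\<lambda>j \<in> elts (rar L s). h j x) \<in> rint (restr_struc L (N x) (S x)) s)"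
    unfolding h(2) by (rule rint_ultraprod[OF R s]) (use h(1) in simp)
  also have "\<dots> \<longleftrightarrow> ae (\<lambda>x. (\<lambda>j \<in> elts (rar L s). h j x) \<in> rint (N x) s)"
  proof (rule ae_cong)
    fix x assume x: "x \<in> X"
    have "(\<lambda>j \<in> elts (rar L s). h j x) \<in> elts (rar L s) \<rightarrow>\<^sub>E S x" using PiE_mem[OF h(1) x] by auto
    then show "(\<lambda>j \<in> elts (rar L s). h j x) \<in> rint (restr_struc L (N x) (S x)) s \<longleftrightarrow> 
        (\<lambda>j \<in> elts (rar L s). h j x) \<in> rint (N x) s"
      by (simp add: rint_restr[OF s])
  qed
  also have "\<dots> \<longleftrightarrow> y \<in> rint (ultraprod L N) s"
    unfolding h(2) by (rule rint_ultraprod[OF N s h', symmetric])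
  finally show "y \<in> rint (ultraprod L (\<lambda>x. restr_struc L (N x) (S x))) s \<longleftrightarrow> y \<in> rint (restr_struc L (ultraprod L N) (bar S)) s"
    using y by (simp add: rint_restr[OF s])
qed

section \<open>Maps between ultraproducts\<close>

definition ultramap :: "('v \<Rightarrow> 'v struc) \<Rightarrow> ('v \<Rightarrow> 'v \<Rightarrow> 'v) \<Rightarrow> 'v \<Rightarrow> 'v" where
  "ultramap P g y = cls (\<lambda>x\<in>X. g x (rep P y x))"

lemma ultramap_cls:
  assumes P: "fam P" and Q: "fam Q" and g: "\<And>x u. x \<in> X \<Longrightarrow> u \<in> univ (P x) \<Longrightarrow> g x u \<in> univ (Q x)"
    and h: "h \<in> (\<Pi>\<^sub>E x\<in>X. univ (P x))"
  shows "ultramap P g (cls h) = cls (\<lambda>x\<in>X. g x (h x))" "(\<lambda>x\<in>X. g x (h x)) \<in> (\<Pi>\<^sub>E x\<in>X. univ (Q x))"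
proof -
  have m: "(\<lambda>x\<in>X. g x (k x)) \<in> (\<Pi>\<^sub>E x\<in>X. univ (Q x))" if "k \<in> (\<Pi>\<^sub>E x\<in>X. univ (P x))" for k
    using that g by (auto simp: PiE_iff)
  show "(\<lambda>x\<in>X. g x (h x)) \<in> (\<Pi>\<^sub>E x\<in>X. univ (Q x))" by (rule m[OF h])
  show "ultramap P g (cls h) = cls (\<lambda>x\<in>X. g x (h x))"
    unfolding ultramap_def
    by (subst fam_cls_eq_iff[OF Q m[OF rep(1)[OF P h]] m[OF h]]) (rule ae_mono[OF rep(2)[OF P h]], simp)
qed

text \<open>The maps \<open>g x\<close> are isomorphisms almost everywhere only, which allows for
  arbitrary default maps elsewhere; they still take values in \<open>Q x\<close>, so that the image
  of a representative is a representative.\<close>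

lemma ultramap_iso:
  assumes P: "fam P" and Q: "fam Q" and g: "\<And>x u. x \<in> X \<Longrightarrow> u \<in> univ (P x) \<Longrightarrow> g x u \<in> univ (Q x)"
    and iso: "ae (\<lambda>x. struc_iso L (g x) (P x) (Q x))"
  shows "struc_iso L (ultramap P g) (ultraprod L P) (ultraprod L Q)"
proof -
  let ?G = "ultramap P g"
  have G: "?G (cls h) = cls (\<lambda>x\<in>X. g x (h x))" "(\<lambda>x\<in>X. g x (h x)) \<in> (\<Pi>\<^sub>E x\<in>X. univ (Q x))"
    if "h \<in> (\<Pi>\<^sub>E x\<in>X. univ (P x))" for h
    using ultramap_cls[OF P Q _ that, of g] g by blast+
  have bij: "bij_betw ?G (univ (ultraprod L P)) (univ (ultraprod L Q))"
    unfolding bij_betw_def univ_ultraprod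
  proof (intro conjI equalityI subsetI)
    show "inj_on ?G (bar (\<lambda>x. univ (P x)))"
    proof (rule inj_onI, elim imageE, hypsubst)
      fix h k assume hk: "h \<in> (\<Pi>\<^sub>E x\<in>X. univ (P x))" "k \<in> (\<Pi>\<^sub>E x\<in>X. univ (P x))" "?G (cls h) = ?G (cls k)"
      then have "ae (\<lambda>x. (\<lambda>x\<in>X. g x (h x)) x = (\<lambda>x\<in>X. g x (k x)) x)"
        using fam_cls_eq_iff[OF Q G(2)[OF hk(1)] G(2)[OF hk(2)]] G(1) by simp
      from ae_conj[OF this iso] have "ae (\<lambda>x. h x = k x)"
      proof (rule ae_mono)
        fix x assume x: "x \<in> X" and *: "(\<lambda>x\<in>X. g x (h x)) x = (\<lambda>x\<in>X. g x (k x)) x \<and> struc_iso L (g x) (P x) (Q x)"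
        then have "inj_on (g x) (univ (P x))" using struc_isoD(3) by blast
        then show "h x = k x"
          by (rule inj_onD) (use * x PiE_mem[OF hk(1) x] PiE_mem[OF hk(2) x] in auto)
      qed
      then show "cls h = cls k" using fam_cls_eq_iff[OF P hk(1,2)] by simp
    qed
  next
    fix y assume "y \<in> ?G ` bar (\<lambda>x. univ (P x))"
    then show "y \<in> bar (\<lambda>x. univ (Q x))" using G by auto
  next
    fix y assume "y \<in> bar (\<lambda>x. univ (Q x))"
    then obtain k where k: "k \<in> (\<Pi>\<^sub>E x\<in>X. univ (Q x))" "y = cls k" by blast
    have "\<forall>x \<in> X. \<exists>u \<in> univ (P x). struc_iso L (g x) (P x) (Q x) \<longrightarrow> g x u = k x"
    proof
      fix x assume x: "x \<in> X"
      have "\<exists>u \<in> univ (P x). g x u = k x" if "struc_iso L (g x) (P x) (Q x)"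
        using struc_isoD(4)[OF that] PiE_mem[OF k(1) x] by (metis imageE)
      then show "\<exists>u \<in> univ (P x). struc_iso L (g x) (P x) (Q x) \<longrightarrow> g x u = k x"
        using famD(3)[OF P x] by blast
    qed
    then obtain h where h: "\<And>x. x \<in> X \<Longrightarrow> h x \<in> univ (P x) \<and> (struc_iso L (g x) (P x) (Q x) \<longrightarrow> g x (h x) = k x)"
      by metis
    have hP: "restrict h X \<in> (\<Pi>\<^sub>E x\<in>X. univ (P x))" using h by auto
    have "?G (cls (restrict h X)) = cls k"
      unfolding G(1)[OF hP] fam_cls_eq_iff[OF Q G(2)[OF hP] k(1)]
      by (rule ae_mono[OF iso]) (simp add: h)
    then show "y \<in> ?G ` bar (\<lambda>x. univ (P x))" using hP k(2) by (metis imageI)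
  qed
  show ?thesis
    unfolding struc_iso_def
  proof (intro conjI ballI is_struc_ultraprod P Q bij)
    fix s y assume s: "s \<in> fsyms L" and y: "y \<in> elts (far L s) \<rightarrow>\<^sub>E univ (ultraprod L P)"
    obtain h where h: "\<And>j. j \<in> elts (far L s) \<Longrightarrow> h j \<in> (\<Pi>\<^sub>E x\<in>X. univ (P x))" "y = (\<lambda>j \<in> elts (far L s). cls (h j))"
      using y unfolding univ_ultraprod by (rule bar_tuple) (rule that)
    let ?k = "\<lambda>j. \<lambda>x\<in>X. g x (h j x)"
    have c: "compose (elts (far L s)) ?G y = (\<lambda>j \<in> elts (far L s). cls (?k j))"
      using G(1)[OF h(1)] by (auto simp: compose_def h(2) fun_eq_iff)
    have F: "fint (ultraprod L P) s (\<lambda>j \<in> elts (far L s). cls (h j)) =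
          cls (\<lambda>x\<in>X. fint (P x) s (\<lambda>j \<in> elts (far L s). h j x))"
        "(\<lambda>x\<in>X. fint (P x) s (\<lambda>j \<in> elts (far L s). h j x)) \<in> (\<Pi>\<^sub>E x\<in>X. univ (P x))"
      by (rule fint_ultraprod[OF P s h(1)], assumption)+
    have kQ: "?k j \<in> (\<Pi>\<^sub>E x\<in>X. univ (Q x))" if "j \<in> elts (far L s)" for j by (rule G(2)[OF h(1)[OF that]])
    have FQ: "fint (ultraprod L Q) s (\<lambda>j \<in> elts (far L s). cls (?k j)) =
          cls (\<lambda>x\<in>X. fint (Q x) s (\<lambda>j \<in> elts (far L s). ?k j x))"
        "(\<lambda>x\<in>X. fint (Q x) s (\<lambda>j \<in> elts (far L s). ?k j x)) \<in> (\<Pi>\<^sub>E x\<in>X. univ (Q x))"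
      by (rule fint_ultraprod[OF Q s kQ], assumption)+
    have "?G (fint (ultraprod L P) s y) = cls (\<lambda>x\<in>X. g x ((\<lambda>x\<in>X. fint (P x) s (\<lambda>j \<in> elts (far L s). h j x)) x))"
      unfolding h(2) F(1) by (rule G(1)[OF F(2)])
    also have "\<dots> = cls (\<lambda>x\<in>X. fint (Q x) s (\<lambda>j \<in> elts (far L s). ?k j x))"
      unfolding fam_cls_eq_iff[OF Q G(2)[OF F(2)] FQ(2)]
    proof (rule ae_mono[OF iso])
      fix x assume x: "x \<in> X" and i: "struc_iso L (g x) (P x) (Q x)"
      have "(\<lambda>j \<in> elts (far L s). h j x) \<in> elts (far L s) \<rightarrow>\<^sub>E univ (P x)" using PiE_mem[OF h(1) x] by auto
      from struc_isoD(5)[OF i s this]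
      show "(\<lambda>x\<in>X. g x ((\<lambda>x\<in>X. fint (P x) s (\<lambda>j \<in> elts (far L s). h j x)) x)) x =
          (\<lambda>x\<in>X. fint (Q x) s (\<lambda>j \<in> elts (far L s). ?k j x)) x"
        using x by (simp add: compose_def cong: restrict_cong)
    qed
    finally show "?G (fint (ultraprod L P) s y) = fint (ultraprod L Q) s (compose (elts (far L s)) ?G y)"
      unfolding c FQ(1) .
  next
    fix s y assume s: "s \<in> rsyms L" and y: "y \<in> elts (rar L s) \<rightarrow>\<^sub>E univ (ultraprod L P)"
    obtain h where h: "\<And>j. j \<in> elts (rar L s) \<Longrightarrow> h j \<in> (\<Pi>\<^sub>E x\<in>X. univ (P x))" "y = (\<lambda>j \<in> elts (rar L s). cls (h j))"
      using y unfolding univ_ultraprod by (rule bar_tuple) (rule that)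
    let ?k = "\<lambda>j. \<lambda>x\<in>X. g x (h j x)"
    have c: "compose (elts (rar L s)) ?G y = (\<lambda>j \<in> elts (rar L s). cls (?k j))"
      using G(1)[OF h(1)] by (auto simp: compose_def h(2) fun_eq_iff)
    have kQ: "?k j \<in> (\<Pi>\<^sub>E x\<in>X. univ (Q x))" if "j \<in> elts (rar L s)" for j by (rule G(2)[OF h(1)[OF that]])
    have "y \<in> rint (ultraprod L P) s \<longleftrightarrow> ae (\<lambda>x. (\<lambda>j \<in> elts (rar L s). h j x) \<in> rint (P x) s)"
      unfolding h(2) by (rule rint_ultraprod[OF P s h(1)])
    also have "\<dots> \<longleftrightarrow> ae (\<lambda>x. (\<lambda>j \<in> elts (rar L s). ?k j x) \<in> rint (Q x) s)"
    proof (rule ae_iff, rule ae_mono[OF iso])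
      fix x assume x: "x \<in> X" and i: "struc_iso L (g x) (P x) (Q x)"
      have "(\<lambda>j \<in> elts (rar L s). h j x) \<in> elts (rar L s) \<rightarrow>\<^sub>E univ (P x)" using PiE_mem[OF h(1) x] by auto
      from struc_isoD(6)[OF i s this]
      show "(\<lambda>j \<in> elts (rar L s). h j x) \<in> rint (P x) s \<longleftrightarrow> (\<lambda>j \<in> elts (rar L s). ?k j x) \<in> rint (Q x) s"
        using x by (simp add: compose_def cong: restrict_cong)
    qed
    also have "\<dots> \<longleftrightarrow> compose (elts (rar L s)) ?G y \<in> rint (ultraprod L Q) s"
      unfolding c by (rule rint_ultraprod[OF Q s kQ, symmetric])
    finally show "y \<in> rint (ultraprod L P) s \<longleftrightarrow> compose (elts (rar L s)) ?G y \<in> rint (ultraprod L Q) s" .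
  qed
qed

definition diag :: "'v \<Rightarrow> 'v" where
  "diag m = cls (\<lambda>x\<in>X. m)"

text \<open>A representative with values in a set of size at most \<theta> is constant almost
  everywhere.\<close>

lemma diag_image_small:
  assumes "S \<subseteq> V" "S \<lesssim> elts \<theta>" shows "diag ` S = bar (\<lambda>_. S)"
proof (intro equalityI subsetI)
  fix y assume "y \<in> bar (\<lambda>_. S)"
  then obtain h where h: "h \<in> X \<rightarrow>\<^sub>E S" "y = cls h" by blast
  have "ae (\<lambda>x. h x \<in> S)" using h(1) by (intro ae_all') auto
  with assms(2) obtain b where b: "b \<in> S" "ae (\<lambda>x. h x = b)" by (rule ae_pigeonhole)
  have "cls h = cls (\<lambda>x\<in>X. b)"
    using b h(1) assms(1) by (subst cls_eq_iff) (auto intro: PiE_range_mono ae_mono)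
  then show "y \<in> diag ` S" using b(1) h(2) by (simp add: diag_def)
qed (auto simp: diag_def)

text \<open>The size of \<open>N\<close> does not enter here: it matters for the surjectivity of
  \<open>diag\<close>, not for its being an isomorphism onto the image.\<close>

lemma diag_iso:
  assumes N: "is_struc L N" "univ N \<subseteq> V"
  shows "struc_iso L diag N (restr_struc L (ultraprod L (\<lambda>_. N)) (diag ` univ N))"
proof -
  let ?N = "ultraprod L (\<lambda>_. N)"
  have fam: "fam (\<lambda>_. N)" using N by (simp add: fam_def)
  have d: "(\<lambda>x\<in>X. m) \<in> (\<Pi>\<^sub>E x\<in>X. univ N)" if "m \<in> univ N" for m using that by auto
  have inj: "inj_on diag (univ N)"
  proof (rule inj_onI)
    fix m n assume mn: "m \<in> univ N" "n \<in> univ N" "diag m = diag n"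
    then have "ae (\<lambda>x. (\<lambda>x\<in>X. m) x = (\<lambda>x\<in>X. n) x)"
      using fam_cls_eq_iff[OF fam d d] by (simp add: diag_def)
    then show "m = n" using ae_ex by fastforce
  qed
  have ax: "(\<lambda>j\<in>J. a j) = a" if "a \<in> J \<rightarrow>\<^sub>E univ N" for a and J :: "'v set" using that by (simp add: PiE_restrict)
  have cd: "compose J diag a = (\<lambda>j\<in>J. cls (\<lambda>x\<in>X. a j))" for a and J :: "'v set"
    by (simp add: compose_def diag_def)
  have F: "fint ?N s (compose (elts (far L s)) diag a) = diag (fint N s a)"
    if s: "s \<in> fsyms L" and a: "a \<in> elts (far L s) \<rightarrow>\<^sub>E univ N" for s a
  proof -
    have "fint ?N s (compose (elts (far L s)) diag a) = cls (\<lambda>x\<in>X. fint N s (\<lambda>j\<in>elts (far L s). (\<lambda>x\<in>X. a j) x))"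
      unfolding cd by (rule fint_ultraprod(1)[OF fam s]) (use a in auto)
    also have "(\<lambda>x\<in>X. fint N s (\<lambda>j\<in>elts (far L s). (\<lambda>x\<in>X. a j) x)) = (\<lambda>x\<in>X. fint N s a)"
      by (rule restrict_ext) (simp add: ax[OF a])
    finally show ?thesis unfolding diag_def .
  qed
  have R: "compose (elts (rar L s)) diag a \<in> rint ?N s \<longleftrightarrow> a \<in> rint N s"
    if s: "s \<in> rsyms L" and a: "a \<in> elts (rar L s) \<rightarrow>\<^sub>E univ N" for s a
  proof -
    have "compose (elts (rar L s)) diag a \<in> rint ?N s \<longleftrightarrow> ae (\<lambda>x. (\<lambda>j\<in>elts (rar L s). (\<lambda>x\<in>X. a j) x) \<in> rint N s)"
      unfolding cd by (rule rint_ultraprod[OF fam s]) (use a in auto)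
    also have "\<dots> \<longleftrightarrow> ae (\<lambda>x. a \<in> rint N s)"
      by (rule ae_cong) (simp add: ax[OF a])
    also have "\<dots> \<longleftrightarrow> a \<in> rint N s" using ae_ex[of "\<lambda>_. a \<in> rint N s"] ae_all'[of "\<lambda>_. a \<in> rint N s"] by blast
    finally show ?thesis .
  qed
  have cl: "closed_in L ?N (diag ` univ N)"
    unfolding closed_in_def
  proof (intro conjI ballI)
    show "diag ` univ N \<subseteq> univ ?N" by (auto simp: diag_def)
    show "diag ` univ N \<noteq> {}" using N(1) by (simp add: is_struc_def)
    fix s y assume s: "s \<in> fsyms L" and y: "y \<in> elts (far L s) \<rightarrow>\<^sub>E diag ` univ N"
    obtain a where a: "a \<in> elts (far L s) \<rightarrow>\<^sub>E univ N" "y = compose (elts (far L s)) diag a"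
      using y by (rule PiE_image_compose)
    then show "fint ?N s y \<in> diag ` univ N" using F[OF s a(1)] is_struc_fint[OF N(1) s a(1)] by simp
  qed
  have cI: "compose J diag a \<in> J \<rightarrow>\<^sub>E diag ` univ N" if "a \<in> J \<rightarrow>\<^sub>E univ N" for a and J :: "'v set"
    using that by (rule compose_PiE[rotated]) simp
  show ?thesis
    unfolding struc_iso_def
    using N(1) is_struc_restr[OF is_struc_ultraprod[OF fam] cl] inj F R
    by (simp add: bij_betw_def fint_restr rint_restr cI)
qed

end

section \<open>Ultraproducts in abstract elementary classes\<close>

text \<open>For sets of size at most \<open>l\<close> the bound of the axiom collapses to
  \<open>l\<close>, because \<open>l\<close> equals its own number of sequences of length below
  \<mu>.\<close>

lemma lowenheim_skolem_tarskiE: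
  assumes "mu_aec \<mu> (K :: 'v::zfc_universe absclass)"
  obtains l :: "'v::zfc_universe" where "infinite (elts l)" "elts \<mu> \<lesssim> elts l"
    "\<And>M A. M \<in> models K \<Longrightarrow> A \<subseteq> univ M \<Longrightarrow> A \<lesssim> elts l \<Longrightarrow> \<exists>B. strong K M B \<and> A \<subseteq> B \<and> B \<lesssim> elts l"
proof -
  interpret mu_class \<mu> K using assms by unfold_locales
  have "lowenheim_skolem_tarski \<mu> K" using assms by (simp add: mu_aec_def)
  then obtain l where "Card l \<and> elts l \<approx> seqs_lt \<mu> (elts l) \<and> (fsyms L <+> rsyms L) <+> elts \<mu> \<lesssim> elts l \<and>
     (\<forall>M \<in> models K. \<forall>A \<subseteq> univ M. \<exists>N. leK K N M \<and> A \<subseteq> univ N \<and> univ N \<lesssim> seqs_lt \<mu> A <+> elts l)"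
    unfolding lowenheim_skolem_tarski_def by (rule exE)
  then have l: "elts l \<approx> seqs_lt \<mu> (elts l)" "(fsyms L <+> rsyms L) <+> elts \<mu> \<lesssim> elts l"
    and lst: "\<And>M A. M \<in> models K \<Longrightarrow> A \<subseteq> univ M \<Longrightarrow>
           \<exists>N. leK K N M \<and> A \<subseteq> univ N \<and> univ N \<lesssim> seqs_lt \<mu> A <+> elts l"
    by simp_all
  have \<mu>l: "elts \<mu> \<lesssim> elts l" using lepoll_trans[OF lepoll_Plus2 l(2)] .
  have inf: "infinite (elts l)" using \<mu>l infinite_mu infinite_le_lepoll lepoll_trans by blast
  show ?thesis
  proof (rule that[OF inf \<mu>l])
    fix M A assume M: "M \<in> models K" "A \<subseteq> univ M" and A: "A \<lesssim> elts l"
    obtain N where N: "leK K N M" "A \<subseteq> univ N" "univ N \<lesssim> seqs_lt \<mu> A <+> elts l" using lst[OF M] by blast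
    have "seqs_lt \<mu> A \<lesssim> seqs_lt \<mu> (elts l)"
      unfolding seqs_lt_def by (intro Sigma_lepoll_mono order_refl lepoll_funcset_right A)
    then have "seqs_lt \<mu> A \<lesssim> elts l" using l(1) lepoll_trans2 eqpoll_sym by blast
    then have "univ N \<lesssim> elts l" using N(3) infinite_Plus_lepoll[OF inf] lepoll_trans by blast
    then show "\<exists>B. strong K M B \<and> A \<subseteq> B \<and> B \<lesssim> elts l"
      using N leK_imp_strong by blast
  qed
qed

text \<open>The last assumption counts structures on subsets of \<open>l\<close> with a marked
  subset. Up to isomorphism these are all pairs consisting of a submodel of size at most
  \<open>l\<close> and a subset of it, so \<theta> bounds the number of isomorphism types of such
  pairs.\<close>

locale mu_ultra = mu_class \<mu> K + ultra_lang X U \<theta> V "lang K"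
  for \<mu> and K :: "'v::zfc_universe absclass" and X U \<theta> V +
  fixes l :: 'v
  assumes infinite_l: "infinite (elts l)" and \<mu>_lepoll_l: "elts \<mu> \<lesssim> elts l"
    and small_strong: "M \<in> models K \<Longrightarrow> A \<subseteq> univ M \<Longrightarrow> A \<lesssim> elts l \<Longrightarrow> \<exists>B. strong K M B \<and> A \<subseteq> B \<and> B \<lesssim> elts l"
    and l_lepoll_\<theta>: "elts l \<lesssim> elts \<theta>"
    and strucs_lepoll: "{(S, T). is_struc (lang K) T \<and> univ T \<subseteq> elts l \<and> S \<subseteq> univ T} \<lesssim> elts \<theta>"
begin

definition mfam :: "('v \<Rightarrow> 'v struc) \<Rightarrow> bool" where
  "mfam N \<longleftrightarrow> (\<forall>x \<in> X. N x \<in> models K \<and> univ (N x) \<subseteq> V)"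

lemma mfam_fam: "mfam N \<Longrightarrow> fam N"
  unfolding mfam_def fam_def using models_struc by blast

lemma mfamD: "mfam N \<Longrightarrow> x \<in> X \<Longrightarrow> N x \<in> models K"
  by (simp add: mfam_def)

definition small_fam :: "('v \<Rightarrow> 'v struc) \<Rightarrow> ('v \<Rightarrow> 'v set) \<Rightarrow> bool" where
  "small_fam N S \<longleftrightarrow> (\<forall>x \<in> X. strong K (N x) (S x) \<and> S x \<lesssim> elts l)"

lemma strong_nonempty: "strong K N B \<Longrightarrow> B \<noteq> {}"
  using strong_closed by (auto simp: closed_in_def)

lemma strong_mfam:
  assumes "mfam N" "x \<in> X" "strong K (N x) B" shows "B \<subseteq> V" "B \<noteq> {}" "closed_in L (N x) B"
  using assms strong_subset strong_nonempty strong_closed unfolding mfam_def by blast+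

text \<open>A representative that lies in \<open>S x\<close> only almost everywhere is corrected on
  a null set.\<close>

lemma cls_in_bar:
  assumes "k \<in> X \<rightarrow>\<^sub>E V" "\<And>x. x \<in> X \<Longrightarrow> S x \<subseteq> V" "\<And>x. x \<in> X \<Longrightarrow> S x \<noteq> {}" "ae (\<lambda>x. k x \<in> S x)"
  shows "cls k \<in> bar S"
proof -
  have "\<forall>x \<in> X. \<exists>u. u \<in> S x" using assms(3) by blast
  then obtain t where t: "\<And>x. x \<in> X \<Longrightarrow> t x \<in> S x" by metis
  define g where "g = (\<lambda>x\<in>X. if k x \<in> S x then k x else t x)"
  have g: "g \<in> Pi\<^sub>E X S" using t by (auto simp: g_def)
  have gV: "g \<in> X \<rightarrow>\<^sub>E V" by (rule PiE_V[OF _ g]) (rule assms(2))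
  have "cls k = cls g"
    unfolding cls_eq_iff[OF assms(1) gV]
    by (rule ae_mono[OF assms(4)]) (simp add: g_def)
  then show ?thesis using g by blast
qed

text \<open>
  Modulo \<open>U\<close> the pairs \<open>(S x, T x)\<close> are all isomorphic to a single pair \<open>(S x\<^sub>0, T x\<^sub>0)\<close>, as there are at most
  \<open>\<theta>\<close> isomorphism types; and a structure of size at most \<open>\<theta>\<close> is isomorphic to its ultrapower.
\<close>

lemma small_fam_leK:
  assumes N: "mfam N" and S: "small_fam N S" and T: "small_fam N T" and ST: "\<And>x. x \<in> X \<Longrightarrow> S x \<subseteq> T x"
  shows "leK K (restr_struc L (ultraprod L N) (bar S)) (restr_struc L (ultraprod L N) (bar T))"
proof -
  have sS: "strong K (N x) (S x)" and sT: "strong K (N x) (T x)" and lT: "T x \<lesssim> elts l" if "x \<in> X" for x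
    using S T that by (auto simp: small_fam_def)
  let ?T = "\<lambda>x. restr_struc L (N x) (T x)"
  have TM: "?T x \<in> models K" if "x \<in> X" for x using strong_models(2)[OF sT[OF that]] .
  have "\<forall>x \<in> X. \<exists>e R. inj_on e (T x) \<and> e ` T x \<subseteq> elts l \<and> struc_iso L e (?T x) R \<and> univ R = e ` T x"
  proof
    fix x assume x: "x \<in> X"
    obtain e where e: "inj_on e (T x)" "e ` T x \<subseteq> elts l" using lT[OF x] unfolding lepoll_def by blast
    obtain R where "struc_iso L e (?T x) R" "univ R = e ` T x"
      using ex_struc_iso[OF models_struc[OF TM[OF x]], of e] e(1) by auto
    then show "\<exists>e R. inj_on e (T x) \<and> e ` T x \<subseteq> elts l \<and> struc_iso L e (?T x) R \<and> univ R = e ` T x"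
      using e by blast
  qed
  then obtain e R where e: "\<And>x. x \<in> X \<Longrightarrow> inj_on (e x) (T x) \<and> e x ` T x \<subseteq> elts l \<and> 
      struc_iso L (e x) (?T x) (R x) \<and> univ (R x) = e x ` T x" by metis
  \<comment> \<open>A copy of \<open>T x\<close> on a subset of \<open>l\<close> together with the
    image of \<open>S x\<close>: equality of codes provides an isomorphism of pairs.\<close>
  define code where "code x = (e x ` S x, R x)" for x
  have "code x \<in> {(S, T). is_struc (lang K) T \<and> univ T \<subseteq> elts l \<and> S \<subseteq> univ T}" if "x \<in> X" for x
    using e[OF that] struc_isoD(2) ST[OF that] by (fastforce simp: code_def)
  then have "ae (\<lambda>x. code x \<in> {(S, T). is_struc (lang K) T \<and> univ T \<subseteq> elts l \<and> S \<subseteq> univ T})"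
    by (rule ae_all')
  with strucs_lepoll obtain c where c: "ae (\<lambda>x. code x = c)" by (rule ae_pigeonhole)
  obtain x0 where x0: "x0 \<in> X" "code x0 = c" using ae_ex[OF c] by blast
  let ?M = "?T x0"
  have "\<forall>x \<in> X. \<exists>u. u \<in> T x" using strong_nonempty[OF sT] by blast
  then obtain t where t: "\<And>x. x \<in> X \<Longrightarrow> t x \<in> T x" by metis
  \<comment> \<open>Where the code is not \<open>c\<close>, the map is constant with value in
    \<open>T x\<close>, which keeps all representatives in the product.\<close>
  define g where "g x u = (if code x = c then inv_into (T x) (e x) (e x0 u) else t x)" for x u
  have iso: "struc_iso L (g x) ?M (?T x)" and gS: "g x ` S x0 = S x" if x: "x \<in> X" "code x = c" for x
  proof -
    have g: "g x = inv_into (T x) (e x) \<circ> e x0" using x(2) by (auto simp: g_def)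
    have R: "R x = R x0" and eS: "e x ` S x = e x0 ` S x0" using x(2) x0(2) by (auto simp: code_def)
    have "struc_iso L (inv_into (T x) (e x)) (R x) (?T x)"
      using struc_iso_inv[of L "e x" "?T x" "R x"] e[OF x(1)] by (metis univ_restr)
    then show "struc_iso L (g x) ?M (?T x)"
      unfolding g R using e[OF x0(1)] by (intro struc_iso_comp[of L "e x0" ?M "R x0"]) simp_all
    show "g x ` S x0 = S x"
      unfolding g image_comp[symmetric] eS[symmetric]
      using inv_into_image_cancel[of "e x" "T x" "S x"] e[OF x(1)] ST[OF x(1)] by blast
  qed
  have aeiso: "ae (\<lambda>x. struc_iso L (g x) ?M (?T x))" 
    by (rule ae_mono[OF c]) (rule iso)
  have gT: "g x u \<in> univ (?T x)" if "x \<in> X" "u \<in> univ ?M" for x u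
  proof (cases "code x = c")
    case True then show ?thesis using struc_isoD(4)[OF iso[OF that(1)]] that(2) by blast
  qed (use t that in \<open>simp add: g_def\<close>)
  have cT: "\<And>x. x \<in> X \<Longrightarrow> closed_in L (N x) (T x)" using strong_closed[OF sT] .
  have fP: "fam (\<lambda>_. ?M)" and fQ: "fam ?T"
    using fam_restr[OF mfam_fam[OF N] cT] x0(1) by (auto simp: fam_def)
  have uV: "univ ?M \<subseteq> V" "univ ?M \<lesssim> elts \<theta>"
    using strong_mfam(1)[OF N x0(1) sT[OF x0(1)]] lepoll_trans[OF lT[OF x0(1)] l_lepoll_\<theta>] by auto
  have "struc_iso L diag ?M (restr_struc L (ultraprod L (\<lambda>_. ?M)) (diag ` univ ?M))"
    by (rule diag_iso[OF models_struc[OF TM[OF x0(1)]] uV(1)])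
  also have "diag ` univ ?M = univ (ultraprod L (\<lambda>_. ?M))"
    using diag_image_small[OF uV] by simp
  also have "restr_struc L (ultraprod L (\<lambda>_. ?M)) \<dots> = ultraprod L (\<lambda>_. ?M)"
    by (rule restr_univ[OF is_struc_ultraprod[OF fP]])
  finally have d: "struc_iso L diag ?M (ultraprod L (\<lambda>_. ?M))" .
  let ?G = "ultramap (\<lambda>_. ?M) g"
  have "struc_iso L ?G (ultraprod L (\<lambda>_. ?M)) (ultraprod L ?T)"
    by (rule ultramap_iso[OF fP fQ gT aeiso])
  also have "ultraprod L ?T = restr_struc L (ultraprod L N) (bar T)"
    by (rule ultraprod_restr[OF mfam_fam[OF N] cT])
  finally have G: "struc_iso L (?G \<circ> diag) ?M (restr_struc L (ultraprod L N) (bar T))"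
    by (rule struc_iso_comp[OF d])
  have S0: "S x0 \<subseteq> V" "S x0 \<lesssim> elts \<theta>" "S x0 \<subseteq> univ ?M"
    using ST[OF x0(1)] uV subset_imp_lepoll lepoll_trans by (auto, blast)
  have SV: "\<And>x. x \<in> X \<Longrightarrow> S x \<subseteq> V" "\<And>x. x \<in> X \<Longrightarrow> S x \<noteq> {}"
    using strong_mfam[OF N _ sS] by blast+
  have Gc: "?G (cls h) = cls (\<lambda>x\<in>X. g x (h x))" "(\<lambda>x\<in>X. g x (h x)) \<in> X \<rightarrow>\<^sub>E V" if "h \<in> X \<rightarrow>\<^sub>E S x0" for h
  proof -
    have h: "h \<in> (\<Pi>\<^sub>E x\<in>X. univ ?M)" using PiE_range_mono[OF S0(3) that] .
    show "?G (cls h) = cls (\<lambda>x\<in>X. g x (h x))" 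
      by (rule ultramap_cls(1)[OF fP fQ gT h])
    have "(\<lambda>x\<in>X. g x (h x)) \<in> (\<Pi>\<^sub>E x\<in>X. univ (?T x))" by (rule ultramap_cls(2)[OF fP fQ gT h])
    then show "(\<lambda>x\<in>X. g x (h x)) \<in> X \<rightarrow>\<^sub>E V" by (rule PiE_V[rotated]) (rule famD(2)[OF fQ])
  qed
  have "(?G \<circ> diag) ` S x0 = ?G ` bar (\<lambda>_. S x0)"
    using diag_image_small[OF S0(1,2)] by (metis image_comp)
  also have "\<dots> = bar S"
  proof (intro equalityI subsetI)
    fix y assume "y \<in> ?G ` bar (\<lambda>_. S x0)"
    then obtain h where h: "h \<in> X \<rightarrow>\<^sub>E S x0" "y = ?G (cls h)" by blast
    show "y \<in> bar S"
      unfolding h(2) Gc(1)[OF h(1)]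
    proof (rule cls_in_bar[OF Gc(2)[OF h(1)] SV])
      show "ae (\<lambda>x. (\<lambda>x\<in>X. g x (h x)) x \<in> S x)"
      proof (rule ae_mono[OF c])
        fix x assume "x \<in> X" "code x = c"
        then show "(\<lambda>x\<in>X. g x (h x)) x \<in> S x" using gS PiE_mem[OF h(1)] by auto
      qed
    qed
  next
    fix y assume "y \<in> bar S"
    then obtain k where k: "k \<in> Pi\<^sub>E X S" "y = cls k" by blast
    have "\<forall>x \<in> X. \<exists>u \<in> S x0. code x = c \<longrightarrow> g x u = k x"
    proof
      fix x assume x: "x \<in> X"
      show "\<exists>u \<in> S x0. code x = c \<longrightarrow> g x u = k x"
        using gS[OF x] PiE_mem[OF k(1) x] SV(2)[OF x0(1)] by (cases "code x = c") (metis imageE, blast)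
    qed
    then obtain h where h: "\<And>x. x \<in> X \<Longrightarrow> h x \<in> S x0 \<and> (code x = c \<longrightarrow> g x (h x) = k x)" by metis
    have hS: "restrict h X \<in> X \<rightarrow>\<^sub>E S x0" using h by auto
    have kV: "k \<in> X \<rightarrow>\<^sub>E V" by (rule PiE_V[OF _ k(1)]) (rule SV(1))
    have "?G (cls (restrict h X)) = cls k"
      unfolding Gc(1)[OF hS] cls_eq_iff[OF Gc(2)[OF hS] kV]
      by (rule ae_mono[OF c]) (simp add: h)
    then show "y \<in> ?G ` bar (\<lambda>_. S x0)" using hS k(2) by (metis imageI)
  qed
  finally have GS: "(?G \<circ> diag) ` S x0 = bar S" .
  have "strong K (restr_struc L (ultraprod L N) (bar T)) (bar S)"
    using strong_iso[OF G strong_restrI[OF sT[OF x0(1)] sS[OF x0(1)] ST[OF x0(1)]]] GS by simp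
  then show ?thesis
    unfolding strong_def using restr_restr[OF bar_mono, of S T, OF ST] by simp
qed

text \<open>Inclusion of the bars gives \<open>S x \<subseteq> T x\<close> only almost everywhere;
  \<open>S\<close> is changed to \<open>T\<close> on the exceptional set, which leaves
  \<open>bar S\<close> unchanged.\<close>

lemma small_fam_leK_bar:
  assumes N: "mfam N" and S: "small_fam N S" and T: "small_fam N T" and ST: "bar S \<subseteq> bar T"
  shows "leK K (restr_struc L (ultraprod L N) (bar S)) (restr_struc L (ultraprod L N) (bar T))"
proof -
  define S' where "S' x = (if S x \<subseteq> T x then S x else T x)" for x
  have S': "small_fam N S'" using S T by (simp add: small_fam_def S'_def)
  have n: "W x \<subseteq> V" "W x \<noteq> {}" if "small_fam N W" "x \<in> X" for W x
    using that strong_mfam[OF N] unfolding small_fam_def by blast+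
  have "ae (\<lambda>x. S x \<subseteq> T x)" using ST by (subst (asm) bar_subset_iff) (use n S T in auto)
  then have "ae (\<lambda>x. S x = S' x)" by (rule ae_mono) (simp add: S'_def)
  then have "bar S = bar S'"
    by (intro bar_eqI n[OF S] n[OF S'])
  then show ?thesis using small_fam_leK[OF N S' T] by (simp add: S'_def)
qed

definition small_bars :: "('v \<Rightarrow> 'v struc) \<Rightarrow> ('v \<Rightarrow> 'v set) \<Rightarrow> 'v set set" where
  "small_bars N W = {bar S |S. small_fam N S \<and> (\<forall>x \<in> X. S x \<subseteq> W x)}"

text \<open>The hulls are taken inside the model on \<open>W x\<close>, not inside
  \<open>N x\<close>, so that they stay below \<open>W x\<close>.\<close>

lemma ex_small_fam:
  assumes "mfam N" "\<And>x. x \<in> X \<Longrightarrow> strong K (N x) (W x)" "\<And>x. x \<in> X \<Longrightarrow> A x \<subseteq> W x" "\<And>x. x \<in> X \<Longrightarrow> A x \<lesssim> elts l"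
  shows "\<exists>S. small_fam N S \<and> (\<forall>x \<in> X. A x \<subseteq> S x \<and> S x \<subseteq> W x)"
proof -
  have "\<forall>x \<in> X. \<exists>B. strong K (N x) B \<and> B \<lesssim> elts l \<and> A x \<subseteq> B \<and> B \<subseteq> W x"
  proof
    fix x assume x: "x \<in> X"
    obtain B where B: "strong K (restr_struc L (N x) (W x)) B" "A x \<subseteq> B" "B \<lesssim> elts l"
      using small_strong[OF strong_models(2)[OF assms(2)[OF x]], of "A x"] assms(3,4)[OF x] by auto
    then show "\<exists>B. strong K (N x) B \<and> B \<lesssim> elts l \<and> A x \<subseteq> B \<and> B \<subseteq> W x"
      using strong_restr[OF assms(2)[OF x] B(1)] strong_subset[OF B(1)] by auto
  qed
  then obtain S where "\<And>x. x \<in> X \<Longrightarrow> strong K (N x) (S x) \<and> S x \<lesssim> elts l \<and> A x \<subseteq> S x \<and> S x \<subseteq> W x" by metis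
  then show ?thesis unfolding small_fam_def by blast
qed

text \<open>The class of \<open>f\<close> lies in \<open>bar S\<close> when each \<open>S x\<close>
  is a hull of the point \<open>f x\<close>.\<close>

lemma Union_small_bars:
  assumes N: "mfam N" and W: "\<And>x. x \<in> X \<Longrightarrow> strong K (N x) (W x)"
  shows "\<Union>(small_bars N W) = bar W"
proof (intro equalityI subsetI)
  fix y assume "y \<in> \<Union>(small_bars N W)"
  then show "y \<in> bar W" unfolding small_bars_def using bar_mono by blast
next
  fix y assume "y \<in> bar W"
  then obtain f where f: "f \<in> Pi\<^sub>E X W" "y = cls f" by blast
  have fin: "{f x} \<lesssim> elts l" for x using infinite_l finite_lepoll_infinite by blast
  obtain S where S: "small_fam N S" "\<forall>x \<in> X. {f x} \<subseteq> S x \<and> S x \<subseteq> W x"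
    using ex_small_fam[OF N W, of "\<lambda>x. {f x}"] fin PiE_mem[OF f(1)] by auto
  then have "f \<in> Pi\<^sub>E X S" using f(1) by (auto simp: PiE_iff)
  then show "y \<in> \<Union>(small_bars N W)" unfolding small_bars_def using S f(2) by blast
qed

text \<open>In each factor the union of fewer than \<mu> sets of size at most \<open>l\<close> has
  size at most \<open>l\<close>, so it has a hull of that size.\<close>

lemma small_bars_directed:
  assumes N: "mfam N" and W: "\<And>x. x \<in> X \<Longrightarrow> strong K (N x) (W x)"
    and C: "C \<subseteq> small_bars N W" "C \<prec> elts \<mu>"
  shows "\<exists>B \<in> small_bars N W. \<forall>c \<in> C. c \<subseteq> B"
proof -
  have "\<forall>c \<in> C. \<exists>S. c = bar S \<and> small_fam N S \<and> (\<forall>x \<in> X. S x \<subseteq> W x)"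
    using C(1) unfolding small_bars_def by blast
  then obtain S where S: "\<And>c. c \<in> C \<Longrightarrow> c = bar (S c) \<and> small_fam N (S c) \<and> (\<forall>x \<in> X. S c x \<subseteq> W x)"
    by metis
  have Cl: "C \<lesssim> elts l" using lesspoll_imp_lepoll[OF C(2)] \<mu>_lepoll_l lepoll_trans by blast
  have "(\<Union>c\<in>C. S c x) \<lesssim> elts l" if "x \<in> X" for x
    by (rule infinite_UN_lepoll[OF infinite_l Cl]) (use S that in \<open>auto simp: small_fam_def\<close>)
  then obtain T where T: "small_fam N T" "\<forall>x \<in> X. (\<Union>c\<in>C. S c x) \<subseteq> T x \<and> T x \<subseteq> W x"
    using ex_small_fam[OF N W, of "\<lambda>x. \<Union>c\<in>C. S c x"] S by blast
  have "c \<subseteq> bar T" if "c \<in> C" for c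
  proof -
    have "bar (S c) \<subseteq> bar T" by (rule bar_mono) (use T(2) that in blast)
    then show ?thesis using S[OF that] by simp
  qed
  moreover have "bar T \<in> small_bars N W" using T unfolding small_bars_def by blast
  ultimately show ?thesis by blast
qed

text \<open>\<open>bar W\<close> is the directed union of its small bars, whose relations
  \<open>leK\<close> are already known. The three parts are the three union axioms, applied in an
  ultraproduct whose membership in the class is not yet established.\<close>

lemma
  assumes N: "mfam N" and W: "\<And>x. x \<in> X \<Longrightarrow> strong K (N x) (W x)"
  shows ultraprod_bar_models: "restr_struc L (ultraprod L N) (bar W) \<in> models K"
    and small_bars_leK: "B \<in> small_bars N W \<Longrightarrow> 
      leK K (restr_struc L (ultraprod L N) B) (restr_struc L (ultraprod L N) (bar W))"
    and small_bars_Union_leK: "P \<in> models K \<Longrightarrow> 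
      (\<And>B. B \<in> small_bars N W \<Longrightarrow> leK K (restr_struc L (ultraprod L N) B) P) \<Longrightarrow> 
      leK K (restr_struc L (ultraprod L N) (bar W)) P"
proof -
  have le: "leK K (restr_struc L (ultraprod L N) B) (restr_struc L (ultraprod L N) C)"
    if "B \<in> small_bars N W" "C \<in> small_bars N W" "B \<subseteq> C" for B C
    using that small_fam_leK_bar[OF N] unfolding small_bars_def by blast
  have D: "small_bars N W \<subseteq> Pow (univ (ultraprod L N))"
  proof -
    have "bar S \<subseteq> univ (ultraprod L N)" if "\<forall>x \<in> X. S x \<subseteq> W x" for S
      unfolding univ_ultraprod by (rule bar_mono) (use that strong_subset[OF W] in blast)
    then show ?thesis unfolding small_bars_def by auto
  qed
  have mod: "restr_struc L (ultraprod L N) B \<in> models K" if "B \<in> small_bars N W" for B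
    using leK_models(1)[OF le[OF that that order_refl]] .
  have U: "\<Union>(small_bars N W) = bar W" by (rule Union_small_bars[OF N W])
  note TV = tarski_vaught_restr[OF is_struc_ultraprod[OF mfam_fam[OF N]] D, unfolded U]
  have dir: "\<exists>B \<in> small_bars N W. \<forall>c \<in> C. c \<subseteq> B" if "C \<subseteq> small_bars N W" "C \<prec> elts \<mu>" for C
    using small_bars_directed[OF N W] that by blast
  show "restr_struc L (ultraprod L N) (bar W) \<in> models K"
    by (rule TV(1)) (rule dir, assumption+, rule mod, assumption, rule le, assumption+)
  show "leK K (restr_struc L (ultraprod L N) B) (restr_struc L (ultraprod L N) (bar W))"
    if "B \<in> small_bars N W"
    by (rule TV(2)) (rule dir, assumption+, rule mod, assumption, rule le, assumption+, rule that)
  show "leK K (restr_struc L (ultraprod L N) (bar W)) P"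
    if "P \<in> models K" "\<And>B. B \<in> small_bars N W \<Longrightarrow> leK K (restr_struc L (ultraprod L N) B) P"
    by (rule TV(3)) (rule dir, assumption+, rule mod, assumption, rule le, assumption+, rule that(1), rule that(2))
qed

lemma ultraprod_models:
  assumes "mfam N" shows "ultraprod L N \<in> models K"
  using ultraprod_bar_models[OF assms strong_univ[OF mfamD[OF assms]]]
    restr_univ[OF is_struc_ultraprod[OF mfam_fam[OF assms]]] by simp

text \<open>Small bars inside \<open>W\<close> are also small bars of the whole family, hence
  submodels of the ultraproduct; the union axiom for upper bounds passes this on to
  \<open>bar W\<close>.\<close>

theorem strong_bar:
  assumes N: "mfam N" and W: "\<And>x. x \<in> X \<Longrightarrow> strong K (N x) (W x)"
  shows "strong K (ultraprod L N) (bar W)"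
proof -
  have Wu: "\<And>x. x \<in> X \<Longrightarrow> W x \<subseteq> univ (N x)" using strong_subset[OF W] .
  have "leK K (restr_struc L (ultraprod L N) (bar W)) (ultraprod L N)"
  proof (rule small_bars_Union_leK[OF N W ultraprod_models[OF N]])
    fix B assume "B \<in> small_bars N W"
    then have "B \<in> small_bars N (\<lambda>x. univ (N x))" using Wu unfolding small_bars_def by blast
    then show "leK K (restr_struc L (ultraprod L N) B) (ultraprod L N)"
      using small_bars_leK[OF N strong_univ[OF mfamD[OF N]]]
        restr_univ[OF is_struc_ultraprod[OF mfam_fam[OF N]]] by simp
  qed
  moreover have "bar W \<subseteq> univ (ultraprod L N)" using bar_mono Wu by simp
  ultimately show ?thesis by (simp add: strong_def)
qed

lemma ultramap_K_embedding:
  assumes P: "mfam P" and Q: "mfam Q" and g: "\<And>x. x \<in> X \<Longrightarrow> K_embedding K (g x) (P x) (Q x)"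
  shows "K_embedding K (ultramap P g) (ultraprod L P) (ultraprod L Q)"
proof -
  let ?W = "\<lambda>x. g x ` univ (P x)"
  have W: "strong K (Q x) (?W x)" and i: "struc_iso L (g x) (P x) (restr_struc L (Q x) (?W x))" if "x \<in> X" for x
    using g[OF that] by (auto simp: K_embedding_iff)
  have cW: "\<And>x. x \<in> X \<Longrightarrow> closed_in L (Q x) (?W x)" using strong_closed[OF W] .
  have "struc_iso L (ultramap P g) (ultraprod L P) (ultraprod L (\<lambda>x. restr_struc L (Q x) (?W x)))"
    by (rule ultramap_iso[OF mfam_fam[OF P] fam_restr[OF mfam_fam[OF Q] cW]]) (auto intro: ae_all' i)
  also have "ultraprod L (\<lambda>x. restr_struc L (Q x) (?W x)) = restr_struc L (ultraprod L Q) (bar ?W)"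
    by (rule ultraprod_restr[OF mfam_fam[OF Q] cW])
  finally show ?thesis
    using strong_bar[OF Q W] unfolding K_embedding_def strong_def by blast
qed

text \<open>For a large \<open>N\<close> the diagonal image need not be of the form
  \<open>bar S\<close>. It is the directed union of the images of small submodels, and on those
  \<open>diag\<close> is onto the ultrapower.\<close>

lemma diag_K_embedding:
  assumes N: "N \<in> models K" "univ N \<subseteq> V" shows "K_embedding K diag N (ultraprod L (\<lambda>_. N))"
proof -
  have f: "mfam (\<lambda>_. N)" using N by (simp add: mfam_def)
  let ?D = "{diag ` S |S. strong K N S \<and> S \<lesssim> elts l}"
  have "strong K (ultraprod L (\<lambda>_. N)) (\<Union>?D)"
  proof (rule strong_Union[OF ultraprod_models[OF f]])
    fix B assume "B \<in> ?D"
    then obtain S where S: "strong K N S" "S \<lesssim> elts l" "B = diag ` S" by blast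
    have "diag ` S = bar (\<lambda>_. S)"
      using strong_subset[OF S(1)] N(2) lepoll_trans[OF S(2) l_lepoll_\<theta>] by (intro diag_image_small) auto
    then show "strong K (ultraprod L (\<lambda>_. N)) B"
      using strong_bar[OF f, of "\<lambda>_. S"] S by simp
  next
    fix C assume C: "C \<subseteq> ?D" "C \<prec> elts \<mu>"
    then have "\<forall>c \<in> C. \<exists>S. c = diag ` S \<and> strong K N S \<and> S \<lesssim> elts l" by blast
    then obtain S where S: "\<And>c. c \<in> C \<Longrightarrow> c = diag ` S c \<and> strong K N (S c) \<and> S c \<lesssim> elts l" by metis
    have Cl: "C \<lesssim> elts l" using lesspoll_imp_lepoll[OF C(2)] \<mu>_lepoll_l lepoll_trans by blast
    have "(\<Union>c\<in>C. S c) \<lesssim> elts l" by (rule infinite_UN_lepoll[OF infinite_l Cl]) (use S in blast)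
    moreover have "(\<Union>c\<in>C. S c) \<subseteq> univ N" using S strong_subset by blast
    ultimately obtain B where B: "strong K N B" "(\<Union>c\<in>C. S c) \<subseteq> B" "B \<lesssim> elts l"
      using small_strong[OF N(1)] by blast
    have "c \<subseteq> diag ` B" if "c \<in> C" for c using S[OF that] B(2) that by blast
    then show "\<exists>B \<in> ?D. \<forall>c \<in> C. c \<subseteq> B" using B by blast
  qed
  also have "\<Union>?D = diag ` univ N"
  proof (intro equalityI subsetI)
    fix y assume "y \<in> diag ` univ N"
    then obtain m where m: "m \<in> univ N" "y = diag m" by blast
    have "{m} \<lesssim> elts l" using infinite_l finite_lepoll_infinite by blast
    then obtain B where "strong K N B" "{m} \<subseteq> B" "B \<lesssim> elts l" using small_strong[OF N(1), of "{m}"] m(1) by blast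
    then show "y \<in> \<Union>?D" using m(2) by blast
  qed (use strong_subset in blast)
  finally show ?thesis
    using diag_iso[OF models_struc[OF N(1)] N(2)] by (simp add: K_embedding_iff)
qed

end

section \<open>Tameness from almost strongly compact cardinals\<close>

lemma E_at_tranclp_sym: "(E_at K J)\<^sup>+\<^sup>+ s t \<Longrightarrow> (E_at K J)\<^sup>+\<^sup>+ t s"
proof (induction rule: tranclp_induct)
  case (step t u)
  from E_at_sym[OF step.hyps(2)] step.IH show ?case by (rule tranclp_into_tranclp2)
qed (rule tranclp.r_into_trancl, rule E_at_sym)

lemma gtp_eqI: 
  assumes "(E_at K J)\<^sup>+\<^sup>+ (a, A, N) (b, A, N')" shows "gtp K J a A N = gtp K J b A N'"
proof -
  have "(E_at K J)\<^sup>+\<^sup>+ (a, A, N) t \<longleftrightarrow> (E_at K J)\<^sup>+\<^sup>+ (b, A, N') t" for t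
    using tranclp_trans[OF assms] tranclp_trans[OF E_at_tranclp_sym[OF assms]] by blast
  then show ?thesis by (simp add: gtp_def)
qed

context mu_class
begin

lemma E_at_refl:
  assumes "N \<in> models K" "A \<subseteq> univ N" "a \<in> J \<rightarrow>\<^sub>E univ N" shows "E_at K J (a, A, N) (a, A, N)"
  using assms K_embedding_incl[OF leK_refl] unfolding E_at_def by fast

lemma gtp_eqD:
  assumes "gtp K J a A N = gtp K J b A N'" "N' \<in> models K" "A \<subseteq> univ N'" "b \<in> J \<rightarrow>\<^sub>E univ N'"
  shows "(E_at K J)\<^sup>+\<^sup>+ (a, A, N) (b, A, N')"
proof -
  have "(b, A, N') \<in> gtp K J b A N'" 
    unfolding gtp_def using E_at_refl[OF assms(2-4)] by blast
  then have "(b, A, N') \<in> gtp K J a A N" using assms(1) by simp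
  then show ?thesis by (simp add: gtp_def)
qed

text \<open>
  A link is a step of \<open>E_at\<close> for structures into which the parameters and the sequence are mapped by
  a labelling; the parameters need not be elements of the structures themselves.
\<close>

definition elink :: "'l set \<Rightarrow> ('l \<Rightarrow> 'v) \<times> 'v struc \<Rightarrow> ('l \<Rightarrow> 'v) \<times> 'v struc \<Rightarrow> bool" where
  "elink Z = (\<lambda>(l, N) (l', N'). l ` Z \<subseteq> univ N \<and> l' ` Z \<subseteq> univ N' \<and>
     (\<exists>Q f f'. K_embedding K f N Q \<and> K_embedding K f' N' Q \<and> (\<forall>z \<in> Z. f (l z) = f' (l' z))))"

text \<open>Elements outside the image of \<open>m\<close> are sent to a copy disjoint from
  \<open>A\<close>; leaving them in place could break injectivity.\<close>

lemma rename_along: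
  assumes "small A" "small Y" "inj_on m A" "m ` A \<subseteq> Y"
  shows "\<exists>\<rho> :: 'v \<Rightarrow> 'v. inj_on \<rho> Y \<and> (\<forall>b \<in> A. \<rho> (m b) = b)"
proof -
  obtain c :: "'v \<Rightarrow> 'v" where c: "inj_on c Y" "c ` Y \<inter> A = {}" "small (c ` Y)"
    by (rule fresh_copy[OF assms(1) setlike_small[THEN iffD2, OF assms(2)]])
  define \<rho> where "\<rho> y = (if y \<in> m ` A then inv_into A m y else c y)" for y
  have m: "\<rho> (m b) = b" if "b \<in> A" for b using that assms(3) by (simp add: \<rho>_def)
  have "inj_on \<rho> Y"
  proof (rule inj_onI)
    fix x y assume xy: "x \<in> Y" "y \<in> Y" "\<rho> x = \<rho> y"
    show "x = y"
    proof (cases "x \<in> m ` A"; cases "y \<in> m ` A")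
      assume "x \<in> m ` A" "y \<in> m ` A" then show ?thesis using xy(3) m by auto
    next
      assume "x \<in> m ` A" "y \<notin> m ` A" then show ?thesis using xy m c(2) by (auto simp: \<rho>_def)
    next
      assume "x \<notin> m ` A" "y \<in> m ` A" then show ?thesis using xy m c(2) by (auto simp: \<rho>_def)
    next
      assume "x \<notin> m ` A" "y \<notin> m ` A" then show ?thesis using xy c(1) by (auto simp: \<rho>_def dest: inj_onD)
    qed
  qed
  with m show ?thesis by blast
qed

lemma rename_struc:
  assumes "is_struc L N" "small A" "inj_on m A" "m ` A \<subseteq> univ N"
  obtains \<rho> N' where "struc_iso L \<rho> N N'" "\<And>b. b \<in> A \<Longrightarrow> \<rho> (m b) = b"
proof -
  obtain \<rho> where \<rho>: "inj_on \<rho> (univ N)" "\<forall>b \<in> A. \<rho> (m b) = b"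
    using rename_along[OF assms(2) _ assms(3,4)] assms(1) by (auto simp: is_struc_def)
  obtain N' where "struc_iso L \<rho> N N'" using ex_struc_iso[OF assms(1) \<rho>(1)] by blast
  with \<rho>(2) that show ?thesis by blast
qed

text \<open>\<open>N'\<close> and the common extension \<open>Q\<close> are renamed so that every
  parameter becomes itself, and the embeddings are conjugated accordingly. The renaming of
  \<open>N\<close> is given in advance, so consecutive links can be chained. Injectivity of the
  labelling of \<open>A\<close> in \<open>N'\<close> is inherited through \<open>Q\<close>.\<close>

lemma elink_realize:
  assumes link: "elink (J <+> A) (l, N) (l', N')" and A: "small A"
    and \<rho>: "struc_iso L \<rho> N R" "\<And>b. b \<in> A \<Longrightarrow> \<rho> (l (Inr b)) = b"
  shows "\<exists>\<rho>' R'. struc_iso L \<rho>' N' R' \<and> (\<forall>b \<in> A. \<rho>' (l' (Inr b)) = b) \<and>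
    E_at K J (\<lambda>j\<in>J. \<rho> (l (Inl j)), A, R) (\<lambda>j\<in>J. \<rho>' (l' (Inl j)), A, R')"
proof -
  obtain Q f f' where l: "l ` (J <+> A) \<subseteq> univ N" "l' ` (J <+> A) \<subseteq> univ N'" 
    and f: "K_embedding K f N Q" and f': "K_embedding K f' N' Q" 
    and ff': "\<And>z. z \<in> J <+> A \<Longrightarrow> f (l z) = f' (l' z)"
    using link unfolding elink_def by auto
  have lJ: "l (Inl j) \<in> univ N \<and> l' (Inl j) \<in> univ N'" if "j \<in> J" for j
    using l InlI[OF that] by blast
  have lA: "l (Inr b) \<in> univ N \<and> l' (Inr b) \<in> univ N'" if "b \<in> A" for b
    using l InrI[OF that] by blast
  have inj: "inj_on (\<lambda>b. l (Inr b)) A" by (rule inj_on_inverseI[of A \<rho>]) (rule \<rho>(2))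
  have injf: "inj_on (\<lambda>b. f (l (Inr b))) A"
    using inj K_embedding_inj_on[OF f] lA unfolding inj_on_def by metis
  have "inj_on (\<lambda>b. f' (l' (Inr b))) A"
    using injf ff' unfolding inj_on_def by (metis InrI)
  then have inj': "inj_on (\<lambda>b. l' (Inr b)) A" unfolding inj_on_def by metis
  obtain \<rho>' R' where \<rho>': "struc_iso L \<rho>' N' R'" "\<And>b. b \<in> A \<Longrightarrow> \<rho>' (l' (Inr b)) = b"
    by (rule rename_struc[OF models_struc[OF K_embedding_models(1)[OF f']] A inj'])
      (use lA that in auto)
  obtain \<tau> T where \<tau>: "struc_iso L \<tau> Q T" "\<And>b. b \<in> A \<Longrightarrow> \<tau> (f (l (Inr b))) = b"
    by (rule rename_struc[OF models_struc[OF K_embedding_models(2)[OF f]] A injf])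
      (use lA K_embedding_image[OF f] that in auto)
  have QM: "Q \<in> models K" and NM: "N \<in> models K" "N' \<in> models K" 
    using K_embedding_models f f' by blast+
  have RM: "R \<in> models K" "R' \<in> models K" using models_iso NM \<rho>(1) \<rho>'(1) by blast+
  have tau: "K_embedding K \<tau> Q T" by (rule K_embedding_iso[OF QM \<tau>(1)])
  let ?r = "inv_into (univ N) \<rho>" and ?r' = "inv_into (univ N') \<rho>'"
  have r: "K_embedding K (\<tau> \<circ> (f \<circ> ?r)) R T"
    using K_embedding_comp[OF K_embedding_comp[OF K_embedding_iso[OF RM(1) struc_iso_inv[OF \<rho>(1)]] f] tau] by (simp add: comp_assoc)
  have r': "K_embedding K (\<tau> \<circ> (f' \<circ> ?r')) R' T"
    using K_embedding_comp[OF K_embedding_comp[OF K_embedding_iso[OF RM(2) struc_iso_inv[OF \<rho>'(1)]] f'] tau] by (simp add: comp_assoc)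
  have inv: "\<And>u. u \<in> univ N \<Longrightarrow> ?r (\<rho> u) = u" "\<And>u. u \<in> univ N' \<Longrightarrow> ?r' (\<rho>' u) = u"
    using struc_isoD(3) \<rho>(1) \<rho>'(1) by (metis inv_into_f_f)+
  have im: "\<rho> ` univ N = univ R" "\<rho>' ` univ N' = univ R'" using struc_isoD(4) \<rho>(1) \<rho>'(1) by blast+
  have fixA: "(\<tau> \<circ> (f \<circ> ?r)) b = b \<and> (\<tau> \<circ> (f' \<circ> ?r')) b = b" if b: "b \<in> A" for b
  proof -
    have "?r b = l (Inr b)" "?r' b = l' (Inr b)" using inv lA[OF b] \<rho>(2)[OF b] \<rho>'(2)[OF b] by metis+
    then show ?thesis using \<tau>(2)[OF b] ff'[OF InrI[OF b]] by simp
  qed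
  have AR: "A \<subseteq> univ R \<inter> univ R'" 
  proof
    fix b assume "b \<in> A" then show "b \<in> univ R \<inter> univ R'" using lA \<rho>(2) \<rho>'(2) im by (metis IntI imageI)
  qed
  have "E_at K J (\<lambda>j\<in>J. \<rho> (l (Inl j)), A, R) (\<lambda>j\<in>J. \<rho>' (l' (Inl j)), A, R')"
    unfolding E_at_def prod.case
  proof (intro conjI RM AR bexI exI r r' refl)
    show "(\<lambda>j\<in>J. \<rho> (l (Inl j))) \<in> J \<rightarrow>\<^sub>E univ R" "(\<lambda>j\<in>J. \<rho>' (l' (Inl j))) \<in> J \<rightarrow>\<^sub>E univ R'"
      using lJ im by auto
    show "\<forall>x\<in>A. (\<tau> \<circ> (f \<circ> ?r)) x = x \<and> (\<tau> \<circ> (f' \<circ> ?r')) x = x" using fixA by blast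
    show "\<forall>j\<in>J. (\<tau> \<circ> (f \<circ> ?r)) ((\<lambda>j\<in>J. \<rho> (l (Inl j))) j) = (\<tau> \<circ> (f' \<circ> ?r')) ((\<lambda>j\<in>J. \<rho>' (l' (Inl j))) j)"
      using inv lJ ff'[OF InlI] by auto
    show "T \<in> models K" using K_embedding_models(2)[OF tau] .
  qed (rule r, rule r')
  with \<rho>' show ?thesis by blast
qed

text \<open>The renamings along the chain end at a copy of \<open>N'\<close> in which the parameters
  are again fixed; that copy is joined to \<open>N'\<close> itself by one further step.\<close>

lemma elink_chain_realize:
  assumes "(elink (J <+> A))\<^sup>+\<^sup>+ (case_sum a (\<lambda>b. b), N) (case_sum a' (\<lambda>b. b), N')" and A: "small A"
    and a: "a \<in> J \<rightarrow>\<^sub>E univ N" and a': "a' \<in> J \<rightarrow>\<^sub>E univ N'" and N: "N \<in> models K"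
  shows "(E_at K J)\<^sup>+\<^sup>+ (a, A, N) (a', A, N')"
proof -
  have ax: "(\<lambda>j\<in>J. a j) = a" "(\<lambda>j\<in>J. a' j) = a'" using a a' by (simp_all add: PiE_restrict)
  have real: "\<exists>\<rho> R. struc_iso L \<rho> M R \<and> (\<forall>b \<in> A. \<rho> (l (Inr b)) = b) \<and>
      (E_at K J)\<^sup>+\<^sup>+ (a, A, N) (\<lambda>j\<in>J. \<rho> (l (Inl j)), A, R)"
    if "(elink (J <+> A))\<^sup>+\<^sup>+ (case_sum a (\<lambda>b. b), N) (l, M)" for l M
    using that
  proof (induction rule: tranclp_induct2)
    case (base l M)
    obtain \<rho> R where \<rho>: "struc_iso L \<rho> M R" "\<forall>b \<in> A. \<rho> (l (Inr b)) = b"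
      and e: "E_at K J (\<lambda>j\<in>J. (\<lambda>x. x) (case_sum a (\<lambda>b. b) (Inl j)), A, N) (\<lambda>j\<in>J. \<rho> (l (Inl j)), A, R)"
      using elink_realize[OF base A struc_iso_refl[OF models_struc[OF N]]] by auto
    from e have "(E_at K J)\<^sup>+\<^sup>+ (a, A, N) (\<lambda>j\<in>J. \<rho> (l (Inl j)), A, R)"
      unfolding sum.case ax(1) by (rule tranclp.r_into_trancl)
    with \<rho> show ?case by blast
  next
    case (step l M l' M')
    then obtain \<rho> R where \<rho>: "struc_iso L \<rho> M R" "\<And>b. b \<in> A \<Longrightarrow> \<rho> (l (Inr b)) = b"
      and e: "(E_at K J)\<^sup>+\<^sup>+ (a, A, N) (\<lambda>j\<in>J. \<rho> (l (Inl j)), A, R)" by blast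
    obtain \<rho>' R' where "struc_iso L \<rho>' M' R'" "\<forall>b \<in> A. \<rho>' (l' (Inr b)) = b"
      "E_at K J (\<lambda>j\<in>J. \<rho> (l (Inl j)), A, R) (\<lambda>j\<in>J. \<rho>' (l' (Inl j)), A, R')"
      using elink_realize[OF step.hyps(2) A \<rho>] by blast
    with tranclp.trancl_into_trancl[OF e] show ?case by blast
  qed
  obtain \<rho> R where \<rho>: "struc_iso L \<rho> N' R" "\<And>b. b \<in> A \<Longrightarrow> \<rho> b = b"
    and e: "(E_at K J)\<^sup>+\<^sup>+ (a, A, N) (\<lambda>j\<in>J. \<rho> (a' j), A, R)"
    using real[OF assms(1)] by auto
  have "\<exists>s. elink (J <+> A) s (case_sum a' (\<lambda>b. b), N')" 
    using assms(1) by (rule tranclp.cases) blast+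
  then have AN: "case_sum a' (\<lambda>b. b) ` (J <+> A) \<subseteq> univ N'" and NM: "N' \<in> models K"
    unfolding elink_def using K_embedding_models(1) by auto
  have AN: "A \<subseteq> univ N'"
  proof
    fix b assume "b \<in> A" then show "b \<in> univ N'" using AN InrI[of b A J] by (metis image_subset_iff sum.case(2))
  qed
  have RM: "R \<in> models K" using models_iso[OF NM \<rho>(1)] .
  have "E_at K J (\<lambda>j\<in>J. \<rho> (a' j), A, R) (a', A, N')"
    unfolding E_at_def prod.case
  proof (intro conjI RM NM a' bexI[OF _ RM] exI refl)
    show "K_embedding K (\<lambda>x. x) R R" by (rule K_embedding_incl[OF leK_refl[OF RM]])
    show "K_embedding K \<rho> N' R" by (rule K_embedding_iso[OF NM \<rho>(1)])
    have im: "\<rho> ` univ N' = univ R" using struc_isoD(4)[OF \<rho>(1)] .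
    then show "(\<lambda>j\<in>J. \<rho> (a' j)) \<in> J \<rightarrow>\<^sub>E univ R" using a' by (auto simp: PiE_iff)
    show "A \<subseteq> univ R \<inter> univ N'"
    proof
      fix b assume "b \<in> A" then show "b \<in> univ R \<inter> univ N'" using AN im \<rho>(2)[of b] by (metis IntI imageI subsetD)
    qed
  qed (use \<rho>(2) in auto)
  with e show ?thesis by (rule tranclp.trancl_into_trancl)
qed

text \<open>The i-th links at all \<open>x\<close> are combined into one link between ultraproducts.
  \<open>D x z\<close> says that the label \<open>z\<close> is available at \<open>x\<close>, which
  holds almost everywhere for each \<open>z\<close>. At both ends the family is constant, and
  diagonal maps join \<open>N1\<close> and \<open>N2\<close> to their ultrapowers.\<close>

lemma mu_ultra_chain:
  assumes mu: "mu_ultra \<mu> K Y U \<theta> V l" and n: "0 < (n :: nat)"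
    and N: "\<And>x i. x \<in> Y \<Longrightarrow> i \<le> n \<Longrightarrow> univ (N x i) \<subseteq> V" "\<And>x. N x 0 = N1" "\<And>x. N x n = N2"
    and Q: "\<And>x i. x \<in> Y \<Longrightarrow> i < n \<Longrightarrow> univ (Q x i) \<subseteq> V"
    and f: "\<And>x i. x \<in> Y \<Longrightarrow> i < n \<Longrightarrow> K_embedding K (f x i) (N x i) (Q x i)"
    and f': "\<And>x i. x \<in> Y \<Longrightarrow> i < n \<Longrightarrow> K_embedding K (f' x i) (N x (Suc i)) (Q x i)"
    and lab: "\<And>z. z \<in> Z \<Longrightarrow> ultra.ae Y U (\<lambda>x. D x z)"
    and l: "\<And>x i z. x \<in> Y \<Longrightarrow> i \<le> n \<Longrightarrow> z \<in> Z \<Longrightarrow> D x z \<Longrightarrow> lb x i z \<in> univ (N x i)"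
    and eq: "\<And>x i z. x \<in> Y \<Longrightarrow> i < n \<Longrightarrow> z \<in> Z \<Longrightarrow> D x z \<Longrightarrow> f x i (lb x i z) = f' x i (lb x (Suc i) z)"
    and l0: "\<And>x z. x \<in> Y \<Longrightarrow> z \<in> Z \<Longrightarrow> D x z \<Longrightarrow> lb x 0 z = l1 z" "l1 ` Z \<subseteq> univ N1"
    and ln: "\<And>x z. x \<in> Y \<Longrightarrow> z \<in> Z \<Longrightarrow> D x z \<Longrightarrow> lb x n z = l2 z" "l2 ` Z \<subseteq> univ N2"
  shows "(elink Z)\<^sup>+\<^sup>+ (l1, N1) (l2, N2)"
proof -
  interpret mu_ultra \<mu> K Y U \<theta> V l by (rule mu)
  have NM: "N x i \<in> models K" if "x \<in> Y" "i \<le> n" for x i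
  proof (cases "i = n")
    case True
    then obtain j where "n = Suc j" using n gr0_implies_Suc by blast
    then show ?thesis using True K_embedding_models(1)[OF f'[OF that(1), of j]] by simp
  next
    case False then show ?thesis using that K_embedding_models(1)[OF f[OF that(1), of i]] by simp
  qed
  have mN: "mfam (\<lambda>x. N x i)" if "i \<le> n" for i using that NM N(1) by (simp add: mfam_def)
  have mQ: "mfam (\<lambda>x. Q x i)" if "i < n" for i
    using that K_embedding_models(2)[OF f[OF _ that]] Q by (simp add: mfam_def)
  have "\<exists>x. x \<in> Y" using ae_ex[OF ae_all'[of "\<lambda>_. True"]] by blast
  then obtain x\<^sub>0 where "x\<^sub>0 \<in> Y" ..
  then have N12: "N1 \<in> models K" "N2 \<in> models K" "univ N1 \<subseteq> V" "univ N2 \<subseteq> V"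
    using NM[of x\<^sub>0 0] NM[of x\<^sub>0 n] N(1)[of x\<^sub>0 0] N(1)[of x\<^sub>0 n] by (simp_all add: N(2,3))
  have "\<forall>x i. \<exists>u. x \<in> Y \<and> i \<le> n \<longrightarrow> u \<in> univ (N x i)"
    using famD(3)[OF mfam_fam[OF mN]] by blast
  then obtain d where d: "\<And>x i. x \<in> Y \<Longrightarrow> i \<le> n \<Longrightarrow> d x i \<in> univ (N x i)" by metis
  \<comment> \<open>Where a label is missing, an arbitrary element \<open>d x i\<close> is used; for
    each label this happens on a null set.\<close>
  define h where "h i z = (\<lambda>x\<in>Y. if D x z then lb x i z else d x i)" for i z
  define lu where "lu i z = cls (h i z)" for i z
  have h: "h i z \<in> (\<Pi>\<^sub>E x\<in>Y. univ (N x i))" if "i \<le> n" "z \<in> Z" for i z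
    using that l d by (auto simp: h_def)
  let ?N = "\<lambda>i. ultraprod L (\<lambda>x. N x i)"
  have lu: "lu i ` Z \<subseteq> univ (?N i)" if "i \<le> n" for i using h[OF that] by (auto simp: lu_def)
  have step: "elink Z (lu i, ?N i) (lu (Suc i), ?N (Suc i))" if i: "i < n" for i
    unfolding elink_def prod.case
  proof (intro conjI exI ballI)
    have le: "i \<le> n" "Suc i \<le> n" using i by auto
    show "lu i ` Z \<subseteq> univ (?N i)" "lu (Suc i) ` Z \<subseteq> univ (?N (Suc i))" using lu le by blast+
    let ?F = "ultramap (\<lambda>x. N x i) (\<lambda>x. f x i)" and ?F' = "ultramap (\<lambda>x. N x (Suc i)) (\<lambda>x. f' x i)"
    show "K_embedding K ?F (?N i) (ultraprod L (\<lambda>x. Q x i))"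
      by (rule ultramap_K_embedding[OF mN[OF le(1)] mQ[OF i] f[OF _ i]])
    show "K_embedding K ?F' (?N (Suc i)) (ultraprod L (\<lambda>x. Q x i))"
      by (rule ultramap_K_embedding[OF mN[OF le(2)] mQ[OF i] f'[OF _ i]])
    fix z assume z: "z \<in> Z"
    have g: "f x i u \<in> univ (Q x i)" if "x \<in> Y" "u \<in> univ (N x i)" for x u
      using K_embedding_image[OF f[OF that(1) i]] that(2) by blast
    have g': "f' x i u \<in> univ (Q x i)" if "x \<in> Y" "u \<in> univ (N x (Suc i))" for x u
      using K_embedding_image[OF f'[OF that(1) i]] that(2) by blast
    note F = ultramap_cls[OF mfam_fam[OF mN[OF le(1)]] mfam_fam[OF mQ[OF i]], of "\<lambda>x. f x i", OF g h[OF le(1) z]]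
    note F' = ultramap_cls[OF mfam_fam[OF mN[OF le(2)]] mfam_fam[OF mQ[OF i]], of "\<lambda>x. f' x i", OF g' h[OF le(2) z]]
    have k: "(\<lambda>x\<in>Y. f x i (h i z x)) \<in> (\<Pi>\<^sub>E x\<in>Y. univ (Q x i))" by (rule F(2))
    have k': "(\<lambda>x\<in>Y. f' x i (h (Suc i) z x)) \<in> (\<Pi>\<^sub>E x\<in>Y. univ (Q x i))" by (rule F'(2))
    have "?F (lu i z) = cls (\<lambda>x\<in>Y. f x i (h i z x))"
      unfolding lu_def by (rule F(1))
    also have "\<dots> = cls (\<lambda>x\<in>Y. f' x i (h (Suc i) z x))"
      unfolding fam_cls_eq_iff[OF mfam_fam[OF mQ[OF i]] k k']
      by (rule ae_mono[OF lab[OF z]]) (simp add: h_def eq i z)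
    also have "\<dots> = ?F' (lu (Suc i) z)" 
      unfolding lu_def by (rule F'(1)[symmetric])
    finally show "?F (lu i z) = ?F' (lu (Suc i) z)" .
  qed
  have chain: "(elink Z)\<^sup>*\<^sup>* (lu 0, ?N 0) (lu i, ?N i)" if "i \<le> n" for i
    using that
  proof (induction i)
    case (Suc i)
    then have "(elink Z)\<^sup>*\<^sup>* (lu 0, ?N 0) (lu i, ?N i)" by simp
    then show ?case by (rule rtranclp.rtrancl_into_rtrancl) (rule step, use Suc.prems in simp)
  qed simp
  have ends: "elink Z (l', N') (lu i, ?N i)" and ends': "elink Z (lu i, ?N i) (l', N')"
    if i: "i \<le> n" and N': "N' \<in> models K" "univ N' \<subseteq> V" "\<And>x. N x i = N'" and 
      l': "\<And>x z. x \<in> Y \<Longrightarrow> z \<in> Z \<Longrightarrow> D x z \<Longrightarrow> lb x i z = l' z" "l' ` Z \<subseteq> univ N'" for i l' N'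
  proof -
    have eqd: "diag (l' z) = lu i z" if z: "z \<in> Z" for z
    proof -
      have c: "(\<lambda>x\<in>Y. l' z) \<in> (\<Pi>\<^sub>E x\<in>Y. univ (N x i))" using l'(2) z N'(3) by auto
      show ?thesis
        unfolding diag_def lu_def fam_cls_eq_iff[OF mfam_fam[OF mN[OF i]] c h[OF i z]]
        by (rule ae_mono[OF lab[OF z]]) (simp add: h_def l'(1) z)
    qed
    have dK: "K_embedding K diag N' (?N i)"
      using diag_K_embedding[OF N'(1,2)] by (simp add: N'(3))
    have iK: "K_embedding K (\<lambda>x. x) (?N i) (?N i)"
      by (rule K_embedding_incl[OF leK_refl[OF ultraprod_models[OF mN[OF i]]]])
    show "elink Z (l', N') (lu i, ?N i)"
      unfolding elink_def prod.case
    proof (intro conjI exI l'(2) lu[OF i])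
      show "K_embedding K diag N' (?N i)" "K_embedding K (\<lambda>x. x) (?N i) (?N i)" by (rule dK, rule iK)
    qed (simp add: eqd)
    show "elink Z (lu i, ?N i) (l', N')"
      unfolding elink_def prod.case
    proof (intro conjI exI l'(2) lu[OF i])
      show "K_embedding K (\<lambda>x. x) (?N i) (?N i)" "K_embedding K diag N' (?N i)" by (rule iK, rule dK)
    qed (simp add: eqd)
  qed
  have first: "elink Z (l1, N1) (lu 0, ?N 0)"
    by (rule ends) (use N12 N l0 in auto)
  have "elink Z (lu n, ?N n) (l2, N2)"
    by (rule ends') (use N12 N ln in auto)
  with chain[OF order_refl] have "(elink Z)\<^sup>+\<^sup>+ (lu 0, ?N 0) (l2, N2)" by (rule rtranclp_into_tranclp1)
  with first show ?thesis by (rule tranclp_into_tranclp2)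
qed

end

section \<open>Fine ultrafilters from almost strong compactness\<close>

lemma almost_strongly_compact_above:
  assumes "\<not> small {\<kappa> :: 'v::zfc_universe. almost_strongly_compact \<kappa>}" "Card \<nu>"
  obtains \<kappa> :: "'v::zfc_universe" where "almost_strongly_compact \<kappa>" "\<nu> \<in> elts \<kappa>"
proof -
  have Ord: "Ord \<kappa>" if "almost_strongly_compact \<kappa>" for \<kappa> :: 'v
    using that by (simp add: almost_strongly_compact_def limit_card_def Card_def)
  have "\<not> {\<kappa> :: 'v. almost_strongly_compact \<kappa>} \<subseteq> insert \<nu> (elts \<nu>)"
    using assms(1) small_subset small_insert[OF small_elts] by blast
  then obtain \<kappa> :: 'v where "almost_strongly_compact \<kappa>" "\<kappa> \<notin> elts \<nu>" "\<kappa> \<noteq> \<nu>" by blast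
  then show ?thesis using that Ord_linear[OF Ord Card_Ord[OF assms(2)]] by blast
qed

lemma complete_family_mono:
  assumes "complete_family \<kappa> F" "elts \<nu> \<lesssim> elts \<kappa>" shows "complete_family \<nu> F"
  using assms lesspoll_trans2 unfolding complete_family_def by blast

text \<open>
  The filter generated by the cones of the \<open>\<kappa>\<close>-sized subsets of \<open>W\<close>: since the sets have size at most,
  and not less than, \<open>\<kappa>\<close>, no regularity of \<open>\<kappa>\<close> is needed.
\<close>

lemma ex_fine_ultrafilter:
  fixes \<kappa> \<nu> \<theta> :: "'v::zfc_universe"
  assumes asc: "almost_strongly_compact \<kappa>" and \<nu>: "\<nu> \<in> elts \<kappa>" "Card \<nu>" and \<theta>: "elts \<theta> \<prec> elts \<nu>" "infinite (elts \<theta>)"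
    and W: "small W"
  obtains X U where "ultra X U \<theta>" "\<And>x. x \<in> X \<Longrightarrow> elts x \<subseteq> W \<and> elts x \<lesssim> elts \<kappa>" 
    "\<And>w. w \<in> W \<Longrightarrow> ultra.ae X U (\<lambda>x. w \<in> elts x)"
proof -
  have inf: "infinite (elts \<kappa>)" using asc by (simp add: almost_strongly_compact_def limit_card_def)
  define X where "X = vset ` {C. C \<subseteq> W \<and> C \<lesssim> elts \<kappa>}"
  have sC: "small C" if "C \<subseteq> W" for C using W that by (rule small_subset)
  have X: "x \<in> X \<longleftrightarrow> elts x \<subseteq> W \<and> elts x \<lesssim> elts \<kappa>" for x
  proof
    show "x \<in> X \<Longrightarrow> elts x \<subseteq> W \<and> elts x \<lesssim> elts \<kappa>" unfolding X_def using sC by (auto simp: elts_vset)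
    show "elts x \<subseteq> W \<and> elts x \<lesssim> elts \<kappa> \<Longrightarrow> x \<in> X" unfolding X_def by (metis (mono_tags, lifting) imageI mem_Collect_eq vset_elts)
  qed
  have vX: "vset C \<in> X" "elts (vset C) = C" if "C \<subseteq> W" "C \<lesssim> elts \<kappa>" for C
    using that sC X by (auto simp: elts_vset)
  have sX: "small X"
  proof -
    have "setlike TYPE('v) X" unfolding X_def
      by (rule setlike_image[OF setlike_subset[OF setlike_Pow[OF setlike_small[THEN iffD2, OF W]]]]) blast
    then show ?thesis by (simp add: setlike_small)
  qed
  define cone where "cone c = {x \<in> X. elts c \<subseteq> elts x}" for c
  define F where "F = {Y. Y \<subseteq> X \<and> (\<exists>c \<in> X. cone c \<subseteq> Y)}"
  have F: "complete_family \<kappa> F"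
    unfolding complete_family_def
  proof (intro allI impI, elim conjE)
    fix S assume S: "S \<subseteq> F" "S \<noteq> {}" "S \<prec> elts \<kappa>"
    have "\<forall>Y \<in> S. \<exists>c \<in> X. cone c \<subseteq> Y" using S(1) unfolding F_def by blast
    then obtain c where c: "\<And>Y. Y \<in> S \<Longrightarrow> c Y \<in> X \<and> cone (c Y) \<subseteq> Y" by metis
    let ?C = "\<Union>Y\<in>S. elts (c Y)"
    have "?C \<lesssim> elts \<kappa>"
      by (rule infinite_UN_lepoll[OF inf lesspoll_imp_lepoll[OF S(3)]]) (use c X in blast)
    moreover have "?C \<subseteq> W" using c X by blast
    ultimately have v: "vset ?C \<in> X" "elts (vset ?C) = ?C" using vX by blast+
    have "cone (vset ?C) \<subseteq> \<Inter>S" unfolding cone_def v(2) using c unfolding cone_def by blast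
    moreover have "\<Inter>S \<subseteq> X" using S(1,2) unfolding F_def by blast
    ultimately show "\<Inter>S \<in> F" unfolding F_def using v(1) by blast
  qed
  have "filter_on_set X F"
    unfolding filter_on_set_def
  proof (intro conjI ballI allI impI)
    show "F \<subseteq> Pow X" unfolding F_def by blast
    have "vset {} \<in> X" by (rule vX) auto
    then show "X \<in> F" unfolding F_def cone_def by blast
    show "{} \<notin> F" unfolding F_def cone_def by blast
    show "A \<inter> B \<in> F" if "A \<in> F" "B \<in> F" for A B
    proof -
      have "{A, B} \<prec> elts \<kappa>" by (rule finite_lesspoll_infinite[OF inf]) simp
      then have "\<Inter>{A, B} \<in> F" using F[unfolded complete_family_def, rule_format, of "{A, B}"] that by simp
      then show ?thesis by simp
    qed
  qed (auto simp: F_def)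
  then obtain U where U: "F \<subseteq> U" "ultrafilter_on_set X U" "complete_family \<nu> U"
    using asc \<nu> sX F unfolding almost_strongly_compact_def by blast
  have u: "ultra X U \<theta>"
  proof
    show "\<Inter>S \<in> U" if "S \<subseteq> U" "S \<noteq> {}" "S \<lesssim> elts \<theta>" for S
      using U(3) that lesspoll_trans1[OF that(3) \<theta>(1)] unfolding complete_family_def by blast
  qed (use sX U(2) \<theta>(2) in auto)
  show ?thesis
  proof (rule that[OF u])
    show "x \<in> X \<Longrightarrow> elts x \<subseteq> W \<and> elts x \<lesssim> elts \<kappa>" for x using X by blast
    fix w assume w: "w \<in> W"
    have "{w} \<lesssim> elts \<kappa>" using inf finite_lepoll_infinite by blast
    then have "vset {w} \<in> X" "elts (vset {w}) = {w}" using vX[of "{w}"] w by auto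
    then have "{x \<in> X. w \<in> elts x} \<in> F" unfolding F_def cone_def by force
    then show "ultra.ae X U (\<lambda>x. w \<in> elts x)" unfolding ultra.ae_def[OF u] using U(1) by blast
  qed
qed

section \<open>Tameness and shortness of one class\<close>

context mu_class
begin

lemma local_chain:
  assumes "(E_at K J)\<^sup>+\<^sup>+ (a, A, N1) (b, A, N2)"
  obtains n :: nat and c N f f' Q where "0 < n" "N 0 = N1" "N n = N2" "c 0 = a" "c n = b"
    "\<And>i. i < n \<Longrightarrow> K_embedding K (f i) (N i) (Q i)" "\<And>i. i < n \<Longrightarrow> K_embedding K (f' i) (N (Suc i)) (Q i)"
    "\<And>i x. i \<le> n \<Longrightarrow> x \<in> A \<Longrightarrow> x \<in> univ (N i)" "\<And>i j. i \<le> n \<Longrightarrow> j \<in> J \<Longrightarrow> c i j \<in> univ (N i)"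
    "\<And>i x. i < n \<Longrightarrow> x \<in> A \<Longrightarrow> f i x = x \<and> f' i x = x" 
    "\<And>i j. i < n \<Longrightarrow> j \<in> J \<Longrightarrow> f i (c i j) = f' i (c (Suc i) j)"
proof -
  obtain n where n: "0 < n" "((E_at K J) ^^ n) (a, A, N1) (b, A, N2)"
    using assms unfolding tranclp_power by blast
  then obtain s where s: "s 0 = (a, A, N1)" "s n = (b, A, N2)" "\<And>i. i < n \<Longrightarrow> E_at K J (s i) (s (Suc i))"
    unfolding relpowp_fun_conv by blast
  define c where "c i = fst (s i)" for i
  define N where "N i = snd (snd (s i))" for i
  have sA: "i \<le> n \<Longrightarrow> s i = (c i, A, N i)" for i
  proof (induction i)
    case (Suc i)
    then show ?case using s(3)[of i] by (cases "s (Suc i)") (auto simp: E_at_def c_def N_def)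
  qed (simp add: s c_def N_def)
  have e: "E_at K J (c i, A, N i) (c (Suc i), A, N (Suc i))" if "i < n" for i
    using s(3)[OF that] sA[of i] sA[of "Suc i"] that by simp
  have "\<forall>i. \<exists>Q f f'. i < n \<longrightarrow> K_embedding K f (N i) Q \<and> K_embedding K f' (N (Suc i)) Q \<and>
     (\<forall>x \<in> A. f x = x \<and> f' x = x) \<and> (\<forall>j \<in> J. f (c i j) = f' (c (Suc i) j))"
  proof
    fix i show "\<exists>Q f f'. i < n \<longrightarrow> K_embedding K f (N i) Q \<and> K_embedding K f' (N (Suc i)) Q \<and>
     (\<forall>x \<in> A. f x = x \<and> f' x = x) \<and> (\<forall>j \<in> J. f (c i j) = f' (c (Suc i) j))"
      using e[of i] unfolding E_at_def prod.case by (cases "i < n") (simp, blast, simp)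
  qed
  then obtain Q f f' where Q: "\<And>i. i < n \<Longrightarrow> K_embedding K (f i) (N i) (Q i) \<and> K_embedding K (f' i) (N (Suc i)) (Q i) \<and>
     (\<forall>x \<in> A. f i x = x \<and> f' i x = x) \<and> (\<forall>j \<in> J. f i (c i j) = f' i (c (Suc i) j))" by metis
  have m: "A \<subseteq> univ (N i) \<and> c i \<in> J \<rightarrow>\<^sub>E univ (N i)" if "i \<le> n" for i
  proof (cases "i = n")
    case True
    then obtain j where "n = Suc j" using n gr0_implies_Suc by blast
    then show ?thesis using True e[of j] by (auto simp: E_at_def)
  next
    case False then show ?thesis using that e[of i] by (auto simp: E_at_def)
  qed
  have mA: "x \<in> univ (N i)" if "i \<le> n" "x \<in> A" for i x using m[OF that(1)] that(2) by blast
  have mc: "c i j \<in> univ (N i)" if "i \<le> n" "j \<in> J" for i j using m[OF that(1)] that(2) by (blast dest: PiE_mem)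
  show ?thesis
    by (rule that[of n N c f Q f']) (use n(1) s(1,2) Q mA mc in \<open>auto simp: c_def[of 0] c_def[of n] N_def[of 0] N_def[of n]\<close>)
qed

text \<open>\<theta> is the size of \<open>l\<close> together with the number of marked structures
  on subsets of \<open>l\<close>; these are coded by their components to see that there is only a
  set of them.\<close>

lemma ex_mu_ultra_bound:
  obtains l \<theta> :: 'v where "infinite (elts \<theta>)"
    "\<And>X U V. ultra X U \<theta> \<Longrightarrow> small V \<Longrightarrow> mu_ultra \<mu> K X U \<theta> V l"
proof -
  obtain l :: 'v where l: "infinite (elts l)" "elts \<mu> \<lesssim> elts l"
    and st: "\<And>M A. M \<in> models K \<Longrightarrow> A \<subseteq> univ M \<Longrightarrow> A \<lesssim> elts l \<Longrightarrow> \<exists>B. strong K M B \<and> A \<subseteq> B \<and> B \<lesssim> elts l"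
    by (rule lowenheim_skolem_tarskiE[OF aec]) (rule that)
  let ?S = "{(S, T). is_struc L T \<and> univ T \<subseteq> elts l \<and> S \<subseteq> univ T}"
  have el: "setlike TYPE('v) (elts x)" for x :: 'v by (simp add: setlike_small)
  have sL: "setlike TYPE('v) (fsyms L)" "setlike TYPE('v) (rsyms L)"
    using abstract_classD(1) by (simp_all add: mu_ary_def setlike_small)
  \<comment> \<open>An extensional function determines its domain, so there is no monotonicity in
    the domain, and the function spaces over all possible universes \<open>u\<close> have to be
    united.\<close>
  define A where "A = (\<Pi>\<^sub>E s \<in> fsyms L. (\<Union>u \<in> Pow (elts l). (\<Union>v \<in> Pow (elts l). (elts (far L s) \<rightarrow>\<^sub>E u) \<rightarrow>\<^sub>E v)))"
  define B where "B = (\<Pi>\<^sub>E s \<in> rsyms L. Pow (elts (rar L s) \<rightarrow>\<^sub>E elts l))"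
  have sA: "setlike TYPE('v) A"
    unfolding A_def using setlike_subset[OF el] by (intro setlike_PiE setlike_UN sL setlike_Pow el) auto
  have sB: "setlike TYPE('v) B"
    unfolding B_def by (intro setlike_PiE sL setlike_Pow el)
  have "inj_on (\<lambda>(S, T). (S, univ T, fint T, rint T)) ?S"
    by (auto simp: inj_on_def)
  moreover have "(\<lambda>(S, T). (S, univ T, fint T, rint T)) ` ?S \<subseteq> Pow (elts l) \<times> Pow (elts l) \<times> A \<times> B"
  proof (clarsimp, intro conjI)
    fix S T assume T: "is_struc L T" "univ T \<subseteq> elts l" and S: "S \<subseteq> univ T"
    show "S \<subseteq> elts l" using S T(2) by blast
    have "fint T \<in> (\<Pi>\<^sub>E s \<in> fsyms L. (elts (far L s) \<rightarrow>\<^sub>E univ T) \<rightarrow>\<^sub>E univ T)"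
      using T(1) by (simp add: is_struc_def)
    moreover have "(\<Pi>\<^sub>E s \<in> fsyms L. (elts (far L s) \<rightarrow>\<^sub>E univ T) \<rightarrow>\<^sub>E univ T) \<subseteq> A"
      unfolding A_def by (rule PiE_mono) (use T(2) in blast)
    ultimately show "fint T \<in> A" by (rule subsetD[rotated])
    have "rint T \<in> (\<Pi>\<^sub>E s \<in> rsyms L. Pow (elts (rar L s) \<rightarrow>\<^sub>E univ T))"
      using T(1) by (simp add: is_struc_def)
    moreover have "(\<Pi>\<^sub>E s \<in> rsyms L. Pow (elts (rar L s) \<rightarrow>\<^sub>E univ T)) \<subseteq> B"
      unfolding B_def by (rule PiE_mono) (intro Pow_mono PiE_mono T(2))
    ultimately show "rint T \<in> B" by (rule subsetD[rotated])
  qed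
  ultimately have "?S \<lesssim> Pow (elts l) \<times> Pow (elts l) \<times> A \<times> B" unfolding lepoll_def by blast
  then have sS: "setlike TYPE('v) ?S"
    by (rule setlike_lepoll) (intro setlike_Times setlike_Pow el sA sB)
  obtain \<theta> :: 'v where \<theta>: "elts \<theta> \<approx> elts l <+> ?S"
    using ex_Card_eqpoll[OF setlike_Plus[OF el[of l] sS]] by blast
  have l\<theta>: "elts l \<lesssim> elts \<theta>" and S\<theta>: "?S \<lesssim> elts \<theta>"
    using lepoll_Plus1 lepoll_Plus2 lepoll_trans2 eqpoll_sym[OF \<theta>] by blast+
  have inf: "infinite (elts \<theta>)" using l(1) l\<theta> infinite_le_lepoll lepoll_trans by blast
  show ?thesis
  proof (rule that[OF inf])
    fix X U and V :: "'v set" assume u: "ultra X U \<theta>" and V: "small V"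
    interpret ultra X U \<theta> by (rule u)
    have m: "J \<lesssim> elts \<theta>" if "J \<prec> elts \<mu>" for J :: "'v set"
      using lesspoll_imp_lepoll[OF that] l(2) l\<theta> lepoll_trans by blast
    show "mu_ultra \<mu> K X U \<theta> V l"
      by unfold_locales (use V m far_lesspoll rar_lesspoll l st l\<theta> S\<theta> in auto)
  qed
qed

text \<open>The constants increase in the order \<theta>, \<nu>, \<open>\<kappa>\<^sub>0\<close>,
  \<kappa>: completeness at \<nu> gives closure under \<theta> intersections,
  \<open>\<kappa>\<^sub>0\<close> extends the filter of cones to a \<nu>-complete ultrafilter, and
  \<kappa> exceeds the sets indexing the cones, whose size is at most
  \<open>\<kappa>\<^sub>0\<close>.\<close>

theorem fully_tame_and_short:
  assumes asc: "\<not> small {\<kappa> :: 'v. almost_strongly_compact \<kappa>}"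
  shows "\<exists>\<kappa>. Card \<kappa> \<and> fully_tame_and_short \<kappa> K"
proof -
  obtain l \<theta> :: 'v where inf\<theta>: "infinite (elts \<theta>)"
    and ult: "\<And>X U V. ultra X U \<theta> \<Longrightarrow> small V \<Longrightarrow> mu_ultra \<mu> K X U \<theta> V l" by (rule ex_mu_ultra_bound) (rule that)
  have big: "\<exists>\<nu> :: 'v. Card \<nu> \<and> elts x \<prec> elts \<nu>" for x :: 'v
  proof -
    have "setlike TYPE('v) (Pow (elts x))" by (intro setlike_Pow) (simp add: setlike_small)
    then obtain \<nu> :: 'v where "Card \<nu>" "elts \<nu> \<approx> Pow (elts x)" by (rule ex_Card_eqpoll)
    then show ?thesis using lesspoll_Pow_self lesspoll_eq_trans eqpoll_sym by blast
  qed
  obtain \<nu> :: 'v where \<nu>: "Card \<nu>" "elts \<theta> \<prec> elts \<nu>" using big by blast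
  obtain \<kappa>\<^sub>0 :: 'v where \<kappa>\<^sub>0: "almost_strongly_compact \<kappa>\<^sub>0" "\<nu> \<in> elts \<kappa>\<^sub>0"
    by (rule almost_strongly_compact_above[OF asc \<nu>(1)])
  obtain \<kappa> :: 'v where \<kappa>: "Card \<kappa>" "elts \<kappa>\<^sub>0 \<prec> elts \<kappa>" using big by blast
  have "fully_tame_and_short \<kappa> K"
    unfolding fully_tame_and_short_def
  proof (intro ballI allI impI)
    fix M \<alpha> p q assume M: "M \<in> models K" and p: "p \<in> gS K \<alpha> M" and q: "q \<in> gS K \<alpha> M" and pq: "p \<noteq> q"
    obtain a N1 where a: "p = gtp K (elts \<alpha>) a (univ M) N1" "leK K M N1" "a \<in> elts \<alpha> \<rightarrow>\<^sub>E univ N1"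
      using p unfolding gS_def by blast
    obtain b N2 where b: "q = gtp K (elts \<alpha>) b (univ M) N2" "leK K M N2" "b \<in> elts \<alpha> \<rightarrow>\<^sub>E univ N2"
      using q unfolding gS_def by blast
    have N12: "N1 \<in> models K" "N2 \<in> models K" using a(2) b(2) leK_models by blast+
    have M12: "univ M \<subseteq> univ N1" "univ M \<subseteq> univ N2" 
      using leK_substruc[OF a(2)] leK_substruc[OF b(2)] by (simp_all add: substruc_def)
    have sM: "small (univ M)" using models_struc[OF M] by (simp add: is_struc_def)
    show "\<exists>I\<subseteq>elts \<alpha>. \<exists>A\<subseteq>univ M. I <+> A \<prec> elts \<kappa> \<and> gtp_restrict K I A p \<noteq> gtp_restrict K I A q"
    proof (rule ccontr)
      assume "\<not> ?thesis"
      then have same: "gtp_restrict K I A p = gtp_restrict K I A q" 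
        if "I \<subseteq> elts \<alpha>" "A \<subseteq> univ M" "I <+> A \<prec> elts \<kappa>" for I A using that by blast
      \<comment> \<open>Places of the sequence and parameters are treated alike as labels; a point
        of \<open>X\<close> codes a set of at most \<open>\<kappa>\<^sub>0\<close> of them.\<close>
      define Z where "Z = elts \<alpha> <+> univ M"
      have "setlike TYPE('v) Z" unfolding Z_def using sM by (intro setlike_Plus) (simp_all add: setlike_small)
      then obtain e :: "'v + 'v \<Rightarrow> 'v" where e: "inj_on e Z" "small (e ` Z)" by (rule setlikeE)
      obtain X U where XU: "ultra X U \<theta>" and X: "\<And>x. x \<in> X \<Longrightarrow> elts x \<subseteq> e ` Z \<and> elts x \<lesssim> elts \<kappa>\<^sub>0"
        and fine: "\<And>w. w \<in> e ` Z \<Longrightarrow> ultra.ae X U (\<lambda>x. w \<in> elts x)"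
        by (rule ex_fine_ultrafilter[OF \<kappa>\<^sub>0 \<nu> inf\<theta> e(2)]) (rule that)
      interpret X: ultra X U \<theta> by (rule XU)
      define I where "I x = {j \<in> elts \<alpha>. e (Inl j) \<in> elts x}" for x
      define A where "A x = {m \<in> univ M. e (Inr m) \<in> elts x}" for x
      have chain: "(E_at K (I x))\<^sup>+\<^sup>+ (restrict a (I x), A x, N1) (restrict b (I x), A x, N2)" if x: "x \<in> X" for x
      proof -
        have IA: "I x \<subseteq> elts \<alpha>" "A x \<subseteq> univ M" by (auto simp: I_def A_def)
        then have sub: "I x <+> A x \<subseteq> Z" unfolding Z_def by auto
        have "e ` (I x <+> A x) \<subseteq> elts x" by (auto simp: I_def A_def)
        then have "I x <+> A x \<lesssim> elts x" using inj_on_subset[OF e(1) sub] unfolding lepoll_def by blast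
        then have "I x <+> A x \<prec> elts \<kappa>" using X[OF x] \<kappa>(2) lepoll_trans lesspoll_trans1 by blast
        then have "gtp_restrict K (I x) (A x) p = gtp_restrict K (I x) (A x) q" using same IA by blast
        then have "gtp K (I x) (restrict a (I x)) (A x) N1 = gtp K (I x) (restrict b (I x)) (A x) N2"
          using gtp_restrict_gtp[OF E_at_refl[OF N12(1) M12(1) a(3)] IA]
            gtp_restrict_gtp[OF E_at_refl[OF N12(2) M12(2) b(3)] IA] a(1) b(1) by simp
        then show ?thesis
          by (rule gtp_eqD) (use N12 IA M12 b(3) in auto)
      qed
      define good where "good x n c N f f' Q \<longleftrightarrow> N 0 = N1 \<and> N n = N2 \<and> c 0 = restrict a (I x) \<and> c n = restrict b (I x) \<and>
        (\<forall>i < n. K_embedding K (f i) (N i) (Q i) \<and> K_embedding K (f' i) (N (Suc i)) (Q i) \<and>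
          (\<forall>m \<in> A x. f i m = m \<and> f' i m = m) \<and> (\<forall>j \<in> I x. f i (c i j) = f' i (c (Suc i) j))) \<and>
        (\<forall>i \<le> n. (\<forall>m \<in> A x. m \<in> univ (N i)) \<and> (\<forall>j \<in> I x. c i j \<in> univ (N i)))"
        for x and n :: nat and c :: "nat \<Rightarrow> 'v \<Rightarrow> 'v" and N :: "nat \<Rightarrow> 'v struc" and f f' :: "nat \<Rightarrow> 'v \<Rightarrow> 'v" and Q :: "nat \<Rightarrow> 'v struc"
      have "\<forall>x \<in> X. \<exists>n > 0. \<exists>c N f f' Q. good x n c N f f' Q"
      proof
        fix x assume x: "x \<in> X"
        obtain n :: nat and c N f f' Q where "0 < n" "N 0 = N1" "N n = N2" "c 0 = restrict a (I x)" "c n = restrict b (I x)"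
          "\<And>i. i < n \<Longrightarrow> K_embedding K (f i) (N i) (Q i)" "\<And>i. i < n \<Longrightarrow> K_embedding K (f' i) (N (Suc i)) (Q i)"
          "\<And>i m. i \<le> n \<Longrightarrow> m \<in> A x \<Longrightarrow> m \<in> univ (N i)" "\<And>i j. i \<le> n \<Longrightarrow> j \<in> I x \<Longrightarrow> c i j \<in> univ (N i)"
          "\<And>i m. i < n \<Longrightarrow> m \<in> A x \<Longrightarrow> f i m = m \<and> f' i m = m" 
          "\<And>i j. i < n \<Longrightarrow> j \<in> I x \<Longrightarrow> f i (c i j) = f' i (c (Suc i) j)"
          by (rule local_chain[OF chain[OF x]]) (rule that)
        then have "0 < n \<and> good x n c N f f' Q" unfolding good_def by simp
        then show "\<exists>n > 0. \<exists>c N f f' Q. good x n c N f f' Q" by blast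
      qed
      then obtain n :: "'v \<Rightarrow> nat" where n: "\<And>x. x \<in> X \<Longrightarrow> 0 < n x \<and> (\<exists>c N f f' Q. good x (n x) c N f f' Q)" by metis
      \<comment> \<open>The length of the chain depends on \<open>x\<close>; there are countably
        many lengths, so one of them occurs almost everywhere.\<close>
      have "(UNIV :: nat set) \<lesssim> elts \<theta>" using inf\<theta> infinite_le_lepoll by blast
      then obtain k where k: "X.ae (\<lambda>x. n x = k)" by (rule X.ae_pigeonhole[of _ n]) (auto intro: X.ae_all')
      define Y where "Y = {x \<in> X. n x = k}"
      have Y: "Y \<in> U" using k by (simp add: Y_def X.ae_def)
      have k0: "0 < k" using X.ae_ex[OF k] n by blast
      let ?U = "U \<inter> Pow Y"
      have u: "ultra Y ?U \<theta>" by (rule X.ultra_restrict[OF Y])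
      \<comment> \<open>The end structures are prescribed for every \<open>x\<close>, also outside
        \<open>Y\<close>, so that the families at both ends are constant functions.\<close>
      have "\<forall>x. \<exists>c N f f' Q. N 0 = N1 \<and> N k = N2 \<and> (x \<in> Y \<longrightarrow> good x k c N f f' Q)"
      proof
        fix x
        show "\<exists>c N f f' Q. N 0 = N1 \<and> N k = N2 \<and> (x \<in> Y \<longrightarrow> good x k c N f f' Q)"
        proof (cases "x \<in> Y")
          case True
          then obtain c N f f' Q where "good x k c N f f' Q" using n[of x] unfolding Y_def by blast
          moreover from this have "N 0 = N1" "N k = N2" unfolding good_def by blast+
          ultimately show ?thesis by blast
        next
          case False
          then show ?thesis using k0 by (intro exI[of _ "\<lambda>_. a"] exI[of _ "\<lambda>i. if i = 0 then N1 else N2"]) simp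
        qed
      qed
      then obtain c N f f' Q where g: "\<And>x. N x 0 = N1" "\<And>x. N x k = N2" 
        and "\<And>x. x \<in> Y \<Longrightarrow> good x k (c x) (N x) (f x) (f' x) (Q x)"
        by metis
      note good = this(3)[unfolded good_def]
      have fN: "K_embedding K (f x i) (N x i) (Q x i)" and fN': "K_embedding K (f' x i) (N x (Suc i)) (Q x i)"
        if "x \<in> Y" "i < k" for x i using good[OF that(1)] that(2) by blast+
      \<comment> \<open>One small set for all universes that occur in the chains, as required by the
        common coding \<open>cls\<close>.\<close>
      define V where "V = (\<Union>x\<in>Y. (\<Union>i\<in>{..k}. univ (N x i)) \<union> (\<Union>i\<in>{..<k}. univ (Q x i)))"
      have sN: "setlike TYPE('v) (univ (N x i))" if "x \<in> Y" "i \<le> k" for x i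
      proof (cases "i = k")
        case True
        then show ?thesis using models_struc[OF N12(2)] by (simp add: g setlike_small is_struc_def)
      next
        case False
        then show ?thesis 
          using models_struc[OF K_embedding_models(1)[OF fN[OF that(1), of i]]] that(2) by (simp add: setlike_small is_struc_def)
      qed
      have sQ: "setlike TYPE('v) (univ (Q x i))" if "x \<in> Y" "i < k" for x i
        using models_struc[OF K_embedding_models(2)[OF fN[OF that]]] by (simp add: setlike_small is_struc_def)
      have "setlike TYPE('v) Y" using small_subset[OF X.small_X, of Y] by (auto simp: Y_def setlike_small)
      then have "setlike TYPE('v) V"
        unfolding V_def by (intro setlike_UN setlike_Un setlike_countable[of "{..k}"] setlike_countable[of "{..<k}"]) (auto intro: sN sQ)
      then have sV: "small V" by (simp add: setlike_small)
      define lb where "lb x i z = case_sum (c x i) (\<lambda>m. m) z" for x i z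
      have "(elink Z)\<^sup>+\<^sup>+ (case_sum a (\<lambda>m. m), N1) (case_sum b (\<lambda>m. m), N2)"
      proof (rule mu_ultra_chain[where Y = Y and U = ?U and \<theta> = \<theta> and V = V and l = l and n = k and N = N and Q = Q and f = f and f' = f'
          and D = "\<lambda>x z. e z \<in> elts x" and lb = lb])
        show "mu_ultra \<mu> K Y ?U \<theta> V l" by (rule ult[OF u sV])
        show "univ (N x i) \<subseteq> V" if "x \<in> Y" "i \<le> k" for x i using that unfolding V_def by auto
        show "univ (Q x i) \<subseteq> V" if "x \<in> Y" "i < k" for x i using that unfolding V_def by auto
        show "ultra.ae Y ?U (\<lambda>x. e z \<in> elts x)" if "z \<in> Z" for z
        proof -
          have "{x \<in> X. e z \<in> elts x} \<in> U" using fine[of "e z"] that by (simp add: X.ae_def)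
          from X.filter(4)[OF this Y] have "{x \<in> Y. e z \<in> elts x} \<in> U" 
            by (rule back_subst[of "\<lambda>S. S \<in> U"]) (auto simp: Y_def)
          then show ?thesis unfolding ultra.ae_def[OF u] by blast
        qed
        show "lb x i z \<in> univ (N x i)" if "x \<in> Y" "i \<le> k" "z \<in> Z" "e z \<in> elts x" for x i z
          using that good[OF that(1)] unfolding Z_def lb_def I_def A_def by auto
        show "f x i (lb x i z) = f' x i (lb x (Suc i) z)" if "x \<in> Y" "i < k" "z \<in> Z" "e z \<in> elts x" for x i z
          using that good[OF that(1)] unfolding Z_def lb_def I_def A_def by auto
        show "lb x 0 z = case_sum a (\<lambda>m. m) z" if "x \<in> Y" "z \<in> Z" "e z \<in> elts x" for x z
          using that good[OF that(1)] unfolding Z_def lb_def I_def A_def by auto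
        show "lb x k z = case_sum b (\<lambda>m. m) z" if "x \<in> Y" "z \<in> Z" "e z \<in> elts x" for x z
          using that good[OF that(1)] unfolding Z_def lb_def I_def A_def by auto
        show "case_sum a (\<lambda>m. m) ` Z \<subseteq> univ N1" "case_sum b (\<lambda>m. m) ` Z \<subseteq> univ N2"
          using M12 a(3) b(3) unfolding Z_def by auto
      qed (use k0 g fN fN' in auto)
      then have "(E_at K (elts \<alpha>))\<^sup>+\<^sup>+ (a, univ M, N1) (b, univ M, N2)"
        unfolding Z_def by (rule elink_chain_realize[OF _ sM a(3) b(3) N12(1)])
      then show False using pq gtp_eqI a(1) b(1) by blast
    qed
  qed
  then show ?thesis using \<kappa>(1) by blast
qed

end

section \<open>The first infinite cardinal\<close>

primrec ordn :: "nat \<Rightarrow> 'v::zfc_universe" where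
  "ordn 0 = vset {}"
| "ordn (Suc n) = vset (insert (ordn n) (elts (ordn n)))"

lemma elts_ordn_Suc: "elts (ordn (Suc n)) = insert (ordn n) (elts (ordn n))"
  by (simp add: elts_vset small_insert)

declare ordn.simps(2) [simp del]

lemma elts_ordn: "elts (ordn n) = ordn ` {..<n}"
  by (induction n) (simp_all add: elts_vset elts_ordn_Suc lessThan_Suc)

declare ordn.simps(1) [simp del]

lemma ordn_inj: "inj (ordn :: nat \<Rightarrow> 'v::zfc_universe)"
proof (rule linorder_injI)
  fix m n :: nat assume "m < n"
  then have "(ordn m :: 'v) \<in> elts (ordn n)" by (simp add: elts_ordn)
  then show "(ordn m :: 'v) \<noteq> ordn n" using elts_irrefl by metis
qed

lemma ordn_eq_iff [simp]: "ordn m = ordn n \<longleftrightarrow> m = n"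
  using ordn_inj by (rule inj_eq)

lemma Ord_ordn: "Ord (ordn n)"
  by (auto simp: Ord_def elts_ordn)

lemma small_range_ordn: "small (range (ordn :: nat \<Rightarrow> 'v::zfc_universe))"
  using setlike_image[OF setlike_nat] setlike_small by blast

text \<open>Uniqueness is by linearity of the ordinals: an infinite ordinal with finite elements can
  neither be a member of \<open>w\<close> nor contain it.\<close>

lemma elts_omega: "elts (omega :: 'v::zfc_universe) = range ordn"
proof -
  define w :: 'v where "w = vset (range ordn)"
  have ew: "elts w = range ordn" unfolding w_def by (rule elts_vset[OF small_range_ordn])
  have Ow: "Ord w" unfolding w_def
    by (rule Ord_vset[OF small_range_ordn]) (auto simp: Ord_ordn elts_ordn)
  have inf: "infinite (elts w)" unfolding ew using range_inj_infinite[OF ordn_inj] .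
  have fin: "finite (elts n)" if "n \<in> elts w" for n using that by (auto simp: ew elts_ordn)
  have "omega = w"
    unfolding omega_def
  proof (rule the_equality)
    show "Ord w \<and> infinite (elts w) \<and> (\<forall>n\<in>elts w. finite (elts n))" using Ow inf fin by blast
    fix v :: 'v assume v: "Ord v \<and> infinite (elts v) \<and> (\<forall>n\<in>elts v. finite (elts n))"
    then show "v = w" using Ord_linear[of v w] Ow inf fin by blast
  qed
  then show ?thesis using ew by simp
qed

lemma infinite_omega: "infinite (elts (omega :: 'v::zfc_universe))"
  unfolding elts_omega using range_inj_infinite[OF ordn_inj] .

lemma omega_lepoll:
  assumes "infinite A" shows "elts (omega :: 'v::zfc_universe) \<lesssim> A"
  using lepoll_trans[OF image_lepoll, of "UNIV :: nat set" A ordn] assms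
  by (simp add: elts_omega infinite_le_lepoll)

lemma Card_omega: "Card (omega :: 'v::zfc_universe)"
  unfolding Card_def
proof (intro conjI ballI)
  show "Ord (omega :: 'v)" by (auto simp: Ord_def elts_omega elts_ordn)
  show "elts \<alpha> \<prec> elts omega" if "\<alpha> \<in> elts omega" for \<alpha> :: 'v
    by (rule finite_lesspoll_infinite[OF infinite_omega]) (use that in \<open>auto simp: elts_omega elts_ordn\<close>)
qed

lemma regular_omega: "regular_card (omega :: 'v::zfc_universe)"
  unfolding regular_card_def
proof (intro conjI Card_omega infinite_omega allI impI)
  fix X assume X: "X \<subseteq> elts (omega :: 'v)" and cof: "\<forall>\<beta>\<in>elts (omega :: 'v). \<exists>x\<in>X. \<beta> = x \<or> \<beta> \<in> elts x"
  have "infinite X"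
  proof
    assume "finite X"
    moreover obtain Y where Y: "X = ordn ` Y" using X unfolding elts_omega by (auto simp: subset_image_iff)
    ultimately have "finite Y" using finite_imageD inj_on_subset[OF ordn_inj] by blast
    then obtain n where n: "\<And>m. m \<in> Y \<Longrightarrow> m < n" by (auto simp: finite_nat_set_iff_bounded)
    have "(ordn n :: 'v) \<in> elts omega" by (simp add: elts_omega)
    then show False using cof n unfolding Y by (force simp: elts_ordn)
  qed
  then show "X \<approx> elts (omega :: 'v)"
    using omega_lepoll subset_imp_lepoll[OF X] lepoll_antisym by blast
qed

lemma finite_PiE_lepoll:
  assumes "infinite C" "finite J" shows "J \<rightarrow>\<^sub>E C \<lesssim> C"
  using assms(2)
proof (induction J)
  case empty
  then show ?case by (simp add: PiE_empty_domain finite_lepoll_infinite[OF assms(1)])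
next
  case (insert j J)
  have "inj_on (\<lambda>f. (f j, restrict f J)) (insert j J \<rightarrow>\<^sub>E C)"
  proof (rule inj_onI)
    fix f g assume fg: "f \<in> insert j J \<rightarrow>\<^sub>E C" "g \<in> insert j J \<rightarrow>\<^sub>E C" "(f j, restrict f J) = (g j, restrict g J)"
    then have "f i = g i" if "i \<in> insert j J" for i using that by (auto dest: fun_cong[of _ _ i])
    with fg show "f = g" by (intro PiE_ext)
  qed
  moreover have "(\<lambda>f. (f j, restrict f J)) ` (insert j J \<rightarrow>\<^sub>E C) \<subseteq> C \<times> (J \<rightarrow>\<^sub>E C)" by auto
  ultimately have "insert j J \<rightarrow>\<^sub>E C \<lesssim> C \<times> (J \<rightarrow>\<^sub>E C)" unfolding lepoll_def by blast
  also have "\<dots> \<lesssim> C" by (rule infinite_Times_lepoll[OF assms(1) lepoll_refl insert.IH])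
  finally show ?case .
qed

lemma lepoll_seqs_lt_omega: "A \<lesssim> seqs_lt (omega :: 'v::zfc_universe) A"
proof -
  have "inj_on (\<lambda>a. (ordn (Suc 0) :: 'v, \<lambda>i \<in> elts (ordn (Suc 0) :: 'v). a)) A"
  proof (rule inj_onI)
    fix a b assume "(ordn (Suc 0) :: 'v, \<lambda>i \<in> elts (ordn (Suc 0) :: 'v). a) = (ordn (Suc 0), \<lambda>i \<in> elts (ordn (Suc 0) :: 'v). b)"
    then have "(\<lambda>i \<in> elts (ordn (Suc 0) :: 'v). a) = (\<lambda>i \<in> elts (ordn (Suc 0) :: 'v). b)" by blast
    from fun_cong[OF this, of "ordn 0"] show "a = b" by (simp add: elts_ordn)
  qed
  moreover have "(\<lambda>a. (ordn (Suc 0) :: 'v, \<lambda>i \<in> elts (ordn (Suc 0) :: 'v). a)) ` A \<subseteq> seqs_lt omega A"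
    by (auto simp: seqs_lt_def elts_omega)
  ultimately show ?thesis unfolding lepoll_def by blast
qed

text \<open>For finitary classes every infinite cardinal thus satisfies the arithmetical condition
  in the Loewenheim-Skolem-Tarski axiom.\<close>

lemma seqs_lt_omega_eqpoll:
  assumes "infinite C" shows "C \<approx> seqs_lt (omega :: 'v::zfc_universe) C"
proof (rule lepoll_antisym[OF lepoll_seqs_lt_omega])
  have "seqs_lt (omega :: 'v) C \<lesssim> elts (omega :: 'v) \<times> C"
    unfolding seqs_lt_def
    by (intro Sigma_lepoll_mono order_refl finite_PiE_lepoll[OF assms]) (auto simp: elts_omega elts_ordn)
  also have "\<dots> \<lesssim> C" by (intro infinite_Times_lepoll assms omega_lepoll lepoll_refl)
  finally show "seqs_lt (omega :: 'v) C \<lesssim> C" .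
qed

section \<open>Directed unions of structures\<close>

text \<open>No ambient structure is at hand here. Two members that contain the same argument tuple
  agree on it because both are substructures of a common upper bound; this determines the value in
  \<open>union_struc\<close>.\<close>

lemma
  fixes L :: "'v::zfc_universe language"
  assumes dir: "mu_directed \<mu> I r" and \<mu>: "Card \<mu>" "infinite (elts \<mu>)" and L: "mu_ary \<mu> L" and I: "small I"
    and M: "\<And>i. i \<in> I \<Longrightarrow> is_struc L (M i)" and sub: "\<And>i j. (i, j) \<in> r \<Longrightarrow> substruc L (M i) (M j)"
  shows is_struc_union: "is_struc L (union_struc L I M)"
    and substruc_union: "i \<in> I \<Longrightarrow> substruc L (M i) (union_struc L I M)"
    and union_substruc: "is_struc L N \<Longrightarrow> (\<And>i. i \<in> I \<Longrightarrow> substruc L (M i) N) \<Longrightarrow> substruc L (union_struc L I M) N"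
    and union_bound: "finite J \<Longrightarrow> J \<subseteq> (\<Union>i\<in>I. univ (M i)) \<Longrightarrow> \<exists>i\<in>I. J \<subseteq> univ (M i)"
proof -
  let ?V = "\<Union>i\<in>I. univ (M i)" and ?U = "union_struc L I M"
  have bd: "\<exists>u\<in>I. \<forall>x\<in>C. (x, u) \<in> r" if "C \<subseteq> I" "C \<prec> elts \<mu>" for C
    using dir that unfolding mu_directed_def by blast
  have bound: "\<exists>i\<in>I. y ` J \<subseteq> univ (M i)" if J: "J \<prec> elts \<mu>" and y: "y ` J \<subseteq> ?V" for y and J :: "'x set"
  proof -
    have "\<forall>j \<in> J. \<exists>i \<in> I. y j \<in> univ (M i)" using y by blast
    then obtain i where i: "\<And>j. j \<in> J \<Longrightarrow> i j \<in> I \<and> y j \<in> univ (M (i j))" by metis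
    have "i ` J \<prec> elts \<mu>" using image_lepoll J by (rule lesspoll_trans1)
    then obtain u where u: "u \<in> I" "\<forall>x\<in>i ` J. (x, u) \<in> r" using bd[of "i ` J"] i by blast
    then have "univ (M (i j)) \<subseteq> univ (M u)" if "j \<in> J" for j 
      using sub[of "i j" u] that by (simp add: substruc_def)
    then show ?thesis using i u(1) by blast
  qed
  show union_bound: "\<exists>i\<in>I. J \<subseteq> univ (M i)" if "finite J" "J \<subseteq> ?V" for J
    using bound[of J id] that finite_lesspoll_infinite[OF \<mu>(2) that(1)] by simp
  have tup: "\<exists>i\<in>I. x \<in> J \<rightarrow>\<^sub>E univ (M i)" if "J \<prec> elts \<mu>" "x \<in> J \<rightarrow>\<^sub>E ?V" for x and J :: "'v set"
    using bound[of J x] that by (auto simp: PiE_iff image_subset_iff)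
  have fl: "elts (far L s) \<prec> elts \<mu>" if "s \<in> fsyms L" for s
    using L Card_mem_lesspoll[OF \<mu>(1)] that unfolding mu_ary_def by blast
  have rl: "elts (rar L s) \<prec> elts \<mu>" if "s \<in> rsyms L" for s
    using L Card_mem_lesspoll[OF \<mu>(1)] that unfolding mu_ary_def by blast
  have pair: "\<exists>k\<in>I. (i, k) \<in> r \<and> (j, k) \<in> r" if "i \<in> I" "j \<in> I" for i j
    using bd[of "{i, j}"] that finite_lesspoll_infinite[OF \<mu>(2), of "{i, j}"] by auto
  have uV: "univ ?U = ?V" by (simp add: union_struc_def)
  have sV: "univ (M i) \<subseteq> ?V" if "i \<in> I" for i using that by blast
  have F: "fint ?U s x = fint (M i) s x" if s: "s \<in> fsyms L" and i: "i \<in> I" and x: "x \<in> elts (far L s) \<rightarrow>\<^sub>E univ (M i)" for s i x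
  proof -
    have "x \<in> elts (far L s) \<rightarrow>\<^sub>E ?V" using PiE_range_mono[OF sV[OF i] x] .
    then have "fint ?U s x = (THE y. \<exists>i \<in> I. x \<in> elts (far L s) \<rightarrow>\<^sub>E univ (M i) \<and> y = fint (M i) s x)"
      using s by (simp add: union_struc_def)
    also have "\<dots> = fint (M i) s x"
    proof (rule the_equality)
      show "\<exists>j \<in> I. x \<in> elts (far L s) \<rightarrow>\<^sub>E univ (M j) \<and> fint (M i) s x = fint (M j) s x" using i x by blast
      fix y assume "\<exists>j \<in> I. x \<in> elts (far L s) \<rightarrow>\<^sub>E univ (M j) \<and> y = fint (M j) s x"
      then obtain j where j: "j \<in> I" "x \<in> elts (far L s) \<rightarrow>\<^sub>E univ (M j)" "y = fint (M j) s x" by blast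
      obtain k where k: "(i, k) \<in> r" "(j, k) \<in> r" using pair[OF i j(1)] by blast
      have "fint (M i) s x = fint (M k) s x" using sub[OF k(1)] s x by (simp add: substruc_def)
      moreover have "fint (M j) s x = fint (M k) s x" using sub[OF k(2)] s j(2) by (simp add: substruc_def)
      ultimately show "y = fint (M i) s x" using j(3) by simp
    qed
    finally show ?thesis .
  qed
  have R: "x \<in> rint ?U s \<longleftrightarrow> x \<in> rint (M i) s" if s: "s \<in> rsyms L" and i: "i \<in> I" and x: "x \<in> elts (rar L s) \<rightarrow>\<^sub>E univ (M i)" for s i x
  proof -
    have "x \<in> rint (M i) s" if j: "j \<in> I" and xj: "x \<in> rint (M j) s" for j
    proof -
      obtain k where k: "(i, k) \<in> r" "(j, k) \<in> r" using pair[OF i j] by blast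
      have "x \<in> elts (rar L s) \<rightarrow>\<^sub>E univ (M j)" using is_struc_rint[OF M[OF j] s] xj by blast
      then have "x \<in> rint (M k) s" using sub[OF k(2)] s xj by (simp add: substruc_def)
      then show ?thesis using sub[OF k(1)] s x by (simp add: substruc_def)
    qed
    then show ?thesis using s i by (auto simp: union_struc_def)
  qed
  show U: "is_struc L ?U"
    unfolding is_struc_def
  proof (intro conjI)
    show "small (univ ?U)" unfolding uV using M by (intro small_UN I) (simp add: is_struc_def)
    obtain i where "i \<in> I" using bd[of "{}"] finite_lesspoll_infinite[OF \<mu>(2), of "{}"] by auto
    then show "univ ?U \<noteq> {}" unfolding uV using M by (auto simp: is_struc_def)
    show "fint ?U \<in> (\<Pi>\<^sub>E s \<in> fsyms L. (elts (far L s) \<rightarrow>\<^sub>E univ ?U) \<rightarrow>\<^sub>E univ ?U)"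
    proof (rule PiE_I, rule PiE_I)
      fix s x assume s: "s \<in> fsyms L" and x: "x \<in> elts (far L s) \<rightarrow>\<^sub>E univ ?U"
      obtain i where i: "i \<in> I" "x \<in> elts (far L s) \<rightarrow>\<^sub>E univ (M i)" using tup[OF fl[OF s], of x] x unfolding uV by blast
      then show "fint ?U s x \<in> univ ?U" 
        using F[OF s i] is_struc_fint[OF M[OF i(1)] s i(2)] unfolding uV by auto
    qed (auto simp: union_struc_def)
    show "rint ?U \<in> (\<Pi>\<^sub>E s \<in> rsyms L. Pow (elts (rar L s) \<rightarrow>\<^sub>E univ ?U))"
    proof (rule PiE_I)
      fix s assume s: "s \<in> rsyms L"
      have "rint (M i) s \<subseteq> elts (rar L s) \<rightarrow>\<^sub>E ?V" if "i \<in> I" for i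
      proof
        fix x assume "x \<in> rint (M i) s"
        then have "x \<in> elts (rar L s) \<rightarrow>\<^sub>E univ (M i)" using is_struc_rint[OF M[OF that] s] by blast
        then show "x \<in> elts (rar L s) \<rightarrow>\<^sub>E ?V" by (rule PiE_range_mono[OF sV[OF that]])
      qed
      then show "rint ?U s \<in> Pow (elts (rar L s) \<rightarrow>\<^sub>E univ ?U)"
        unfolding uV using s by (auto simp: union_struc_def)
    qed (auto simp: union_struc_def)
  qed
  show "substruc L (M i) ?U" if i: "i \<in> I" for i
    unfolding substruc_def
  proof (intro conjI ballI U M[OF i])
    show "univ (M i) \<subseteq> univ ?U" using sV[OF i] by (simp add: uV)
  qed (simp_all only: F[OF _ i] R[OF _ i])
  show "substruc L ?U N" if N: "is_struc L N" "\<And>i. i \<in> I \<Longrightarrow> substruc L (M i) N"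
    unfolding substruc_def
  proof (intro conjI ballI U N(1))
    show "univ ?U \<subseteq> univ N" using N(2) unfolding uV substruc_def by blast
    fix s x assume s: "s \<in> fsyms L" and x: "x \<in> elts (far L s) \<rightarrow>\<^sub>E univ ?U"
    obtain i where i: "i \<in> I" "x \<in> elts (far L s) \<rightarrow>\<^sub>E univ (M i)" using tup[OF fl[OF s], of x] x unfolding uV by blast
    then show "fint ?U s x = fint N s x" using F[OF s i] N(2)[OF i(1)] s by (simp add: substruc_def)
  next
    fix s x assume s: "s \<in> rsyms L" and x: "x \<in> elts (rar L s) \<rightarrow>\<^sub>E univ ?U"
    obtain i where i: "i \<in> I" "x \<in> elts (rar L s) \<rightarrow>\<^sub>E univ (M i)" using tup[OF rl[OF s], of x] x unfolding uV by blast
    then show "x \<in> rint ?U s \<longleftrightarrow> x \<in> rint N s" using R[OF s i] N(2)[OF i(1)] s by (simp add: substruc_def)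
  qed
qed

lemma substruc_iso:
  assumes MN: "substruc L M N" and N: "struc_iso L f N N'" and M: "struc_iso L f M M'"
  shows "substruc L M' N'"
proof -
  have sub: "univ M \<subseteq> univ N" using MN by (simp add: substruc_def)
  note T = PiE_range_mono[OF sub]
  note m = struc_isoD[OF M] and n = struc_isoD[OF N]
  show ?thesis
    unfolding substruc_def
  proof (intro conjI ballI m(2) n(2))
    show "univ M' \<subseteq> univ N'" using sub m(4) n(4) by blast
    fix s y assume s: "s \<in> fsyms L" and y: "y \<in> elts (far L s) \<rightarrow>\<^sub>E univ M'"
    obtain x where x: "x \<in> elts (far L s) \<rightarrow>\<^sub>E univ M" "y = compose (elts (far L s)) f x"
      using y unfolding m(4)[symmetric] by (rule PiE_image_compose)
    show "fint M' s y = fint N' s y"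
      unfolding x(2) m(5)[OF s x(1), symmetric] n(5)[OF s T[OF x(1)], symmetric] 
      using MN s x(1) by (simp add: substruc_def)
  next
    fix s y assume s: "s \<in> rsyms L" and y: "y \<in> elts (rar L s) \<rightarrow>\<^sub>E univ M'"
    obtain x where x: "x \<in> elts (rar L s) \<rightarrow>\<^sub>E univ M" "y = compose (elts (rar L s)) f x"
      using y unfolding m(4)[symmetric] by (rule PiE_image_compose)
    show "y \<in> rint M' s \<longleftrightarrow> y \<in> rint N' s"
      unfolding x(2) m(6)[OF s x(1), symmetric] n(6)[OF s T[OF x(1)], symmetric] 
      using MN s x(1) by (simp add: substruc_def)
  qed
qed

section \<open>A class of torsors\<close>

text \<open>\<open>QQ\<close> marks an index whose fibre must be nonempty, \<open>SS\<close> relates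
  base point, index and fibre, \<open>ZZ\<close> marks one parity, and \<open>RR \<pi>\<close>
  relates a point to its push-forward along \<pi>. All are interpreted as ternary relations, which
  spares a case distinction on arities.\<close>

datatype 'v rsym = QQ | SS | ZZ | RR "'v \<Rightarrow> 'v"

definition single :: "'v::zfc_universe \<Rightarrow> 'v \<Rightarrow> 'v" where
  "single a = (\<lambda>i \<in> elts (ordn (Suc 0)). a)"

definition triple :: "'v::zfc_universe \<Rightarrow> 'v \<Rightarrow> 'v \<Rightarrow> 'v \<Rightarrow> 'v" where
  "triple a b c = (\<lambda>i \<in> elts (ordn 3). if i = ordn 0 then a else if i = ordn (Suc 0) then b else c)"

lemma elts_ordn_1: "elts (ordn (Suc 0)) = {ordn 0}"
  by (simp add: elts_ordn lessThan_Suc)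

lemma elts_ordn_3: "elts (ordn 3) = {ordn 0, ordn (Suc 0), ordn 2}"
  by (auto simp: elts_ordn lessThan_Suc numeral_3_eq_3 numeral_2_eq_2)

lemma single_PiE: "x \<in> elts (ordn (Suc 0)) \<rightarrow>\<^sub>E U \<longleftrightarrow> (\<exists>a \<in> U. x = single a)"
  by (auto simp: single_def elts_ordn_1 PiE_iff fun_eq_iff extensional_def)

lemma triple_PiE: "x \<in> elts (ordn 3) \<rightarrow>\<^sub>E U \<longleftrightarrow> (\<exists>a \<in> U. \<exists>b \<in> U. \<exists>c \<in> U. x = triple a b c)"
proof
  assume x: "x \<in> elts (ordn 3) \<rightarrow>\<^sub>E U"
  then have "x i = triple (x (ordn 0)) (x (ordn (Suc 0))) (x (ordn 2)) i" for i
    by (cases "i \<in> elts (ordn 3)") (auto simp: triple_def elts_ordn_3 PiE_iff extensional_def)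
  then have "x = triple (x (ordn 0)) (x (ordn (Suc 0))) (x (ordn 2))" ..
  then show "\<exists>a \<in> U. \<exists>b \<in> U. \<exists>c \<in> U. x = triple a b c"
    using x by (auto simp: elts_ordn_3 PiE_iff)
qed (auto simp: triple_def restrict_PiE_iff simp del: PiE_iff)

lemma single_in: "a \<in> U \<Longrightarrow> single a \<in> elts (ordn (Suc 0)) \<rightarrow>\<^sub>E U"
  unfolding single_PiE by blast

lemma ball_single: "(\<forall>x \<in> elts (ordn (Suc 0)) \<rightarrow>\<^sub>E U. P x) \<longleftrightarrow> (\<forall>a \<in> U. P (single a))"
  using single_PiE by metis

lemma ball_triple: "(\<forall>x \<in> elts (ordn 3) \<rightarrow>\<^sub>E U. P x) \<longleftrightarrow> (\<forall>a \<in> U. \<forall>b \<in> U. \<forall>c \<in> U. P (triple a b c))"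
  using triple_PiE by metis

lemma compose_single: "compose (elts (ordn (Suc 0))) f (single a) = single (f a)"
  by (auto simp: compose_def single_def)

lemma compose_triple: "compose (elts (ordn 3)) f (triple a b c) = triple (f a) (f b) (f c)"
  by (auto simp: compose_def triple_def fun_eq_iff)

lemma single_apply [simp]: "single a (ordn 0) = a"
  by (simp add: single_def elts_ordn_1)

lemma triple_apply [simp]: "triple a b c (ordn 0) = a" "triple a b c (ordn (Suc 0)) = b" "triple a b c (ordn 2) = c"
  by (simp_all add: triple_def elts_ordn_3)

text \<open>\<open>T\<close> has two roles: its elements are the unary function symbols, meant as
  the generators of the group of finite subsets of \<open>T\<close>, and in the models built later
  they are also the values of the functions that serve as indices.\<close>

locale torsor_class =
  fixes T :: "'v::zfc_universe set" and renc :: "'v rsym \<Rightarrow> 'v" and RS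
  defines "RS \<equiv> {QQ, SS, ZZ} \<union> RR ` (T \<rightarrow>\<^sub>E T)"
  assumes small_T: "small T" and renc: "inj_on renc RS" "small (renc ` RS)"
begin

definition TL :: "'v language" where
  "TL = \<lparr>fsyms = T, rsyms = renc ` RS, far = (\<lambda>_. ordn (Suc 0)), rar = (\<lambda>_. ordn 3)\<rparr>"

definition fn :: "'v struc \<Rightarrow> 'v \<Rightarrow> 'v \<Rightarrow> 'v" where
  "fn M t a = fint M t (single a)"

definition rl :: "'v struc \<Rightarrow> 'v rsym \<Rightarrow> 'v \<Rightarrow> 'v \<Rightarrow> 'v \<Rightarrow> bool" where
  "rl M r a b c \<longleftrightarrow> triple a b c \<in> rint M (renc r)"

lemma mu_ary_TL: "mu_ary omega TL"
  using small_T renc(2) by (simp add: mu_ary_def TL_def elts_omega)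

lemma TL_sel [simp]: "fsyms TL = T" "rsyms TL = renc ` RS" "far TL s = ordn (Suc 0)" "rar TL s = ordn 3"
  by (simp_all add: TL_def)

lemma fn_in: "is_struc TL M \<Longrightarrow> t \<in> T \<Longrightarrow> a \<in> univ M \<Longrightarrow> fn M t a \<in> univ M"
  using is_struc_fint[of TL M t "single a"] by (simp add: fn_def single_in)

lemma substrucD:
  assumes "substruc TL M N"
  shows "is_struc TL M" "is_struc TL N" "univ M \<subseteq> univ N"
    "t \<in> T \<Longrightarrow> a \<in> univ M \<Longrightarrow> fn M t a = fn N t a"
    "r \<in> RS \<Longrightarrow> a \<in> univ M \<Longrightarrow> b \<in> univ M \<Longrightarrow> c \<in> univ M \<Longrightarrow> rl M r a b c \<longleftrightarrow> rl N r a b c"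
  using assms unfolding substruc_def fn_def rl_def by (simp_all add: ball_single ball_triple)

lemma substrucI:
  assumes "is_struc TL M" "is_struc TL N" "univ M \<subseteq> univ N"
    "\<And>t a. t \<in> T \<Longrightarrow> a \<in> univ M \<Longrightarrow> fn M t a = fn N t a"
    "\<And>r a b c. r \<in> RS \<Longrightarrow> a \<in> univ M \<Longrightarrow> b \<in> univ M \<Longrightarrow> c \<in> univ M \<Longrightarrow> rl M r a b c \<longleftrightarrow> rl N r a b c"
  shows "substruc TL M N"
  using assms unfolding substruc_def fn_def rl_def by (simp_all add: ball_single ball_triple)

lemma struc_iso_TL:
  "struc_iso TL f M N \<longleftrightarrow> is_struc TL M \<and> is_struc TL N \<and> bij_betw f (univ M) (univ N) \<and>
    (\<forall>t \<in> T. \<forall>a \<in> univ M. f (fn M t a) = fn N t (f a)) \<and>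
    (\<forall>r \<in> RS. \<forall>a \<in> univ M. \<forall>b \<in> univ M. \<forall>c \<in> univ M. rl M r a b c \<longleftrightarrow> rl N r (f a) (f b) (f c))"
  unfolding struc_iso_def fn_def rl_def
  by (simp add: ball_single ball_triple compose_single compose_triple)

text \<open>To lie in one orbit under finite compositions is an infinitary condition, but each
  instance of it involves finitely many elements, so it passes to directed unions and to
  substructures. It is imposed so that a point of a fibre of a larger model can be reached from a
  smaller one (\<open>section_of_E_at\<close>).\<close>

definition torsors :: "'v struc set" where
  "torsors = {M. is_struc TL M \<and>
     (\<forall>a \<in> univ M. \<forall>g \<in> univ M. rl M QQ a g g \<longrightarrow> (\<exists>w \<in> univ M. rl M SS a g w)) \<and>
     (\<forall>a \<in> univ M. \<forall>g \<in> univ M. \<forall>w \<in> univ M. \<forall>w' \<in> univ M. rl M SS a g w \<and> rl M SS a g w' \<longrightarrow>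
       (\<exists>ts \<in> lists T. w' = fold (fn M) ts w))}"

definition TK :: "'v absclass" where
  "TK = \<lparr>lang = TL, models = torsors, leK = (\<lambda>M N. M \<in> torsors \<and> N \<in> torsors \<and> substruc TL M N)\<rparr>"

lemma TK_sel [simp]: "lang TK = TL" "models TK = torsors" 
    "leK TK M N \<longleftrightarrow> M \<in> torsors \<and> N \<in> torsors \<and> substruc TL M N"
  by (simp_all add: TK_def)

lemma RS_in: "QQ \<in> RS" "SS \<in> RS" "ZZ \<in> RS" "\<pi> \<in> T \<rightarrow>\<^sub>E T \<Longrightarrow> RR \<pi> \<in> RS"
  by (auto simp: RS_def)

lemma fold_fn_in: "is_struc TL M \<Longrightarrow> ts \<in> lists T \<Longrightarrow> w \<in> univ M \<Longrightarrow> fold (fn M) ts w \<in> univ M"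
  by (induction ts arbitrary: w) (auto simp: fn_in)

lemma fold_fn_substruc:
  assumes "substruc TL M N" "ts \<in> lists T" "w \<in> univ M" shows "fold (fn M) ts w = fold (fn N) ts w"
  using assms(2,3)
  by (induction ts arbitrary: w) (auto simp: substrucD(4)[OF assms(1), symmetric] fn_in[OF substrucD(1)[OF assms(1)]])

lemma fold_fn_iso:
  assumes "struc_iso TL f M N" "ts \<in> lists T" "w \<in> univ M" shows "f (fold (fn M) ts w) = fold (fn N) ts (f w)"
  using assms(2,3)
proof (induction ts arbitrary: w)
  case (Cons t ts)
  then have "fn M t w \<in> univ M" using fn_in assms(1) by (simp add: struc_iso_TL)
  then show ?case using Cons assms(1) by (simp add: struc_iso_TL)
qed simp

lemma torsors_struc: "M \<in> torsors \<Longrightarrow> is_struc TL M"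
  by (simp add: torsors_def)

lemma torsors_fibre: "M \<in> torsors \<Longrightarrow> a \<in> univ M \<Longrightarrow> g \<in> univ M \<Longrightarrow> rl M QQ a g g \<Longrightarrow> \<exists>w \<in> univ M. rl M SS a g w"
  by (simp add: torsors_def)

lemma torsors_transitive: 
  "M \<in> torsors \<Longrightarrow> a \<in> univ M \<Longrightarrow> g \<in> univ M \<Longrightarrow> w \<in> univ M \<Longrightarrow> w' \<in> univ M \<Longrightarrow> 
    rl M SS a g w \<Longrightarrow> rl M SS a g w' \<Longrightarrow> \<exists>ts \<in> lists T. w' = fold (fn M) ts w"
  unfolding torsors_def by blast

lemma torsors_iso:
  assumes M: "M \<in> torsors" and f: "struc_iso TL f M N" shows "N \<in> torsors"
proof -
  have im: "f ` univ M = univ N" and N: "is_struc TL N" using struc_isoD(2,4)[OF f] by auto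
  have pre: "\<exists>v \<in> univ M. u = f v" if "u \<in> univ N" for u using that im by blast
  have R: "\<And>r a b c. r \<in> RS \<Longrightarrow> a \<in> univ M \<Longrightarrow> b \<in> univ M \<Longrightarrow> c \<in> univ M \<Longrightarrow> rl N r (f a) (f b) (f c) \<longleftrightarrow> rl M r a b c"
    using f by (simp add: struc_iso_TL)
  have "\<exists>w \<in> univ N. rl N SS a g w" if ag: "a \<in> univ N" "g \<in> univ N" "rl N QQ a g g" for a g
  proof -
    obtain a' g' where "a = f a'" "g = f g'" "a' \<in> univ M" "g' \<in> univ M" using ag(1,2) im by blast
    then show ?thesis using ag(3) R RS_in torsors_fibre[OF M, of a' g'] im by blast
  qed
  moreover have "\<exists>ts \<in> lists T. w' = fold (fn N) ts w" 
    if ag: "a \<in> univ N" "g \<in> univ N" "w \<in> univ N" "w' \<in> univ N" "rl N SS a g w" "rl N SS a g w'" for a g w w'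
  proof -
    obtain b h v v' where b: "a = f b" "g = f h" "w = f v" "w' = f v'" "b \<in> univ M" "h \<in> univ M" "v \<in> univ M" "v' \<in> univ M"
      using pre[OF ag(1)] pre[OF ag(2)] pre[OF ag(3)] pre[OF ag(4)] by metis
    then have "rl M SS b h v" "rl M SS b h v'" using ag(5,6) R RS_in by blast+
    then obtain ts where "ts \<in> lists T" "v' = fold (fn M) ts v" using torsors_transitive[OF M b(5-8)] by blast
    then show ?thesis using fold_fn_iso[OF f _ b(7)] b(3,4) by blast
  qed
  ultimately show ?thesis using N by (auto simp: torsors_def)
qed

text \<open>The witnesses \<open>ts\<close> for transitivity evaluate to the same point in the
  substructure, so only the nonemptiness of fibres has to be checked.\<close>

lemma torsors_substruc:
  assumes M: "substruc TL M N" and N: "N \<in> torsors"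
    and fib: "\<And>a g. a \<in> univ M \<Longrightarrow> g \<in> univ M \<Longrightarrow> rl N QQ a g g \<Longrightarrow> \<exists>w \<in> univ M. rl N SS a g w"
  shows "M \<in> torsors"
proof -
  note D = substrucD[OF M]
  have "\<exists>w \<in> univ M. rl M SS a g w" if "a \<in> univ M" "g \<in> univ M" "rl M QQ a g g" for a g
    using fib[OF that(1,2)] that D(5) RS_in by blast
  moreover have "\<exists>ts \<in> lists T. w' = fold (fn M) ts w" 
    if "a \<in> univ M" "g \<in> univ M" "w \<in> univ M" "w' \<in> univ M" "rl M SS a g w" "rl M SS a g w'" for a g w w'
    using torsors_transitive[OF N, of a g w w'] that D(3,5) RS_in fold_fn_substruc[OF M _ that(3)] by (metis subsetD)
  ultimately show ?thesis using D(1) by (auto simp: torsors_def)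
qed

lemma mu_abstract_class_TK: "mu_abstract_class omega TK"
  unfolding mu_abstract_class_def
proof (intro conjI allI ballI impI)
  show "mu_ary omega (lang TK)" by (simp add: mu_ary_TL)
  show "is_struc (lang TK) M" if "M \<in> models TK" for M using that by (simp add: torsors_struc)
  show "M \<in> models TK" "N \<in> models TK" "substruc (lang TK) M N" if "leK TK M N" for M N using that by simp_all
  show "leK TK M M" if "M \<in> models TK" for M using that by (simp add: torsors_struc substruc_refl)
  show "leK TK M P" if "leK TK M N \<and> leK TK N P" for M N P
    using that substruc_trans[of TL M N P] by simp
  show "N \<in> models TK" if "M \<in> models TK \<and> struc_iso (lang TK) f M N" for M N f
    using that torsors_iso[of M f N] by simp
  show "leK TK M' N'" if "leK TK M N \<and> struc_iso (lang TK) f N N' \<and> struc_iso (lang TK) f M M'" for M N M' N' f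
    using that torsors_iso[of M f M'] torsors_iso[of N f N'] substruc_iso[of TL M N f N' M'] by simp
qed

lemma tarski_vaught_TK: "tarski_vaught omega TK"
  unfolding tarski_vaught_def TK_sel
proof (intro allI impI; elim conjE)
  fix I r and M :: "'v \<Rightarrow> 'v struc"
  assume I: "small I" and dir: "mu_directed omega I r" and M: "\<forall>i\<in>I. M i \<in> torsors"
    and le: "\<forall>i j. (i, j) \<in> r \<longrightarrow> M i \<in> torsors \<and> M j \<in> torsors \<and> substruc TL (M i) (M j)"
  let ?U = "union_struc TL I M"
  have MS: "\<And>i. i \<in> I \<Longrightarrow> is_struc TL (M i)" and sub: "\<And>i j. (i, j) \<in> r \<Longrightarrow> substruc TL (M i) (M j)"
    using M le torsors_struc by auto
  have U: "is_struc TL ?U"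
    by (rule is_struc_union[where M = M, OF dir Card_omega infinite_omega mu_ary_TL I MS sub])
  have MU: "substruc TL (M i) ?U" if "i \<in> I" for i
    by (rule substruc_union[where M = M, OF dir Card_omega infinite_omega mu_ary_TL I MS sub that])
  have UN: "substruc TL ?U N" if "is_struc TL N" "\<And>i. i \<in> I \<Longrightarrow> substruc TL (M i) N" for N
    by (rule union_substruc[where M = M, OF dir Card_omega infinite_omega mu_ary_TL I MS sub that])
  have bd: "\<exists>i\<in>I. J \<subseteq> univ (M i)" if "finite J" "J \<subseteq> (\<Union>i\<in>I. univ (M i))" for J
    by (rule union_bound[where M = M, OF dir Card_omega infinite_omega mu_ary_TL I MS sub that])
  have uU: "univ ?U = (\<Union>i\<in>I. univ (M i))" by (simp add: union_struc_def)
  have "?U \<in> torsors"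
    unfolding torsors_def
  proof (intro CollectI conjI ballI impI)
    show "is_struc TL ?U" by (rule U)
    fix a g assume ag: "a \<in> univ ?U" "g \<in> univ ?U" "rl ?U QQ a g g"
    obtain i where i: "i \<in> I" "a \<in> univ (M i)" "g \<in> univ (M i)" using bd[where J = "{a, g}"] ag(1,2) unfolding uU by auto
    then obtain w where w: "w \<in> univ (M i)" "rl (M i) SS a g w"
      using torsors_fibre[of "M i" a g] M substrucD(5)[OF MU[OF i(1)] RS_in(1)] ag(3) by blast
    then show "\<exists>w\<in>univ ?U. rl ?U SS a g w"
      using substrucD(3,5)[OF MU[OF i(1)]] RS_in(2) i by blast
  next
    fix a g w w' assume ag: "a \<in> univ ?U" "g \<in> univ ?U" "w \<in> univ ?U" "w' \<in> univ ?U" "rl ?U SS a g w \<and> rl ?U SS a g w'"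
    obtain i where i: "i \<in> I" "a \<in> univ (M i)" "g \<in> univ (M i)" "w \<in> univ (M i)" "w' \<in> univ (M i)" 
      using bd[where J = "{a, g, w, w'}"] ag(1-4) unfolding uU by auto
    then have "rl (M i) SS a g w" "rl (M i) SS a g w'"
      using substrucD(5)[OF MU[OF i(1)]] RS_in(2) ag(5) by blast+
    then obtain ts where "ts \<in> lists T" "w' = fold (fn (M i)) ts w"
      using torsors_transitive[of "M i" a g w w'] M i by blast
    then show "\<exists>ts\<in>lists T. w' = fold (fn ?U) ts w"
      using fold_fn_substruc[OF MU[OF i(1)] _ i(4)] by blast
  qed
  then show "?U \<in> torsors \<and> (\<forall>j\<in>I. M j \<in> torsors \<and> ?U \<in> torsors \<and> substruc TL (M j) ?U) \<and>
      (\<forall>N\<in>torsors. (\<forall>i\<in>I. M i \<in> torsors \<and> N \<in> torsors \<and> substruc TL (M i) N) \<longrightarrow>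
        ?U \<in> torsors \<and> N \<in> torsors \<and> substruc TL ?U N)"
    using M MU UN torsors_struc by blast
qed

text \<open>Closure in \<omega> stages under the function symbols and a Skolem function for fibres;
  no stage exceeds the size of \<open>C\<close>.\<close>

lemma torsors_hull:
  assumes M: "M \<in> torsors" and A: "A \<subseteq> univ M" and C: "infinite C" "A \<lesssim> C" "T \<lesssim> C"
  shows "\<exists>N \<in> torsors. substruc TL N M \<and> A \<subseteq> univ N \<and> univ N \<lesssim> C"
proof -
  have MS: "is_struc TL M" using M by (rule torsors_struc)
  \<comment> \<open>The default value \<open>a\<close> makes the Skolem function total without
    leaving the model.\<close>
  define w where "w a g = (if \<exists>w \<in> univ M. rl M SS a g w then SOME w. w \<in> univ M \<and> rl M SS a g w else a)" for a g
  have w: "w a g \<in> univ M \<and> rl M SS a g (w a g)" if "\<exists>w \<in> univ M. rl M SS a g w" for a g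
    unfolding w_def if_P[OF that] by (rule someI_ex) (use that in blast)
  have w_in: "w a g \<in> univ M" if "a \<in> univ M" for a g
  proof (cases "\<exists>w \<in> univ M. rl M SS a g w")
    case False
    then have "w a g = a" unfolding w_def by (rule if_not_P)
    then show ?thesis using that by simp
  next
    case True
    from w[OF this] show ?thesis by simp
  qed
  obtain u where u: "u \<in> univ M" using MS by (auto simp: is_struc_def)
  define B where "B = rec_nat (insert u A) (\<lambda>_ D. D \<union> (\<Union>t\<in>T. fn M t ` D) \<union> (\<lambda>(a, g). w a g) ` (D \<times> D))"
  have B0: "B 0 = insert u A" and BS: "B (Suc n) = B n \<union> (\<Union>t\<in>T. fn M t ` B n) \<union> (\<lambda>(a, g). w a g) ` (B n \<times> B n)" for n
    by (simp_all add: B_def)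
  have BM: "B n \<subseteq> univ M" for n
  proof (induction n)
    case (Suc n)
    have "fn M t ` B n \<subseteq> univ M" if "t \<in> T" for t using Suc fn_in[OF MS that] by blast
    moreover have "w a g \<in> univ M" if "a \<in> B n" for a g using w_in Suc that by blast
    ultimately show ?case unfolding BS using Suc by (intro Un_least UN_least image_subsetI) auto
  qed (use A u in \<open>simp add: B0\<close>)
  have BC: "B n \<lesssim> C" for n
  proof (induction n)
    case 0
    have "{u} \<union> A \<lesssim> C" by (intro infinite_Un_lepoll C finite_lepoll_infinite) simp
    then show ?case by (simp add: B0)
  next
    case (Suc n)
    have "B n \<times> B n \<lesssim> C" by (rule infinite_Times_lepoll[OF C(1) Suc Suc])
    then show ?case unfolding BS
      by (intro infinite_Un_lepoll infinite_UN_lepoll C Suc lepoll_trans[OF image_lepoll])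
  qed
  have mono: "m \<le> n \<Longrightarrow> B m \<subseteq> B n" for m n by (rule lift_Suc_mono_le[of B]) (simp_all add: BS Un_assoc)
  define D where "D = (\<Union>n. B n)"
  have DM: "D \<subseteq> univ M" and AD: "A \<subseteq> D" "u \<in> D" using BM B0 by (auto simp: D_def)
  have DC: "D \<lesssim> C" unfolding D_def
    by (rule infinite_UN_lepoll[OF C(1)]) (use C(1) BC in \<open>auto simp: infinite_le_lepoll\<close>)
  have cl: "closed_in TL M D"
    unfolding closed_in_def TL_sel ball_single
  proof (intro conjI ballI DM)
    fix t a assume "t \<in> T" "a \<in> D"
    then obtain n where "a \<in> B n" by (auto simp: D_def)
    then have "fn M t a \<in> B (Suc n)" using \<open>t \<in> T\<close> unfolding BS by blast
    then show "fint M t (single a) \<in> D" unfolding D_def fn_def by blast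
  next
    show "D \<noteq> {}" using AD(2) by blast
  qed
  have sub: "substruc TL (restr_struc TL M D) M" by (rule substruc_restr[OF MS cl])
  have "restr_struc TL M D \<in> torsors"
  proof (rule torsors_substruc[OF sub M], unfold univ_restr)
    fix a g assume "a \<in> D" "g \<in> D" and Q: "rl M QQ a g g"
    then obtain m n where "a \<in> B m" "g \<in> B n" unfolding D_def by blast
    then have ag: "a \<in> B (max m n)" "g \<in> B (max m n)" using mono[of m "max m n"] mono[of n "max m n"] by auto
    then have "w a g \<in> D" unfolding D_def using BS[of "max m n"] by blast
    moreover have "\<exists>w \<in> univ M. rl M SS a g w" using torsors_fibre[OF M _ _ Q] ag BM by blast
    ultimately show "\<exists>w\<in>D. rl M SS a g w" using w by blast
  qed
  then show ?thesis using sub AD(1) DC by (intro bexI[of _ "restr_struc TL M D"]) simp_all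
qed

lemma lowenheim_skolem_tarski_TK: "lowenheim_skolem_tarski omega TK"
proof -
  let ?S = "(T <+> renc ` RS) <+> elts (omega :: 'v)"
  have "setlike TYPE('v) ?S"
    using small_T renc(2) by (intro setlike_Plus) (simp_all add: setlike_small)
  then obtain l :: 'v where l: "Card l" "elts l \<approx> ?S" by (rule ex_Card_eqpoll)
  have Sl: "?S \<lesssim> elts l" using eqpoll_imp_lepoll[OF eqpoll_sym[OF l(2)]] .
  have "elts (omega :: 'v) \<lesssim> elts l" by (rule lepoll_trans[OF lepoll_Plus2 Sl])
  then have inf: "infinite (elts l)" using infinite_omega infinite_le_lepoll lepoll_trans by blast
  have Tl: "T \<lesssim> elts l" by (rule lepoll_trans[OF lepoll_trans[OF lepoll_Plus1 lepoll_Plus1] Sl])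
  have "\<exists>N. leK TK N M \<and> A \<subseteq> univ N \<and> univ N \<lesssim> seqs_lt omega A <+> elts l" 
    if M: "M \<in> torsors" "A \<subseteq> univ M" for M A
  proof -
    let ?C = "seqs_lt (omega :: 'v) A <+> elts l"
    have C: "infinite ?C" using inf by (simp add: finite_Plus_iff)
    have "A \<lesssim> ?C" "T \<lesssim> ?C" 
      using lepoll_trans[OF lepoll_seqs_lt_omega lepoll_Plus1] lepoll_trans[OF Tl lepoll_Plus2] by blast+
    then show ?thesis using torsors_hull[OF M C] M(1) by auto
  qed
  then show ?thesis
    unfolding lowenheim_skolem_tarski_def using l(1) seqs_lt_omega_eqpoll[OF inf] Sl by (intro exI[of _ l]) simp
qed

theorem aec_TK: "mu_aec omega TK"
proof -
  have "coherence TK" unfolding coherence_def TK_sel by blast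
  then show ?thesis
    unfolding mu_aec_def
    by (intro conjI regular_omega mu_abstract_class_TK tarski_vaught_TK lowenheim_skolem_tarski_TK)
qed

end

section \<open>Ultrafilters from parity selectors\<close>

text \<open>On finite sets, regarded as vectors over the field with two elements, this is the linear
  map induced by \<pi>.\<close>

definition push :: "('a \<Rightarrow> 'b) \<Rightarrow> 'a set \<Rightarrow> 'b set" where
  "push \<pi> u = {j. odd (card {i \<in> u. \<pi> i = j})}"

lemma push_subset: "push \<pi> u \<subseteq> \<pi> ` u"
proof
  fix j assume "j \<in> push \<pi> u"
  then have "odd (card {i \<in> u. \<pi> i = j})" by (simp add: push_def)
  then have "{i \<in> u. \<pi> i = j} \<noteq> {}" by (metis card.empty even_zero)
  then show "j \<in> \<pi> ` u" by blast
qed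

lemma card_push_le: "finite u \<Longrightarrow> card (push \<pi> u) \<le> card u"
  by (rule order_trans[OF card_mono[OF _ push_subset] card_image_le]) simp_all

text \<open>Collisions under \<pi> cost elements, and even ones cancel; if the size does not drop,
  there are no collisions.\<close>

lemma push_inj_on:
  assumes "finite u" "card u \<le> card (push \<pi> u)" shows "inj_on \<pi> u" "\<pi> ` u = push \<pi> u"
proof -
  have "card (push \<pi> u) \<le> card (\<pi> ` u)" by (rule card_mono[OF _ push_subset]) (simp add: assms(1))
  moreover have "card (\<pi> ` u) \<le> card u" using assms(1) by (rule card_image_le)
  ultimately have c: "card (\<pi> ` u) = card u" "card (push \<pi> u) = card (\<pi> ` u)" using assms(2) by auto
  show "inj_on \<pi> u" using assms(1) c(1) by (rule eq_card_imp_inj_on)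
  show "\<pi> ` u = push \<pi> u" using card_subset_eq[OF _ push_subset c(2)] assms(1) by simp
qed

text \<open>Following a point yields a map \<open>val\<close> from functions to \<open>T\<close>
  that behaves like evaluation at an ideal point of \<open>X\<close>: it commutes with every \<pi>
  along equality modulo \<open>F\<close>. Such a map gives an ultrafilter, consisting of the sets
  whose indicator is evaluated to \<open>t1\<close>; a partition of \<open>X\<close> into pieces
  indexed by \<open>T\<close> has one piece in it, whence the completeness.\<close>

lemma ultrafilter_of_parity_selector:
  fixes X T :: "'v::zfc_universe set" and c :: "(nat \<Rightarrow> 'v) \<Rightarrow> 'v"
  assumes F: "filter_on_set X F"
    and c: "inj_on c {s. range s \<subseteq> T}" "\<And>s. range s \<subseteq> T \<Longrightarrow> c s \<in> T"
    and t01: "t0 \<in> T" "t1 \<in> T" "t0 \<noteq> t1"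
    and \<phi>: "\<And>f. f \<in> X \<rightarrow>\<^sub>E T \<Longrightarrow> finite (\<phi> f) \<and> \<phi> f \<subseteq> T \<and> odd (card (\<phi> f))"
    and \<phi>_push: "\<And>f f' \<pi>. f \<in> X \<rightarrow>\<^sub>E T \<Longrightarrow> f' \<in> X \<rightarrow>\<^sub>E T \<Longrightarrow> \<pi> \<in> T \<rightarrow>\<^sub>E T \<Longrightarrow>
      {x \<in> X. f' x = \<pi> (f x)} \<in> F \<Longrightarrow> \<phi> f' = push \<pi> (\<phi> f)"
  shows "\<exists>U. F \<subseteq> U \<and> ultrafilter_on_set X U \<and> (\<forall>S \<subseteq> U. S \<noteq> {} \<and> S \<lesssim> T \<longrightarrow> \<Inter>S \<in> U)"
proof -
  have XF: "X \<in> F" and FX: "F \<subseteq> Pow X" and Fup: "\<And>A B. A \<in> F \<Longrightarrow> A \<subseteq> B \<Longrightarrow> B \<subseteq> X \<Longrightarrow> B \<in> F"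
    using F unfolding filter_on_set_def by blast+
  let ?G = "X \<rightarrow>\<^sub>E T"
  \<comment> \<open>The n-th entry of the sequence with code \<open>t\<close>; on elements that code
    no sequence the value is \<open>t0\<close>.\<close>
  define P where "P n = (\<lambda>t\<in>T. if t \<in> c ` {s. range s \<subseteq> T} then inv_into {s. range s \<subseteq> T} c t n else t0)" for n
  have Pc: "P n (c s) = s n" if "range s \<subseteq> T" for s n
    using that c by (simp add: P_def)
  have PT: "P n \<in> T \<rightarrow>\<^sub>E T" for n
  proof (unfold P_def, rule restrict_PiE_iff[THEN iffD2], rule ballI)
    fix t assume "t \<in> T"
    show "(if t \<in> c ` {s. range s \<subseteq> T} then inv_into {s. range s \<subseteq> T} c t n else t0) \<in> T"
      using t01(1) by (auto simp: inv_into_f_f[OF c(1)] intro: subsetD[OF _ rangeI])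
  qed
  define J where "J fs = (\<lambda>x\<in>X. c (\<lambda>n. fs n x))" for fs
  have rng: "range (\<lambda>n. fs n x) \<subseteq> T" if "\<And>n. fs n \<in> ?G" "x \<in> X" for fs :: "nat \<Rightarrow> 'v \<Rightarrow> 'v" and x
    using PiE_mem[OF that(1) that(2)] by auto
  have JG: "J fs \<in> ?G" if "\<And>n. fs n \<in> ?G" for fs
    unfolding J_def using c(2)[OF rng[OF that]] by simp
  have PJ: "P n (J fs x) = fs n x" if "\<And>n. fs n \<in> ?G" "x \<in> X" for fs n x
    using Pc[OF rng[OF that]] that(2) by (simp add: J_def)
  have pushJ: "\<phi> (fs n) = push (P n) (\<phi> (J fs))" if "\<And>n. fs n \<in> ?G" for fs n
  proof (rule \<phi>_push[OF JG[OF that] that PT])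
    have "{x \<in> X. fs n x = P n (J fs x)} = X" using PJ[OF that] by auto
    then show "{x \<in> X. fs n x = P n (J fs x)} \<in> F" using XF by simp
  qed
  have fin: "finite (\<phi> f)" if "f \<in> ?G" for f using \<phi>[OF that] by blast
  \<comment> \<open>Otherwise one function would refine a sequence of functions with unbounded sizes
    of the selected sets, although a push-forward never increases the size.\<close>
  have "\<exists>b. \<forall>f. f \<in> ?G \<longrightarrow> card (\<phi> f) < b"
  proof (rule ccontr)
    assume "\<not> ?thesis"
    then have "\<forall>b. \<exists>f. f \<in> ?G \<and> b \<le> card (\<phi> f)" by (meson not_le)
    then obtain fs where fs: "\<And>b. fs b \<in> ?G \<and> b \<le> card (\<phi> (fs b))" by metis
    let ?n = "Suc (card (\<phi> (J fs)))"
    have fsG: "fs b \<in> ?G" for b using fs by blast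
    have "card (\<phi> (fs ?n)) \<le> card (\<phi> (J fs))"
      using pushJ[where fs = fs and n = ?n, OF fsG] card_push_le[OF fin[OF JG[OF fsG]]] by simp
    then show False using fs[of ?n] by simp
  qed
  then obtain b where b: "\<forall>f. f \<in> ?G \<longrightarrow> card (\<phi> f) < b" by blast
  have "(\<lambda>x\<in>X. t0) \<in> ?G" using t01(1) by simp
  from ex_has_greatest_nat[of "\<lambda>f. f \<in> ?G", OF this b]
  obtain f0 where f0: "f0 \<in> ?G" "\<And>f. f \<in> ?G \<Longrightarrow> card (\<phi> f) \<le> card (\<phi> f0)" by blast
  have "card (\<phi> f0) \<noteq> 0" using \<phi>[OF f0(1)] by (metis even_zero)
  then obtain i0 where i0: "i0 \<in> \<phi> f0" by (metis all_not_in_conv card.empty)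
  \<comment> \<open>The common refinement of \<open>f0\<close> and \<open>g\<close>. Maximality of
    \<open>f0\<close> makes \<open>P 0\<close> a bijection from the selected set of
    \<open>K g\<close> to that of \<open>f0\<close>, so \<open>i0\<close> has exactly one preimage
    there.\<close>
  define K where "K g = J (\<lambda>n. if n = 0 then f0 else g)" for g
  have KG: "K g \<in> ?G" if "g \<in> ?G" for g unfolding K_def using f0(1) that by (intro JG) simp
  have PK: "P 0 (K g x) = f0 x" "P (Suc n) (K g x) = g x" if "g \<in> ?G" "x \<in> X" for g x n
    unfolding K_def using PJ[of "\<lambda>n. if n = 0 then f0 else g", OF _ that(2)] f0(1) that(1) by simp_all
  have pushK: "\<phi> f0 = push (P 0) (\<phi> (K g))" if "g \<in> ?G" for g
    using pushJ[of "\<lambda>n. if n = 0 then f0 else g" 0] f0(1) that by (simp add: K_def)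
  have cardK: "card (\<phi> (K g)) \<le> card (\<phi> f0)" if "g \<in> ?G" for g using f0(2)[OF KG[OF that]] .
  have injK: "inj_on (P 0) (\<phi> (K g))" "P 0 ` \<phi> (K g) = \<phi> f0" if "g \<in> ?G" for g
    using push_inj_on[OF fin[OF KG[OF that]], of "P 0"] cardK[OF that] pushK[OF that] by simp_all
  define e where "e g = inv_into (\<phi> (K g)) (P 0) i0" for g
  have e: "e g \<in> \<phi> (K g)" "P 0 (e g) = i0" if "g \<in> ?G" for g
    using i0 injK(2)[OF that] unfolding e_def by (auto intro: inv_into_into f_inv_into_f)
  have e_unique: "u = e g" if "g \<in> ?G" "u \<in> \<phi> (K g)" "P 0 u = i0" for g u
    using inj_onD[OF injK(1)[OF that(1)], of u "e g"] e[OF that(1)] that by simp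
  define val where "val g = P 1 (e g)" for g
  have eT: "e g \<in> T" if "g \<in> ?G" for g using e(1)[OF that] \<phi>[OF KG[OF that]] by blast
  have valT: "val g \<in> T" if "g \<in> ?G" for g unfolding val_def using PiE_mem[OF PT eT[OF that]] .
  have val_push: "val h = \<pi> (val g)" if g: "g \<in> ?G" and h: "h \<in> ?G" and \<pi>: "\<pi> \<in> T \<rightarrow>\<^sub>E T" and ae: "{x \<in> X. h x = \<pi> (g x)} \<in> F" for g h \<pi>
  proof -
    \<comment> \<open>The lift of \<pi> to codes keeps entry 0 and replaces every later entry by the
      value of \<pi> at entry 1, so it takes \<open>K g\<close> to \<open>K h\<close> wherever
      \<open>h\<close> equals \<pi> after \<open>g\<close>. Keeping entry 0 makes it respect the
      fibres over \<open>i0\<close>.\<close>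
    define s where "s t = (\<lambda>n :: nat. if n = 0 then P 0 t else \<pi> (P 1 t))" for t
    have s: "range (s t) \<subseteq> T" if "t \<in> T" for t
      using PiE_mem[OF PT that, of 0] PiE_mem[OF \<pi> PiE_mem[OF PT that, of 1]] by (auto simp: s_def)
    define lift where "lift = (\<lambda>t\<in>T. c (s t))"
    have lift_T: "lift \<in> T \<rightarrow>\<^sub>E T" unfolding lift_def using c(2)[OF s] by simp
    have P_lift: "P 0 (lift t) = P 0 t" "P 1 (lift t) = \<pi> (P 1 t)" if "t \<in> T" for t
      unfolding lift_def using that Pc[OF s[OF that]] by (simp_all add: s_def)
    have eq: "K h x = lift (K g x)" if x: "x \<in> X" "h x = \<pi> (g x)" for x
    proof -
      have KT: "K g x \<in> T" using PiE_mem[OF KG[OF g] x(1)] .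
      have "s (K g x) = (\<lambda>n. (if n = 0 then f0 else h) x)"
        using PK[OF g x(1)] x(2) by (auto simp: s_def fun_eq_iff)
      then show ?thesis using KT x(1) by (simp add: lift_def K_def[of h] J_def)
    qed
    have "{x \<in> X. K h x = lift (K g x)} \<in> F" by (rule Fup[OF ae]) (use eq in auto)
    then have p: "\<phi> (K h) = push lift (\<phi> (K g))" by (rule \<phi>_push[OF KG[OF g] KG[OF h] lift_T])
    \<comment> \<open>The selected set of \<open>K h\<close> is no smaller than that of
      \<open>f0\<close>, which is maximal, so nothing is lost along the lift and its push-forward is
      a plain image.\<close>
    have "card (\<phi> (K g)) \<le> card (\<phi> (K h))"
      using cardK[OF g] card_push_le[OF fin[OF KG[OF h]], of "P 0"] pushK[OF h] by simp
    then have "lift ` \<phi> (K g) = \<phi> (K h)" using push_inj_on(2)[OF fin[OF KG[OF g]], of lift] p by simp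
    then have "lift (e g) = e h" using e[OF g] P_lift(1)[OF eT[OF g]] by (intro e_unique[OF h]) auto
    then show ?thesis using P_lift(2)[OF eT[OF g]] by (simp add: val_def)
  qed
  have val_comp: "val h = \<pi> (val g)" if "g \<in> ?G" "h \<in> ?G" "\<pi> \<in> T \<rightarrow>\<^sub>E T" "\<And>x. x \<in> X \<Longrightarrow> h x = \<pi> (g x)" for g h \<pi>
  proof -
    have "{x \<in> X. h x = \<pi> (g x)} = X" using that(4) by auto
    then show ?thesis using val_push[OF that(1-3)] XF by simp
  qed
  have valJ: "val (fs n) = P n (val (J fs))" if "\<And>n. fs n \<in> ?G" for fs n
    by (rule val_comp[OF JG[OF that] that PT]) (simp add: PJ[OF that])
  define ind where "ind Y = (\<lambda>x\<in>X. if x \<in> Y then t1 else t0)" for Y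
  have indG: "ind Y \<in> ?G" for Y using t01 by (simp add: ind_def)
  define U where "U = {Y. Y \<subseteq> X \<and> val (ind Y) = t1}"
  have key: "{x \<in> X. g x \<in> A} \<in> U \<longleftrightarrow> val g \<in> A" if g: "g \<in> ?G" for g A
  proof -
    let ?\<chi> = "\<lambda>t\<in>T. if t \<in> A then t1 else t0"
    have "val (ind {x \<in> X. g x \<in> A}) = ?\<chi> (val g)"
      by (rule val_comp[OF g indG]) (use t01 PiE_mem[OF g] in \<open>auto simp: ind_def\<close>)
    then show ?thesis using t01(3) valT[OF g] by (simp add: U_def)
  qed
  have emp: "{} \<notin> U" using key[OF indG, of "{}" "{}"] by simp
  have FU: "F \<subseteq> U"
  proof
    fix Y assume Y: "Y \<in> F"
    have "val (ind Y) = (\<lambda>t\<in>T. t1) (val (ind X))"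
    proof (rule val_push[OF indG indG])
      show "{x \<in> X. ind Y x = (\<lambda>t\<in>T. t1) (ind X x)} \<in> F"
        by (rule Fup[OF Y]) (use t01 Y FX in \<open>auto simp: ind_def\<close>)
    qed (rule restrict_PiE_iff[THEN iffD2], use t01 in blast)
    then show "Y \<in> U" using Y FX valT[OF indG] by (auto simp: U_def)
  qed
  have inter: "Z \<in> U" if Y: "Y \<in> U" "Y' \<in> U" and Z: "Y \<inter> Y' \<subseteq> Z" "Z \<subseteq> X" for Y Y' Z
  proof (rule ccontr)
    assume nZ: "Z \<notin> U"
    \<comment> \<open>The three indicators are packed into one function, so that a single value of
      \<open>val\<close> decides them together; no point of \<open>X\<close> realises the pattern
      \<open>?A\<close>.\<close>
    define fs where "fs n = (if n = 0 then ind Y else if n = 1 then ind Y' else ind Z)" for n :: nat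
    have fs: "fs n \<in> ?G" for n using indG by (simp add: fs_def)
    let ?A = "{t. P 0 t = t1 \<and> P 1 t = t1 \<and> P 2 t \<noteq> t1}"
    have "val (ind Y) = t1" "val (ind Y') = t1" "val (ind Z) \<noteq> t1" using Y nZ Z(2) by (auto simp: U_def)
    then have "val (J fs) \<in> ?A" using valJ[where fs = fs and n = 0, OF fs] valJ[where fs = fs and n = 1, OF fs] valJ[where fs = fs and n = 2, OF fs] by (simp add: fs_def)
    then have "{x \<in> X. J fs x \<in> ?A} \<in> U" using key[OF JG[where fs = fs, OF fs]] by blast
    moreover have "{x \<in> X. J fs x \<in> ?A} = {}" 
    proof -
      have False if "x \<in> X" "J fs x \<in> ?A" for x
        using that PJ[where fs = fs and n = 0, OF fs that(1)] PJ[where fs = fs and n = 1, OF fs that(1)] PJ[where fs = fs and n = 2, OF fs that(1)] Z(1) t01(3)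
        by (auto simp: fs_def ind_def split: if_splits)
      then show ?thesis by blast
    qed
    ultimately show False using emp by metis
  qed
  have compl: "X - Y \<in> U" if "Y \<subseteq> X" "Y \<notin> U" for Y
  proof -
    have "{x \<in> X. ind Y x \<in> T - {t1}} \<in> U"
      unfolding key[OF indG] using that valT[OF indG] by (simp add: U_def)
    moreover have "{x \<in> X. ind Y x \<in> T - {t1}} = X - Y" using t01 by (auto simp: ind_def)
    ultimately show ?thesis by simp
  qed
  have uf: "ultrafilter_on_set X U"
    unfolding ultrafilter_on_set_def filter_on_set_def
  proof (intro conjI ballI allI impI)
    show "U \<subseteq> Pow X" by (auto simp: U_def)
    show "X \<in> U" using FU XF by blast
    show "B \<in> U" if "A \<in> U" "A \<subseteq> B \<and> B \<subseteq> X" for A B using inter[OF that(1) that(1)] that(2) by simp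
    show "A \<inter> B \<in> U" if "A \<in> U" "B \<in> U" for A B using inter[OF that] that by (auto simp: U_def)
    show "A \<in> U \<or> X - A \<in> U" if "A \<subseteq> X" for A using compl[OF that] by blast
  qed (rule emp)
  have "\<Inter>S \<in> U" if S: "S \<subseteq> U" "S \<noteq> {}" "S \<lesssim> T" for S
  proof (rule ccontr)
    assume n: "\<Inter>S \<notin> U"
    have SX: "\<Inter>S \<subseteq> X" using S(1,2) by (auto simp: U_def)
    let ?W = "X - \<Inter>S"
    have W: "?W \<in> U" by (rule compl[OF SX n])
    obtain \<iota> where \<iota>: "inj_on \<iota> S" "\<iota> ` S \<subseteq> T" using S(3) unfolding lepoll_def by blast
    have "\<forall>x \<in> ?W. \<exists>Y. Y \<in> S \<and> x \<notin> Y" by blast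
    then obtain y where y: "\<And>x. x \<in> ?W \<Longrightarrow> y x \<in> S \<and> x \<notin> y x" by metis
    \<comment> \<open>On \<open>?W\<close> the function names a member of \<open>S\<close> that
      omits \<open>x\<close>; its value under \<open>val\<close> singles out one member, which would
      then be disjoint from a set of \<open>U\<close>.\<close>
    define g where "g = (\<lambda>x\<in>X. if x \<in> ?W then \<iota> (y x) else t0)"
    have "\<iota> (y x) \<in> T" if "x \<in> ?W" for x using y[OF that] \<iota>(2) by blast
    then have g: "g \<in> ?G" unfolding g_def restrict_PiE_iff using t01(1) by simp
    have "{x \<in> X. g x \<in> {val g}} \<in> U" using key[OF g, of "{val g}"] by blast
    then have A: "{x \<in> X. g x = val g} \<inter> ?W \<in> U" using inter[OF _ W] by auto
    then have "{x \<in> X. g x = val g} \<inter> ?W \<noteq> {}" using emp by metis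
    then obtain x0 where x0: "x0 \<in> ?W" "g x0 = val g" by blast
    then have j: "val g = \<iota> (y x0)" by (simp add: g_def)
    have "y x = y x0" if "x \<in> ?W" "g x = val g" for x
      using that j inj_onD[OF \<iota>(1)] y x0(1) by (simp add: g_def)
    then have "{x \<in> X. g x = val g} \<inter> ?W \<inter> y x0 \<subseteq> {}" using y by blast
    moreover have "y x0 \<in> U" using y x0(1) S(1) by blast
    ultimately have "{} \<in> U" using inter[OF A] by blast
    then show False using emp by blast
  qed
  with FU uf show ?thesis by blast
qed

section \<open>Ultrafilters from tameness\<close>

text \<open>Symmetric difference with a singleton, the action of a generator of the group of finite
  sets.\<close>

definition flip :: "'a \<Rightarrow> 'a set \<Rightarrow> 'a set" where
  "flip t u = (if t \<in> u then u - {t} else insert t u)"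

lemma flip_flip [simp]: "flip t (flip t u) = u"
  by (auto simp: flip_def)

lemma flip_eq_iff [simp]: "flip t u = flip t v \<longleftrightarrow> u = v"
  by (metis flip_flip)

lemma flip_commute: "flip s (flip t u) = flip t (flip s u)"
  by (auto simp: flip_def)

lemma mem_flip: "j \<in> flip t u \<longleftrightarrow> (if j = t then j \<notin> u else j \<in> u)"
  by (auto simp: flip_def)

lemma finite_flip [simp]: "finite (flip t u) \<longleftrightarrow> finite u"
  by (auto simp: flip_def)

lemma flip_subset: "t \<in> T \<Longrightarrow> u \<subseteq> T \<Longrightarrow> flip t u \<subseteq> T"
  by (auto simp: flip_def)

lemma odd_card_flip: "finite u \<Longrightarrow> odd (card (flip t u)) \<longleftrightarrow> even (card u)"
  by (cases "t \<in> u") (auto simp: flip_def card_gt_0_iff card_Diff_singleton)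

lemma even_card_flip: "finite u \<Longrightarrow> even (card (flip t u)) \<longleftrightarrow> odd (card u)"
  using odd_card_flip[of u t] by argo

text \<open>Translation by \<open>t\<close> changes one fibre count only, the one at
  \<open>\<pi> t\<close>, and it changes it by one.\<close>

lemma push_flip:
  assumes "finite u" shows "push \<pi> (flip t u) = flip (\<pi> t) (push \<pi> u)"
proof (rule set_eqI)
  fix j
  have e: "{i \<in> flip t u. \<pi> i = j} = (if \<pi> t = j then flip t {i \<in> u. \<pi> i = j} else {i \<in> u. \<pi> i = j})"
    by (auto simp: mem_flip split: if_splits)
  have fin: "finite {i \<in> u. \<pi> i = j}" using assms by simp
  have "odd (card {i \<in> flip t u. \<pi> i = j}) \<longleftrightarrow> 
    (if \<pi> t = j then even (card {i \<in> u. \<pi> i = j}) else odd (card {i \<in> u. \<pi> i = j}))"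
    unfolding e using odd_card_flip[OF fin, of t] by simp
  then show "j \<in> push \<pi> (flip t u) \<longleftrightarrow> j \<in> flip (\<pi> t) (push \<pi> u)"
    by (auto simp: mem_flip push_def)
qed

lemma fold_flip_transitive:
  assumes "finite u" "finite v" "u \<subseteq> T" "v \<subseteq> T" shows "\<exists>ts \<in> lists T. fold flip ts u = v"
proof -
  have "\<exists>ts \<in> lists T. fold flip ts u = {}"
    using assms(1,3)
  proof (induction u)
    case (insert t u)
    then obtain ts where "ts \<in> lists T" "fold flip ts u = {}" by auto
    moreover have "flip t (insert t u) = u" "t \<in> T" using insert.hyps insert.prems by (auto simp: flip_def)
    ultimately show ?case by (intro bexI[of _ "t # ts"]) simp_all
  qed (auto intro: bexI[of _ "[]"])
  moreover have "\<exists>ts \<in> lists T. fold flip ts {} = v"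
    using assms(2,4)
  proof (induction v)
    case (insert t v)
    then obtain ts where "ts \<in> lists T" "fold flip ts {} = v" by auto
    moreover have "flip t v = insert t v" "t \<in> T" using insert.hyps insert.prems by (auto simp: flip_def)
    ultimately show ?case by (intro bexI[of _ "ts @ [t]"]) simp_all
  qed (auto intro: bexI[of _ "[]"])
  ultimately obtain ts ts' where "ts \<in> lists T" "ts' \<in> lists T" "fold flip ts u = {}" "fold flip ts' {} = v" by blast
  then show ?thesis by (intro bexI[of _ "ts @ ts'"]) auto
qed

text \<open>One base point, the indices, and a copy of the group of finite sets over each
  index.\<close>

datatype 'v el = AA | GG "'v \<Rightarrow> 'v" | WW "'v \<Rightarrow> 'v" "'v set"

primrec tr :: "'v \<Rightarrow> 'v el \<Rightarrow> 'v el" where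
  "tr t AA = AA"
| "tr t (GG f) = GG f"
| "tr t (WW f u) = WW f (flip t u)"

lemma fold_tr: "fold tr ts (WW f u) = WW f (fold flip ts u)"
  by (induction ts arbitrary: u) auto

section \<open>The two models over the functions from \<open>X\<close> to \<open>T\<close>\<close>

locale torsor_frame = torsor_class T renc RS for T :: "'v::zfc_universe set" and renc RS +
  fixes X :: "'v set" and F :: "'v set set" and enc :: "'v el \<Rightarrow> 'v" and E
  defines "E \<equiv> {AA} \<union> GG ` (X \<rightarrow>\<^sub>E T) \<union> {WW f u |f u. f \<in> X \<rightarrow>\<^sub>E T \<and> u \<subseteq> T \<and> finite u}"
  assumes enc: "inj_on enc E" "small (enc ` E)" and T_nonempty: "T \<noteq> {}"
begin

sublocale mu_class omega TK
  by unfold_locales (rule aec_TK)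

abbreviation "G \<equiv> X \<rightarrow>\<^sub>E T"

definition dec :: "'v \<Rightarrow> 'v el" where "dec = inv_into E enc"

definition rdec :: "'v \<Rightarrow> 'v rsym" where "rdec = inv_into RS renc"

lemma dec_enc [simp]: "e \<in> E \<Longrightarrow> dec (enc e) = e"
  using enc(1) by (simp add: dec_def)

lemma rdec_renc [simp]: "r \<in> RS \<Longrightarrow> rdec (renc r) = r"
  using renc(1) by (simp add: rdec_def)

definition edge :: "('v \<Rightarrow> 'v) \<Rightarrow> ('v \<Rightarrow> 'v) \<Rightarrow> ('v \<Rightarrow> 'v) \<Rightarrow> bool" where
  "edge \<pi> f f' \<longleftrightarrow> {x \<in> X. f' x = \<pi> (f x)} \<in> F"

text \<open>\<open>z\<close> decides which parity is marked by \<open>ZZ\<close>; all other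
  relations are the same for both values.\<close>

primrec Rel :: "bool \<Rightarrow> 'v rsym \<Rightarrow> 'v el \<Rightarrow> 'v el \<Rightarrow> 'v el \<Rightarrow> bool" where
  "Rel z QQ a b c \<longleftrightarrow> a = AA \<and> (\<exists>f. b = GG f)"
| "Rel z SS a b c \<longleftrightarrow> a = AA \<and> (\<exists>f u. b = GG f \<and> c = WW f u)"
| "Rel z ZZ a b c \<longleftrightarrow> (\<exists>f u. a = WW f u \<and> (even (card u) \<longleftrightarrow> z))"
| "Rel z (RR \<pi>) a b c \<longleftrightarrow> (\<exists>f u f' u'. a = WW f u \<and> b = WW f' u' \<and> edge \<pi> f f' \<and> u' = push \<pi> u)"

definition ST :: "bool \<Rightarrow> 'v el set \<Rightarrow> 'v struc" where
  "ST z D = \<lparr>univ = enc ` D,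
     fint = (\<lambda>t \<in> T. \<lambda>x \<in> elts (ordn (Suc 0)) \<rightarrow>\<^sub>E enc ` D. enc (tr t (dec (x (ordn 0))))),
     rint = (\<lambda>s \<in> renc ` RS. {x \<in> elts (ordn 3) \<rightarrow>\<^sub>E enc ` D.
       Rel z (rdec s) (dec (x (ordn 0))) (dec (x (ordn (Suc 0)))) (dec (x (ordn 2)))})\<rparr>"

definition stable :: "'v el set \<Rightarrow> bool" where
  "stable D \<longleftrightarrow> D \<subseteq> E \<and> D \<noteq> {} \<and> (\<forall>t \<in> T. \<forall>e \<in> D. tr t e \<in> D)"

lemma univ_ST [simp]: "univ (ST z D) = enc ` D"
  by (simp add: ST_def)

lemma fn_ST: "D \<subseteq> E \<Longrightarrow> t \<in> T \<Longrightarrow> e \<in> D \<Longrightarrow> fn (ST z D) t (enc e) = enc (tr t e)"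
  by (simp add: fn_def ST_def single_in subsetD)

lemma triple_in: "a \<in> U \<Longrightarrow> b \<in> U \<Longrightarrow> c \<in> U \<Longrightarrow> triple a b c \<in> elts (ordn 3) \<rightarrow>\<^sub>E U"
  unfolding triple_PiE by blast

lemma rl_ST: "D \<subseteq> E \<Longrightarrow> r \<in> RS \<Longrightarrow> a \<in> D \<Longrightarrow> b \<in> D \<Longrightarrow> c \<in> D \<Longrightarrow> 
    rl (ST z D) r (enc a) (enc b) (enc c) \<longleftrightarrow> Rel z r a b c"
  by (simp add: rl_def ST_def triple_in subsetD)

lemma is_struc_ST:
  assumes "stable D" shows "is_struc TL (ST z D)"
  unfolding is_struc_def
proof (intro conjI)
  have D: "D \<subseteq> E" "D \<noteq> {}" "\<And>t e. t \<in> T \<Longrightarrow> e \<in> D \<Longrightarrow> tr t e \<in> D" using assms by (auto simp: stable_def)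
  show "small (univ (ST z D))" using small_subset[OF enc(2)] D(1) by (simp add: image_mono)
  show "univ (ST z D) \<noteq> {}" using D(2) by simp
  show "fint (ST z D) \<in> (\<Pi>\<^sub>E s\<in>fsyms TL. (elts (far TL s) \<rightarrow>\<^sub>E univ (ST z D)) \<rightarrow>\<^sub>E univ (ST z D))"
  proof (rule PiE_I, rule PiE_I)
    fix t x assume t: "t \<in> fsyms TL" and "x \<in> elts (far TL t) \<rightarrow>\<^sub>E univ (ST z D)"
    then obtain e where e: "e \<in> D" "x = single (enc e)" by (auto simp: single_PiE)
    have "fint (ST z D) t x = enc (tr t e)" using fn_ST[OF D(1) _ e(1), of t z] t e(2) by (simp add: fn_def)
    then show "fint (ST z D) t x \<in> univ (ST z D)" using D(3)[OF _ e(1)] t by simp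
  qed (auto simp: ST_def)
  show "rint (ST z D) \<in> (\<Pi>\<^sub>E s\<in>rsyms TL. Pow (elts (rar TL s) \<rightarrow>\<^sub>E univ (ST z D)))"
    by (rule PiE_I) (auto simp: ST_def)
qed

text \<open>The two parity values may differ as long as the relations agree on the smaller set; this
  is how the base becomes common to both models.\<close>

lemma substruc_ST:
  assumes "stable D" "stable D'" "D \<subseteq> D'"
    and "\<And>r a b c. r \<in> RS \<Longrightarrow> a \<in> D \<Longrightarrow> b \<in> D \<Longrightarrow> c \<in> D \<Longrightarrow> Rel z r a b c \<longleftrightarrow> Rel z' r a b c"
  shows "substruc TL (ST z D) (ST z' D')"
proof (rule substrucI[OF is_struc_ST[OF assms(1)] is_struc_ST[OF assms(2)]])
  have D: "D \<subseteq> E" "D' \<subseteq> E" using assms(1,2) by (auto simp: stable_def)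
  show "univ (ST z D) \<subseteq> univ (ST z' D')" using assms(3) by auto
  show "fn (ST z D) t a = fn (ST z' D') t a" if "t \<in> T" "a \<in> univ (ST z D)" for t a
    using that assms(3) D by (auto simp: fn_ST subsetD)
  show "rl (ST z D) r a b c \<longleftrightarrow> rl (ST z' D') r a b c" 
    if abc: "r \<in> RS" "a \<in> univ (ST z D)" "b \<in> univ (ST z D)" "c \<in> univ (ST z D)" for r a b c
  proof -
    obtain a' b' c' where "a = enc a'" "b = enc b'" "c = enc c'" "a' \<in> D" "b' \<in> D" "c' \<in> D" 
      using abc(2-4) by auto
    then show ?thesis using abc(1) D assms(3,4) rl_ST[of D r a' b' c' z] rl_ST[of D' r a' b' c' z'] by auto
  qed
qed

text \<open>The part of the frame over a set \<open>B\<close> of indices. Over few indices such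
  parts admit isomorphisms between the two models that the whole frame may lack.\<close>

definition dom :: "('v \<Rightarrow> 'v) set \<Rightarrow> 'v el set" where
  "dom B = {AA} \<union> GG ` B \<union> {WW f u |f u. f \<in> B \<and> u \<subseteq> T \<and> finite u}"

lemma stable_dom: "B \<subseteq> G \<Longrightarrow> stable (dom B)"
  unfolding stable_def dom_def E_def by (auto simp: flip_subset)

lemma G_nonempty: "G \<noteq> {}"
  using T_nonempty by (simp add: PiE_eq_empty_iff)

lemma stable_G: "stable (GG ` G)"
  unfolding stable_def using G_nonempty by (auto simp: E_def)

lemma fold_fn_ST:
  assumes "stable D" "ts \<in> lists T" "e \<in> D" shows "fold (fn (ST z D)) ts (enc e) = enc (fold tr ts e)"
  using assms(2,3)
proof (induction ts arbitrary: e)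
  case (Cons t ts)
  then show ?case using assms(1) fn_ST[of D t e z] by (simp add: stable_def)
qed simp

lemma ST_dom_torsors:
  assumes B: "B \<subseteq> G" shows "ST z (dom B) \<in> torsors"
proof -
  note s = stable_dom[OF B]
  have D: "dom B \<subseteq> E" using s by (simp add: stable_def)
  have "\<exists>w \<in> enc ` dom B. rl (ST z (dom B)) SS a g w" 
    if ag: "a \<in> enc ` dom B" "g \<in> enc ` dom B" "rl (ST z (dom B)) QQ a g g" for a g
  proof -
    obtain a' g' where a': "a = enc a'" "g = enc g'" "a' \<in> dom B" "g' \<in> dom B" using ag(1,2) by auto
    then obtain f where f: "a' = AA" "g' = GG f" using ag(3) rl_ST[OF D RS_in(1)] by auto
    then have "WW f {} \<in> dom B" using a'(4) by (auto simp: dom_def)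
    moreover from this have "rl (ST z (dom B)) SS a g (enc (WW f {}))"
      using a' f rl_ST[OF D RS_in(2)] by simp
    ultimately show ?thesis by blast
  qed
  moreover have "\<exists>ts \<in> lists T. w' = fold (fn (ST z (dom B))) ts w"
    if ag: "a \<in> enc ` dom B" "g \<in> enc ` dom B" "w \<in> enc ` dom B" "w' \<in> enc ` dom B" 
      "rl (ST z (dom B)) SS a g w" "rl (ST z (dom B)) SS a g w'" for a g w w'
  proof -
    obtain a1 g1 w1 w2 where a1: "a = enc a1" "g = enc g1" "w = enc w1" "w' = enc w2"
      "a1 \<in> dom B" "g1 \<in> dom B" "w1 \<in> dom B" "w2 \<in> dom B" using ag(1-4) by auto
    then obtain f u u' where f: "w1 = WW f u" "w2 = WW f u'" using ag(5,6) rl_ST[OF D RS_in(2)] by auto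
    have u: "finite u" "finite u'" "u \<subseteq> T" "u' \<subseteq> T" using a1(7,8) unfolding f by (auto simp: dom_def)
    obtain ts where "ts \<in> lists T" "fold flip ts u = u'" using fold_flip_transitive[OF u] by blast
    then show ?thesis using fold_fn_ST[OF s _ a1(7)] by (intro bexI[of _ ts]) (simp_all add: a1 f fold_tr)
  qed
  ultimately show ?thesis unfolding torsors_def using is_struc_ST[OF s] by simp
qed

text \<open>Without the base point no fibre is marked, and both conditions hold vacuously.\<close>

lemma ST_G_torsors: "ST z (GG ` G) \<in> torsors"
proof -
  have D: "GG ` G \<subseteq> E" using stable_G by (simp add: stable_def)
  have n: "\<not> rl (ST z (GG ` G)) r a g w" if r: "r = QQ \<or> r = SS" and ag: "a \<in> enc ` GG ` G" "g \<in> enc ` GG ` G" "w \<in> enc ` GG ` G" for a g w r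
  proof -
    obtain a' g' w' where "a = enc a'" "g = enc g'" "w = enc w'" "a' \<in> GG ` G" "g' \<in> GG ` G" "w' \<in> GG ` G"
      using ag by auto
    then show ?thesis using r rl_ST[OF D, of r a' g' w' z] RS_in by auto
  qed
  show ?thesis unfolding torsors_def using is_struc_ST[OF stable_G] n by auto
qed

text \<open>The relation \<open>ZZ\<close>, on which the two structures differ, is empty on the base.\<close>

lemma ST_G_eq: "ST z (GG ` G) = ST z' (GG ` G)"
proof -
  have "substruc TL (ST z (GG ` G)) (ST z' (GG ` G))"
    by (rule substruc_ST[OF stable_G stable_G order_refl]) (auto simp: RS_def)
  from substruc_eq_restr[OF this] show ?thesis
    using restr_univ[OF is_struc_ST[OF stable_G, of z']] by simp
qed

abbreviation "base \<equiv> ST True (GG ` G)"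

lemma leK_base: "leK TK base (ST z (dom G))"
proof -
  have "substruc TL (ST z (GG ` G)) (ST z (dom G))"
    by (rule substruc_ST[OF stable_G stable_dom]) (auto simp: dom_def)
  then show ?thesis using ST_G_torsors ST_dom_torsors[of G z] ST_G_eq[of True z] by simp
qed

text \<open>The realising point is the same element of both models, which differ in the parity
  marked by \<open>ZZ\<close>; equality of the types asks for a chain of embeddings that exchanges
  the parities over all indices.\<close>

definition parity_type :: "bool \<Rightarrow> 'v pretype set" where
  "parity_type z = gtp TK (elts ord_one) (\<lambda>i \<in> elts ord_one. enc AA) (univ base) (ST z (dom G))"

lemma elts_ord_one: "elts (ord_one :: 'v) = {ordn 0}"
  by (simp add: ord_one_def elts_vset ordn.simps)

lemma parity_type_gS: "parity_type z \<in> gS TK ord_one base"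
  unfolding gS_def parity_type_def using leK_base[of z] by (fastforce simp: dom_def)

text \<open>Translate the fibre over \<open>f\<close> by the generator \<open>f x\<close>. Parity
  changes everywhere, and the relations \<open>RR \<pi>\<close> survive because push-forward is
  linear and \<open>f' x = \<pi> (f x)\<close> holds at the chosen point along each edge.\<close>

lemma point_iso:
  assumes B: "B \<subseteq> G" and x: "x \<in> X" 
    and pt: "\<And>f f' \<pi>. f \<in> B \<Longrightarrow> f' \<in> B \<Longrightarrow> \<pi> \<in> T \<rightarrow>\<^sub>E T \<Longrightarrow> edge \<pi> f f' \<Longrightarrow> f' x = \<pi> (f x)"
  shows "\<exists>\<psi>. struc_iso TL \<psi> (ST True (dom B)) (ST False (dom B)) \<and> \<psi> (enc AA) = enc AA \<and> (\<forall>f \<in> B. \<psi> (enc (GG f)) = enc (GG f))"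
proof -
  note s = stable_dom[OF B]
  have D: "dom B \<subseteq> E" using s by (simp add: stable_def)
  define h where "h e = (case e of WW f u \<Rightarrow> WW f (flip (f x) u) | _ \<Rightarrow> e)" for e
  have h [simp]: "h AA = AA" "h (GG f) = GG f" "h (WW f u) = WW f (flip (f x) u)" for f u
    by (simp_all add: h_def)
  have fx: "f x \<in> T" if "f \<in> B" for f using that B x by auto
  have hD: "h e \<in> dom B" if "e \<in> dom B" for e
  proof (cases e)
    case (WW f u)
    then have f: "f \<in> B" "u \<subseteq> T" "finite u" using that by (auto simp: dom_def)
    have "flip (f x) u \<subseteq> T" by (rule flip_subset[OF fx[OF f(1)] f(2)])
    then show ?thesis using f WW by (simp add: dom_def)
  qed (use that in \<open>auto simp: dom_def\<close>)
  have hh: "h (h e) = e" for e by (cases e) auto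
  define \<psi> where "\<psi> v = enc (h (dec v))" for v
  have \<psi>: "\<psi> (enc e) = enc (h e)" if "e \<in> dom B" for e using that D by (simp add: \<psi>_def subsetD)
  have bij: "bij_betw \<psi> (enc ` dom B) (enc ` dom B)"
    by (rule bij_betw_byWitness[where f' = \<psi>]) (auto simp: \<psi> hD hh)
  have "Rel True r a b c \<longleftrightarrow> Rel False r (h a) (h b) (h c)" if r: "r \<in> RS" and abc: "a \<in> dom B" "b \<in> dom B" "c \<in> dom B" for r a b c
  proof (cases r)
    case QQ then show ?thesis by (cases a; cases b) auto
  next
    case SS then show ?thesis by (cases a; cases b; cases c) auto
  next
    case ZZ then show ?thesis using abc by (cases a) (auto simp: dom_def even_card_flip)
  next
    case (RR \<pi>)
    then have \<pi>: "\<pi> \<in> T \<rightarrow>\<^sub>E T" using r by (auto simp: RS_def)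
    show ?thesis
    proof (cases "\<exists>f u f' u'. a = WW f u \<and> b = WW f' u'")
      case True
      then obtain f u f' u' where ab: "a = WW f u" "b = WW f' u'" by blast
      have f: "f \<in> B" "f' \<in> B" "finite u" using abc(1,2) unfolding ab by (auto simp: dom_def)
      have "flip (f' x) u' = push \<pi> (flip (f x) u) \<longleftrightarrow> u' = push \<pi> u" if "edge \<pi> f f'"
        using pt[OF f(1,2) \<pi> that] by (simp add: push_flip[OF f(3)])
      then show ?thesis using RR ab by auto
    next
      case False
      then show ?thesis using RR by (cases a; cases b) auto
    qed
  qed
  note R = this
  have "struc_iso TL \<psi> (ST True (dom B)) (ST False (dom B))"
    unfolding struc_iso_TL
  proof (intro conjI ballI is_struc_ST s)
    show "bij_betw \<psi> (univ (ST True (dom B))) (univ (ST False (dom B)))" using bij by simp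
  next
    fix t v assume t: "t \<in> T" and "v \<in> univ (ST True (dom B))"
    then obtain e where e: "e \<in> dom B" "v = enc e" by auto
    have "h (tr t e) = tr t (h e)" by (cases e) (auto simp: flip_commute)
    moreover have "tr t e \<in> dom B" using s t e(1) by (simp add: stable_def)
    ultimately show "\<psi> (fn (ST True (dom B)) t v) = fn (ST False (dom B)) t (\<psi> v)"
      using e t hD[OF e(1)] by (simp add: fn_ST[OF D] \<psi>)
  next
    fix r a b c assume r: "r \<in> RS" and "a \<in> univ (ST True (dom B))" "b \<in> univ (ST True (dom B))" "c \<in> univ (ST True (dom B))"
    then obtain a' b' c' where "a = enc a'" "b = enc b'" "c = enc c'" "a' \<in> dom B" "b' \<in> dom B" "c' \<in> dom B" by auto
    then show "rl (ST True (dom B)) r a b c \<longleftrightarrow> rl (ST False (dom B)) r (\<psi> a) (\<psi> b) (\<psi> c)"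
      using R[OF r] by (simp add: rl_ST[OF D r] \<psi> hD)
  qed
  moreover have "\<psi> (enc AA) = enc AA" using \<psi>[of AA] by (simp add: dom_def)
  moreover have "\<psi> (enc (GG f)) = enc (GG f)" if "f \<in> B" for f using \<psi>[of "GG f"] that by (simp add: dom_def)
  ultimately show ?thesis by blast
qed

lemma leK_dom: "B \<subseteq> G \<Longrightarrow> leK TK (ST z (dom B)) (ST z (dom G))"
proof -
  assume B: "B \<subseteq> G"
  have "substruc TL (ST z (dom B)) (ST z (dom G))"
    by (rule substruc_ST[OF stable_dom[OF B] stable_dom]) (use B in \<open>auto simp: dom_def\<close>)
  then show ?thesis using ST_dom_torsors[OF B] ST_dom_torsors[of G] by simp
qed

text \<open>The part over the indices in \<open>A\<close> embeds into both models, once by inclusion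
  and once along the translation. Through it two steps of \<open>E_at\<close> connect the types,
  without a common extension of the two whole models.\<close>

lemma parity_type_restrict_eq:
  assumes A: "A \<subseteq> univ base" and x: "x \<in> X" 
    and pt: "\<And>f f' \<pi>. f \<in> G \<Longrightarrow> f' \<in> G \<Longrightarrow> enc (GG f) \<in> A \<Longrightarrow> enc (GG f') \<in> A \<Longrightarrow> \<pi> \<in> T \<rightarrow>\<^sub>E T \<Longrightarrow> edge \<pi> f f' \<Longrightarrow> f' x = \<pi> (f x)"
  shows "gtp_restrict TK (elts ord_one) A (parity_type True) = gtp_restrict TK (elts ord_one) A (parity_type False)"
proof -
  define B where "B = {f \<in> G. enc (GG f) \<in> A}"
  have B: "B \<subseteq> G" by (auto simp: B_def)
  have AB: "A = enc ` GG ` B" using A by (auto simp: B_def)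
  let ?J = "elts (ord_one :: 'v)" and ?a = "\<lambda>i \<in> elts (ord_one :: 'v). enc AA"
  let ?N = "\<lambda>z. ST z (dom G)" and ?P = "ST True (dom B)" and ?Q = "ST False (dom B)"
  obtain \<psi> where \<psi>: "struc_iso TL \<psi> ?P ?Q" "\<psi> (enc AA) = enc AA" "\<forall>f \<in> B. \<psi> (enc (GG f)) = enc (GG f)"
    using point_iso[OF B x] pt unfolding B_def by blast
  have NM: "?N z \<in> models TK" "?P \<in> models TK" for z using ST_dom_torsors B by simp_all
  have a: "?a \<in> ?J \<rightarrow>\<^sub>E univ (?N z)" "?a \<in> ?J \<rightarrow>\<^sub>E univ ?P" for z by (auto simp: dom_def)
  have AN: "A \<subseteq> univ (?N z)" "A \<subseteq> univ ?P" for z using B unfolding AB by (auto simp: dom_def)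
  have iP: "K_embedding TK (\<lambda>x. x) ?P (?N True)" by (rule K_embedding_incl[OF leK_dom[OF B]])
  have iN: "K_embedding TK (\<lambda>x. x) (?N z) (?N z)" for z by (rule K_embedding_incl[OF leK_refl[OF NM(1)]])
  have \<psi>K: "K_embedding TK \<psi> ?P (?N False)"
    using \<psi>(1) leK_dom[OF B, of False] unfolding K_embedding_def TK_sel(1) by blast
  have 1: "E_at TK ?J (?a, A, ?N True) (?a, A, ?P)"
    unfolding E_at_def prod.case
  proof (intro conjI bexI[OF _ NM(1)] exI NM a refl)
    show "A \<subseteq> univ (?N True) \<inter> univ ?P" using AN by blast
    show "K_embedding TK (\<lambda>x. x) (?N True) (?N True)" "K_embedding TK (\<lambda>x. x) ?P (?N True)" by (rule iN, rule iP)
  qed simp_all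
  have 2: "E_at TK ?J (?a, A, ?P) (?a, A, ?N False)"
    unfolding E_at_def prod.case
  proof (intro conjI bexI[OF _ NM(1)] exI NM a refl)
    show "A \<subseteq> univ ?P \<inter> univ (?N False)" using AN by blast
    show "K_embedding TK \<psi> ?P (?N False)" "K_embedding TK (\<lambda>x. x) (?N False) (?N False)" by (rule \<psi>K, rule iN)
    show "\<forall>x \<in> A. \<psi> x = x \<and> x = x" using \<psi>(3) unfolding AB by blast
  qed (simp add: \<psi>(2))
  have "gtp TK ?J ?a A (?N True) = gtp TK ?J ?a A (?N False)"
    by (rule gtp_eqI[OF tranclp.trancl_into_trancl[OF tranclp.r_into_trancl[of "E_at TK ?J", OF 1] 2]])
  moreover have "gtp_restrict TK ?J A (parity_type z) = gtp TK ?J ?a A (?N z)" for z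
  proof -
    have "univ base \<subseteq> univ (?N z)" by (auto simp: dom_def)
    from gtp_restrict_gtp[OF E_at_refl[OF NM(1) this a(1)] order_refl A]
    show ?thesis by (simp add: parity_type_def)
  qed
  ultimately show ?thesis by simp
qed

section \<open>Sections of the fibres and their transport\<close>

lemma K_embedding_TK:
  assumes "K_embedding TK f P Q"
  shows "x \<in> univ P \<Longrightarrow> f x \<in> univ Q"
    "r \<in> RS \<Longrightarrow> x \<in> univ P \<Longrightarrow> y \<in> univ P \<Longrightarrow> z \<in> univ P \<Longrightarrow> rl Q r (f x) (f y) (f z) \<longleftrightarrow> rl P r x y z"
    "ts \<in> lists T \<Longrightarrow> x \<in> univ P \<Longrightarrow> f (fold (fn P) ts x) = fold (fn Q) ts (f x)"
proof -
  obtain P' where P': "struc_iso TL f P P'" "substruc TL P' Q" using assms unfolding K_embedding_def by auto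
  have im: "f ` univ P = univ P'" using struc_isoD(4)[OF P'(1)] .
  show "x \<in> univ P \<Longrightarrow> f x \<in> univ Q" using im substrucD(3)[OF P'(2)] by blast
  show "rl Q r (f x) (f y) (f z) \<longleftrightarrow> rl P r x y z" if "r \<in> RS" "x \<in> univ P" "y \<in> univ P" "z \<in> univ P"
    using that P'(1) substrucD(5)[OF P'(2), of r "f x" "f y" "f z"] im by (auto simp: struc_iso_TL)
  show "f (fold (fn P) ts x) = fold (fn Q) ts (f x)" if "ts \<in> lists T" "x \<in> univ P"
    using fold_fn_iso[OF P'(1) that] fold_fn_substruc[OF P'(2) that(1), of "f x"] that(2) im by auto
qed

text \<open>A choice of a \<open>ZZ\<close>-marked point in every fibre, compatible with
  push-forwards along edges. The fibres are addressed by \<open>a\<close> and the indices only,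
  which are what chains of \<open>E_at\<close> over the base preserve.\<close>

definition section_of :: "'v \<Rightarrow> 'v struc \<Rightarrow> (('v \<Rightarrow> 'v) \<Rightarrow> 'v) \<Rightarrow> bool" where
  "section_of a P v \<longleftrightarrow> a \<in> univ P \<and> (\<forall>f \<in> G. v f \<in> univ P \<and> rl P QQ a (enc (GG f)) (enc (GG f)) \<and>
      rl P SS a (enc (GG f)) (v f) \<and> rl P ZZ (v f) (v f) (v f)) \<and>
    (\<forall>f \<in> G. \<forall>f' \<in> G. \<forall>\<pi> \<in> T \<rightarrow>\<^sub>E T. edge \<pi> f f' \<longrightarrow> rl P (RR \<pi>) (v f) (v f') (v f))"

text \<open>In the common extension the point \<open>f1 (v f)\<close> lies in the fibre over the
  shared image of \<open>a i\<close> and \<open>a' i\<close>. The fibre of \<open>P'\<close> is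
  nonempty and also maps there. Transitivity in \<open>Q\<close> reaches \<open>f1 (v f)\<close>
  from an image point of \<open>P'\<close> by function symbols, so it comes from \<open>P'\<close>
  itself and the section can be pulled back.\<close>

lemma section_of_E_at:
  assumes v: "section_of (a i) P v" and e: "E_at TK J (a, univ base, P) (a', univ base, P')" and i: "i \<in> J"
  shows "\<exists>v'. section_of (a' i) P' v'"
proof -
  note e' = e[unfolded E_at_def prod.case]
  obtain Q f1 f2 where Q: "K_embedding TK f1 P Q" "K_embedding TK f2 P' Q"
    and f12: "\<forall>x \<in> univ base. f1 x = x \<and> f2 x = x" "\<forall>j \<in> J. f1 (a j) = f2 (a' j)"
    using e' by blast
  have fixb: "\<And>x. x \<in> univ base \<Longrightarrow> f1 x = x \<and> f2 x = x" and eq: "f1 (a i) = f2 (a' i)" using f12 i by blast+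
  have bs: "univ base \<subseteq> univ P" "univ base \<subseteq> univ P'" using e' by blast+
  have "a' \<in> J \<rightarrow>\<^sub>E univ P'" using e' by blast
  then have a'P: "a' i \<in> univ P'" using i by (rule PiE_mem)
  note K1 = K_embedding_TK[OF Q(1)] and K2 = K_embedding_TK[OF Q(2)]
  have PM: "P' \<in> torsors" "Q \<in> torsors" using K_embedding_models[OF Q(2)] by simp_all
  let ?c = "f1 (a i)"
  have aP: "a i \<in> univ P" using v by (simp add: section_of_def)
  have g: "enc (GG f) \<in> univ P" "enc (GG f) \<in> univ P'" "f1 (enc (GG f)) = enc (GG f)" "f2 (enc (GG f)) = enc (GG f)" if "f \<in> G" for f
    using that bs fixb[of "enc (GG f)"] by auto
  have V: "v f \<in> univ P" "rl P QQ (a i) (enc (GG f)) (enc (GG f))" "rl P SS (a i) (enc (GG f)) (v f)" "rl P ZZ (v f) (v f) (v f)"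
    if "f \<in> G" for f using v that by (simp_all add: section_of_def)
  have QQ': "rl P' QQ (a' i) (enc (GG f)) (enc (GG f))" if f: "f \<in> G" for f
    using V(2)[OF f] K1(2)[OF RS_in(1) aP g(1)[OF f] g(1)[OF f]] K2(2)[OF RS_in(1) a'P g(2)[OF f] g(2)[OF f]] g[OF f] eq by simp
  have "\<exists>u. u \<in> univ P' \<and> f2 u = f1 (v f)" if f: "f \<in> G" for f
  proof -
    obtain w where w: "w \<in> univ P'" "rl P' SS (a' i) (enc (GG f)) w"
      using torsors_fibre[OF PM(1) a'P g(2)[OF f] QQ'[OF f]] by blast
    have "rl Q SS ?c (enc (GG f)) (f2 w)"
      using w(2) K2(2)[OF RS_in(2) a'P g(2)[OF f] w(1)] g[OF f] eq by simp
    moreover have "rl Q SS ?c (enc (GG f)) (f1 (v f))"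
      using V(3)[OF f] K1(2)[OF RS_in(2) aP g(1)[OF f] V(1)[OF f]] g[OF f] by simp
    moreover have "enc (GG f) \<in> univ Q" using K1(1)[OF g(1)[OF f]] g(3)[OF f] by simp
    ultimately obtain ts where ts: "ts \<in> lists T" "f1 (v f) = fold (fn Q) ts (f2 w)"
      using torsors_transitive[OF PM(2) K1(1)[OF aP] _ K2(1)[OF w(1)] K1(1)[OF V(1)[OF f]]] by blast
    then have "f1 (v f) = f2 (fold (fn P') ts w)" using K2(3)[OF ts(1) w(1)] by simp
    then show ?thesis using fold_fn_in[OF torsors_struc[OF PM(1)] ts(1) w(1)] by metis
  qed
  then obtain v' where v': "\<And>f. f \<in> G \<Longrightarrow> v' f \<in> univ P' \<and> f2 (v' f) = f1 (v f)" by metis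
  have "rl P' SS (a' i) (enc (GG f)) (v' f)" if f: "f \<in> G" for f
    using V(3)[OF f] K1(2)[OF RS_in(2) aP g(1)[OF f] V(1)[OF f]] K2(2)[OF RS_in(2) a'P g(2)[OF f], of "v' f"] v'[OF f] g[OF f] eq by simp
  moreover have "rl P' ZZ (v' f) (v' f) (v' f)" if f: "f \<in> G" for f
    using V(4)[OF f] K1(2)[OF RS_in(3) V(1)[OF f] V(1)[OF f] V(1)[OF f]] K2(2)[OF RS_in(3), of "v' f" "v' f" "v' f"] v'[OF f] by simp
  moreover have "rl P' (RR \<pi>) (v' f) (v' f') (v' f)" if f: "f \<in> G" "f' \<in> G" "\<pi> \<in> T \<rightarrow>\<^sub>E T" "edge \<pi> f f'" for f f' \<pi>
  proof -
    have "rl P (RR \<pi>) (v f) (v f') (v f)" using v f by (simp add: section_of_def)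
    then show ?thesis
      using K1(2)[OF RS_in(4)[OF f(3)] V(1)[OF f(1)] V(1)[OF f(2)] V(1)[OF f(1)]] 
        K2(2)[OF RS_in(4)[OF f(3)], of "v' f" "v' f'" "v' f"] v'[OF f(1)] v'[OF f(2)] by simp
  qed
  ultimately have "section_of (a' i) P' v'" unfolding section_of_def using v' QQ' a'P by simp
  then show ?thesis by blast
qed

text \<open>The empty sets form a section in the model that marks even sets. Carried along the
  chain, it becomes a section in the model that marks odd sets, and this is the selector.\<close>

lemma parity_selector:
  assumes "parity_type True = parity_type False"
  obtains \<phi> where "\<And>f. f \<in> G \<Longrightarrow> finite (\<phi> f) \<and> \<phi> f \<subseteq> T \<and> odd (card (\<phi> f))"
    "\<And>f f' \<pi>. f \<in> G \<Longrightarrow> f' \<in> G \<Longrightarrow> \<pi> \<in> T \<rightarrow>\<^sub>E T \<Longrightarrow> edge \<pi> f f' \<Longrightarrow> \<phi> f' = push \<pi> (\<phi> f)"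
proof -
  let ?J = "elts (ord_one :: 'v)" and ?a = "\<lambda>i \<in> elts (ord_one :: 'v). enc AA" and ?N = "\<lambda>z. ST z (dom G)"
  have D: "dom G \<subseteq> E" using stable_dom[of G] by (simp add: stable_def)
  have in_dom: "AA \<in> dom G" "\<And>f. f \<in> G \<Longrightarrow> GG f \<in> dom G" "\<And>f. f \<in> G \<Longrightarrow> WW f {} \<in> dom G" by (auto simp: dom_def)
  have i0: "ordn 0 \<in> ?J" by (simp add: elts_ord_one)
  have "(E_at TK ?J)\<^sup>+\<^sup>+ (?a, univ base, ?N True) (?a, univ base, ?N False)"
    by (rule gtp_eqD) (use assms ST_dom_torsors[of G] in \<open>auto simp: parity_type_def dom_def\<close>)
  moreover have "section_of (?a (ordn 0)) (?N True) (\<lambda>f. enc (WW f {}))"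
    unfolding section_of_def using in_dom i0 RS_in by (simp add: rl_ST[OF D] push_def)
  moreover have "\<exists>v. section_of (a' (ordn 0)) P' v \<and> A' = univ base" 
    if "(E_at TK ?J)\<^sup>+\<^sup>+ (?a, univ base, ?N True) (a', A', P')" 
      and s: "section_of (?a (ordn 0)) (?N True) (\<lambda>f. enc (WW f {}))" for a' A' P'
    using that(1)
  proof (induction "(a', A', P')" arbitrary: a' A' P' rule: tranclp_induct)
    case base
    then have "A' = univ base" by (simp add: E_at_def)
    with section_of_E_at[where a = ?a and i = "ordn 0" and J = ?J, OF s _ i0] base show ?case by blast
  next
    case (step t)
    obtain b B Q where t: "t = (b, B, Q)" by (cases t)
    obtain v where v: "section_of (b (ordn 0)) Q v" "B = univ base" using step(3)[OF t] by blast
    have "A' = univ base" using step(2) t v(2) by (simp add: E_at_def)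
    with section_of_E_at[where a = b and i = "ordn 0" and J = ?J, OF v(1) _ i0] step(2) t v(2) show ?case by blast
  qed
  ultimately obtain v where "section_of (?a (ordn 0)) (?N False) v" by blast
  then have v: "section_of (enc AA) (?N False) v" using i0 by simp
  have "\<exists>u. v f = enc (WW f u) \<and> finite u \<and> u \<subseteq> T \<and> odd (card u)" if f: "f \<in> G" for f
  proof -
    have vf: "v f \<in> enc ` dom G" "rl (?N False) SS (enc AA) (enc (GG f)) (v f)" "rl (?N False) ZZ (v f) (v f) (v f)"
      using v f by (simp_all add: section_of_def)
    then obtain e where e: "e \<in> dom G" "v f = enc e" by blast
    have "Rel False SS AA (GG f) e" "Rel False ZZ e e e"
      using vf(2,3) rl_ST[OF D RS_in(2) in_dom(1) in_dom(2)[OF f] e(1)] rl_ST[OF D RS_in(3) e(1) e(1) e(1)] e(2) by simp_all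
    then show ?thesis using e by (auto simp: dom_def)
  qed
  then obtain \<phi> where \<phi>: "\<And>f. f \<in> G \<Longrightarrow> v f = enc (WW f (\<phi> f)) \<and> finite (\<phi> f) \<and> \<phi> f \<subseteq> T \<and> odd (card (\<phi> f))" by metis
  show ?thesis
  proof (rule that[of \<phi>])
    show "finite (\<phi> f) \<and> \<phi> f \<subseteq> T \<and> odd (card (\<phi> f))" if "f \<in> G" for f using \<phi>[OF that] by blast
    fix f f' \<pi> assume f: "f \<in> G" "f' \<in> G" "\<pi> \<in> T \<rightarrow>\<^sub>E T" "edge \<pi> f f'"
    have d: "WW f (\<phi> f) \<in> dom G" "WW f' (\<phi> f') \<in> dom G" using f \<phi> by (auto simp: dom_def)
    have "rl (?N False) (RR \<pi>) (v f) (v f') (v f)" using v f by (simp add: section_of_def)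
    then show "\<phi> f' = push \<pi> (\<phi> f)"
      using \<phi>[OF f(1)] \<phi>[OF f(2)] rl_ST[OF D RS_in(4)[OF f(3)] d(1) d(2) d(1)] by simp
  qed
qed

text \<open>A small set \<open>A\<close> of parameters imposes at most one condition per pair from
  \<open>A\<close> and map from \<open>T\<close> to \<open>T\<close>, each holding on a set of
  \<open>F\<close>. Completeness gives one point of \<open>X\<close> that satisfies all of them, so
  no small set separates the types.\<close>

lemma parity_types_eq:
  assumes tame: "tame \<kappa> TK" and F: "filter_on_set X F"
    and compl: "\<And>(B :: 'v set) S. B \<prec> elts \<kappa> \<Longrightarrow> S \<subseteq> F \<Longrightarrow> S \<noteq> {} \<Longrightarrow> S \<lesssim> B \<times> B \<times> (T \<rightarrow>\<^sub>E T) \<Longrightarrow> \<Inter>S \<in> F"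
  shows "parity_type True = parity_type False"
proof (rule ccontr)
  assume pq: "parity_type True \<noteq> parity_type False"
  have "base \<in> models TK" using ST_G_torsors by simp
  note tame[unfolded tame_def, rule_format, OF this parity_type_gS parity_type_gS pq]
  then obtain A where A: "A \<subseteq> univ base" "A \<prec> elts \<kappa>"
    and ne: "gtp_restrict TK (elts ord_one) A (parity_type True) \<noteq> gtp_restrict TK (elts ord_one) A (parity_type False)"
    by blast
  have XF: "X \<in> F" "{} \<notin> F" using F by (auto simp: filter_on_set_def)
  define g where "g p = (SOME f. f \<in> G \<and> p = enc (GG f))" for p
  have g: "g (enc (GG f)) = f" if f: "f \<in> G" for f
    unfolding g_def
  proof (rule some_equality)
    fix f' assume f': "f' \<in> G \<and> enc (GG f) = enc (GG f')"
    then have "GG f \<in> E" "GG f' \<in> E" using f by (simp_all add: E_def)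
    then show "f' = f" using inj_onD[OF enc(1)] f' by blast
  qed (use f in simp)
  \<comment> \<open>Triples without an edge contribute the set \<open>X\<close>, so that
    \<open>S\<close> is an image of the full product and inherits its size bound.\<close>
  define S where "S = (\<lambda>(p, q, \<pi>). if edge \<pi> (g p) (g q) then {x \<in> X. g q x = \<pi> (g p x)} else X) ` (A \<times> A \<times> (T \<rightarrow>\<^sub>E T))"
  have S: "{x \<in> X. f' x = \<pi> (f x)} \<in> S" 
    if f: "f \<in> G" "f' \<in> G" "enc (GG f) \<in> A" "enc (GG f') \<in> A" "\<pi> \<in> T \<rightarrow>\<^sub>E T" "edge \<pi> f f'" for f f' \<pi>
    unfolding S_def using f by (intro image_eqI[of _ _ "(enc (GG f), enc (GG f'), \<pi>)"]) (simp_all add: g)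
  have SF: "S \<subseteq> F" using XF(1) by (auto simp: S_def edge_def)
  have "\<exists>x \<in> X. \<forall>Y \<in> S. x \<in> Y"
  proof (cases "S = {}")
    case True
    then show ?thesis using XF by (metis all_not_in_conv)
  next
    case False
    have "S \<lesssim> A \<times> A \<times> (T \<rightarrow>\<^sub>E T)" unfolding S_def by (rule image_lepoll)
    from compl[OF A(2) SF False this] have I: "\<Inter>S \<in> F" .
    moreover have "\<Inter>S \<subseteq> X" using False SF F unfolding filter_on_set_def by blast
    moreover have "\<Inter>S \<noteq> {}" using I XF(2) by metis
    ultimately show ?thesis by blast
  qed
  then obtain x where x: "x \<in> X" "\<And>Y. Y \<in> S \<Longrightarrow> x \<in> Y" by blast
  have "gtp_restrict TK (elts ord_one) A (parity_type True) = gtp_restrict TK (elts ord_one) A (parity_type False)"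
    by (rule parity_type_restrict_eq[OF A(1) x(1)]) (use S x(2) in blast)
  then show False using ne by blast
qed

end

section \<open>Closure under the tameness bounds\<close>

lemma Pow_lepoll_mono: "A \<lesssim> B \<Longrightarrow> Pow A \<lesssim> Pow B"
  unfolding lepoll_def by (meson image_Pow_mono inj_on_image_Pow)

text \<open>The power set of an infinite set absorbs countable sequences: a sequence of subsets of
  \<open>?S\<close> is a subset of the product of the natural numbers with \<open>?S\<close>, which
  is no larger than \<open>?S\<close>.\<close>

lemma ex_omega_closed:
  fixes k :: "'v::zfc_universe"
  obtains T :: "'v set" and c :: "(nat \<Rightarrow> 'v) \<Rightarrow> 'v" where "small T" "infinite T" "elts k \<lesssim> T"
    "inj_on c {s. range s \<subseteq> T}" "\<And>s. range s \<subseteq> T \<Longrightarrow> c s \<in> T"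
proof -
  let ?S = "elts k <+> (UNIV :: nat set)"
  have "setlike TYPE('v) (Pow ?S)"
    by (intro setlike_Pow setlike_Plus setlike_nat) (simp add: setlike_small)
  then obtain \<tau> :: 'v where \<tau>: "Card \<tau>" "elts \<tau> \<approx> Pow ?S" by (rule ex_Card_eqpoll)
  let ?T = "elts \<tau>"
  have S: "infinite ?S" by (simp add: finite_Plus_iff)
  have PT: "Pow ?S \<lesssim> ?T" "?T \<lesssim> Pow ?S" using \<tau>(2) eqpoll_imp_lepoll eqpoll_sym by blast+
  have ST: "?S \<lesssim> ?T" by (rule lepoll_trans[OF lepoll_Pow_self PT(1)])
  have kT: "elts k \<lesssim> ?T" by (rule lepoll_trans[OF lepoll_Plus1 ST])
  have inf: "infinite ?T" using lepoll_trans[OF lepoll_Plus2 ST] by (simp add: infinite_le_lepoll)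
  obtain b where b: "inj_on b ?T" "b ` ?T \<subseteq> Pow ?S" using PT(2) unfolding lepoll_def by blast
  have "inj_on (\<lambda>s. {(n, y). y \<in> b (s n)}) {s :: nat \<Rightarrow> 'v. range s \<subseteq> ?T}"
  proof (rule inj_onI)
    fix s t :: "nat \<Rightarrow> 'v"
    assume st: "s \<in> {s. range s \<subseteq> ?T}" "t \<in> {s. range s \<subseteq> ?T}" "{(n, y). y \<in> b (s n)} = {(n, y). y \<in> b (t n)}"
    have "s n = t n" for n
    proof -
      have "b (s n) = b (t n)" using st(3) by auto
      then show ?thesis using st(1,2) by (intro inj_onD[OF b(1)]) auto
    qed
    then show "s = t" ..
  qed
  moreover have "(\<lambda>s. {(n, y). y \<in> b (s n)}) ` {s :: nat \<Rightarrow> 'v. range s \<subseteq> ?T} \<subseteq> Pow (UNIV \<times> ?S)"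
  proof (rule image_subsetI)
    fix s :: "nat \<Rightarrow> 'v" assume s: "s \<in> {s. range s \<subseteq> ?T}"
    have "b (s n) \<subseteq> ?S" for n using s b(2) by blast
    then show "{(n, y). y \<in> b (s n)} \<in> Pow (UNIV \<times> ?S)" by blast
  qed
  ultimately have "{s :: nat \<Rightarrow> 'v. range s \<subseteq> ?T} \<lesssim> Pow ((UNIV :: nat set) \<times> ?S)" unfolding lepoll_def by blast
  also have "\<dots> \<lesssim> Pow ?S"
    by (intro Pow_lepoll_mono infinite_Times_lepoll S lepoll_Plus2 lepoll_refl)
  also have "\<dots> \<lesssim> ?T" by (rule PT(1))
  finally obtain c where "inj_on c {s :: nat \<Rightarrow> 'v. range s \<subseteq> ?T}" "c ` {s. range s \<subseteq> ?T} \<subseteq> ?T"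
    unfolding lepoll_def by blast
  then show ?thesis using that[of ?T c] inf kT by (auto simp: image_subset_iff)
qed

text \<open>The class, hence its tameness bound \<kappa>, is fixed by \<open>k\<close> before
  \<open>X\<close> and \<open>F\<close> are given; only the models depend on these. This is what
  gives one \<open>k'\<close> for all filters. It is taken above \<open>k\<close> and above the
  number of conditions that fewer than \<kappa> parameters can impose.\<close>

lemma ultrafilters_of_tame:
  fixes k :: "'v::zfc_universe"
  assumes tame: "\<forall>K :: 'v absclass. aec K \<longrightarrow> (\<exists>\<kappa>. Card \<kappa> \<and> tame \<kappa> K)"
  shows "\<exists>k' :: 'v. Card k' \<and> elts k \<prec> elts k' \<and> (\<forall>X F. small X \<and> filter_on_set X F \<and> complete_family k' F \<longrightarrow>
    (\<exists>U. F \<subseteq> U \<and> ultrafilter_on_set X U \<and> complete_family k U))"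
proof -
  obtain T :: "'v set" and c :: "(nat \<Rightarrow> 'v) \<Rightarrow> 'v" where T: "small T" "infinite T" "elts k \<lesssim> T"
    and c: "inj_on c {s. range s \<subseteq> T}" "\<And>s. range s \<subseteq> T \<Longrightarrow> c s \<in> T" by (rule ex_omega_closed) (rule that)
  have "\<exists>t0 \<in> T. \<exists>t1 \<in> T. t0 \<noteq> t1"
  proof (rule ccontr)
    assume "\<not> ?thesis"
    then obtain t where "T \<subseteq> {t}" by blast
    then show False using T(2) finite_subset by blast
  qed
  then obtain t0 t1 where t01: "t0 \<in> T" "t1 \<in> T" "t0 \<noteq> t1" by blast
  define RS where "RS = {QQ, SS, ZZ} \<union> RR ` (T \<rightarrow>\<^sub>E T)"
  have sT: "setlike TYPE('v) T" using T(1) by (simp add: setlike_small)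
  have sTT: "setlike TYPE('v) (T \<rightarrow>\<^sub>E T)" by (intro setlike_PiE sT)
  have "setlike TYPE('v) RS"
    unfolding RS_def by (intro setlike_Un setlike_image sTT setlike_countable) simp
  then obtain renc where renc: "inj_on renc RS" "small (renc ` RS :: 'v set)" by (rule setlikeE)
  interpret C: torsor_class T renc RS
    by unfold_locales (use T(1) renc in \<open>auto simp: RS_def\<close>)
  have "aec C.TK" unfolding aec_def by (rule C.aec_TK)
  then obtain \<kappa> where \<kappa>: "tame \<kappa> C.TK" using tame by blast
  let ?P = "elts k <+> elts \<kappa> \<times> elts \<kappa> \<times> (T \<rightarrow>\<^sub>E T)"
  have "setlike TYPE('v) (Pow ?P)"
    by (intro setlike_Pow setlike_Plus setlike_Times sTT) (simp_all add: setlike_small)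
  then obtain k' :: 'v where k': "Card k'" "elts k' \<approx> Pow ?P" by (rule ex_Card_eqpoll)
  have Pk': "?P \<prec> elts k'" using lesspoll_Pow_self lesspoll_eq_trans eqpoll_sym[OF k'(2)] by blast
  have kk': "elts k \<prec> elts k'" using lepoll_Plus1 Pk' by (rule lesspoll_trans1)
  have "\<exists>U. F \<subseteq> U \<and> ultrafilter_on_set X U \<and> complete_family k U"
    if XF: "small X" "filter_on_set X F" "complete_family k' F" for X F
  proof -
    define E where "E = {AA} \<union> GG ` (X \<rightarrow>\<^sub>E T) \<union> {WW f u |f u. f \<in> X \<rightarrow>\<^sub>E T \<and> u \<subseteq> T \<and> finite u}"
    have sXT: "setlike TYPE('v) (X \<rightarrow>\<^sub>E T)" using XF(1) by (intro setlike_PiE sT) (simp add: setlike_small)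
    have "{WW f u |f u. f \<in> X \<rightarrow>\<^sub>E T \<and> u \<subseteq> T \<and> finite u} \<subseteq> (\<lambda>(f, u). WW f u) ` ((X \<rightarrow>\<^sub>E T) \<times> Pow T)" by auto
    then have "setlike TYPE('v) {WW f u |f u. f \<in> X \<rightarrow>\<^sub>E T \<and> u \<subseteq> T \<and> finite u}"
      by (rule setlike_subset[rotated]) (intro setlike_image setlike_Times sXT setlike_Pow sT)
    then have "setlike TYPE('v) E"
      unfolding E_def by (intro setlike_Un setlike_image sXT; simp add: setlike_countable)
    then obtain enc where enc: "inj_on enc E" "small (enc ` E :: 'v set)" by (rule setlikeE)
    interpret torsor_frame T renc RS X F enc E
      by unfold_locales (use enc T(2) in \<open>auto simp: E_def\<close>)
    have "parity_type True = parity_type False"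
    proof (rule parity_types_eq[OF \<kappa> XF(2)])
      fix B :: "'v set" and S assume B: "B \<prec> elts \<kappa>" and S: "S \<subseteq> F" "S \<noteq> {}" "S \<lesssim> B \<times> B \<times> (T \<rightarrow>\<^sub>E T)"
      have "B \<times> B \<times> (T \<rightarrow>\<^sub>E T) \<lesssim> elts \<kappa> \<times> elts \<kappa> \<times> (T \<rightarrow>\<^sub>E T)"
        by (intro times_lepoll_mono lesspoll_imp_lepoll[OF B] lepoll_refl)
      then have "S \<lesssim> ?P" by (rule lepoll_trans[OF S(3) lepoll_trans[OF _ lepoll_Plus2]])
      then have "S \<prec> elts k'" using Pk' by (rule lesspoll_trans1)
      then show "\<Inter>S \<in> F" using XF(3) S(1,2) unfolding complete_family_def by blast
    qed
    then obtain \<phi> where \<phi>: "\<And>f. f \<in> X \<rightarrow>\<^sub>E T \<Longrightarrow> finite (\<phi> f) \<and> \<phi> f \<subseteq> T \<and> odd (card (\<phi> f))"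
      "\<And>f f' \<pi>. f \<in> X \<rightarrow>\<^sub>E T \<Longrightarrow> f' \<in> X \<rightarrow>\<^sub>E T \<Longrightarrow> \<pi> \<in> T \<rightarrow>\<^sub>E T \<Longrightarrow> edge \<pi> f f' \<Longrightarrow> \<phi> f' = push \<pi> (\<phi> f)"
      by (rule parity_selector) (rule that)
    have "\<exists>U. F \<subseteq> U \<and> ultrafilter_on_set X U \<and> (\<forall>S \<subseteq> U. S \<noteq> {} \<and> S \<lesssim> T \<longrightarrow> \<Inter>S \<in> U)"
      by (rule ultrafilter_of_parity_selector[OF XF(2) c t01 \<phi>(1) \<phi>(2)]) (simp_all add: edge_def)
    then obtain U where U: "F \<subseteq> U" "ultrafilter_on_set X U" "\<forall>S \<subseteq> U. S \<noteq> {} \<and> S \<lesssim> T \<longrightarrow> \<Inter>S \<in> U" by blast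
    have "S \<lesssim> T" if "S \<prec> elts k" for S :: "'v set set" using lesspoll_imp_lepoll[OF that] T(3) by (rule lepoll_trans)
    then have "complete_family k U" unfolding complete_family_def using U(3) by simp
    with U(1,2) show ?thesis by blast
  qed
  then show ?thesis using k'(1) kk' by blast
qed

text \<open>Iterating the passage from \<open>k\<close> to \<open>k'\<close> from any start leads to
  an almost strongly compact limit: a cardinal below the limit is below some \<open>ks n\<close>,
  and a filter complete at the limit is complete enough for the step after
  \<open>ks n\<close>.\<close>

lemma not_small_almost_strongly_compact:
  assumes tame: "\<forall>K :: 'v::zfc_universe absclass. aec K \<longrightarrow> (\<exists>\<kappa>. Card \<kappa> \<and> tame \<kappa> K)"
  shows "\<not> small {\<kappa> :: 'v. almost_strongly_compact \<kappa>}"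
proof
  assume small: "small {\<kappa> :: 'v. almost_strongly_compact \<kappa>}"
  \<comment> \<open>If there were only a set of such cardinals, \<open>k0\<close> could be chosen
    larger in size than their union \<open>A\<close>, while the limit built above \<open>k0\<close>
    would be contained in \<open>A\<close>.\<close>
  define A where "A = (\<Union>\<kappa> \<in> {\<kappa> :: 'v. almost_strongly_compact \<kappa>}. elts \<kappa>)"
  have sA: "small A" unfolding A_def by (rule small_UN[OF small]) simp
  have el: "setlike TYPE('v) (elts x)" for x :: 'v by (simp add: setlike_small)
  have "setlike TYPE('v) (Pow (A <+> elts (omega :: 'v)))"
    using sA by (intro setlike_Pow setlike_Plus el) (simp add: setlike_small)
  then obtain k0 :: 'v where k0: "Card k0" "elts k0 \<approx> Pow (A <+> elts (omega :: 'v))" by (rule ex_Card_eqpoll)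
  have "A <+> elts (omega :: 'v) \<prec> elts k0" using lesspoll_Pow_self lesspoll_eq_trans eqpoll_sym[OF k0(2)] by blast
  then have Ak0: "A \<prec> elts k0" "elts (omega :: 'v) \<prec> elts k0" 
    using lepoll_Plus1 lepoll_Plus2 lesspoll_trans1 by blast+
  obtain g :: "'v \<Rightarrow> 'v" where g: "\<And>k. Card (g k) \<and> elts k \<prec> elts (g k) \<and> (\<forall>X F. small X \<and> filter_on_set X F \<and> complete_family (g k) F \<longrightarrow>
    (\<exists>U. F \<subseteq> U \<and> ultrafilter_on_set X U \<and> complete_family k U))"
    using ultrafilters_of_tame[OF tame] by metis
  define ks where "ks n = (g ^^ n) k0" for n
  have Cks: "Card (ks n)" for n using g k0(1) by (cases n) (simp_all add: ks_def)
  have ks_mem: "ks n \<in> elts (ks (Suc n))" for n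
    unfolding Card_mem_iff_lesspoll[OF Cks Cks] using g by (simp add: ks_def)
  define \<kappa> where "\<kappa> = vset (\<Union>n. elts (ks n))"
  have "small (\<Union>n. elts (ks n))" using setlike_UN[OF setlike_nat el] by (simp add: setlike_small)
  then have e\<kappa>: "elts \<kappa> = (\<Union>n. elts (ks n))" unfolding \<kappa>_def by (rule elts_vset)
  have sub: "elts (ks n) \<subseteq> elts \<kappa>" for n by (auto simp: e\<kappa>)
  have ks\<kappa>: "ks n \<in> elts \<kappa>" for n using ks_mem[of n] by (auto simp: e\<kappa>)
  have O\<kappa>: "Ord \<kappa>" unfolding \<kappa>_def
  proof (rule Ord_vset[OF \<open>small (\<Union>n. elts (ks n))\<close>])
    fix x assume "x \<in> (\<Union>n. elts (ks n))"
    then obtain n where n: "x \<in> elts (ks n)" by blast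
    show "Ord x" by (rule Ord_mem[OF Card_Ord[OF Cks] n])
    show "y \<in> (\<Union>n. elts (ks n))" if "y \<in> elts x" for y
      using Ord_trans[OF Card_Ord[OF Cks] n that] by blast
  qed
  have C\<kappa>: "Card \<kappa>"
    unfolding Card_def
  proof (intro conjI O\<kappa> ballI)
    fix \<alpha> assume "\<alpha> \<in> elts \<kappa>"
    then obtain n where "\<alpha> \<in> elts (ks n)" by (auto simp: e\<kappa>)
    then have "elts \<alpha> \<prec> elts (ks n)" by (rule Card_mem_lesspoll[OF Cks])
    then show "elts \<alpha> \<prec> elts \<kappa>" using subset_imp_lepoll[OF sub] by (rule lesspoll_trans2)
  qed
  have k0\<kappa>: "elts k0 \<lesssim> elts \<kappa>" using subset_imp_lepoll[OF sub[of 0]] by (simp add: ks_def)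
  have \<omega>\<kappa>: "elts (omega :: 'v) \<prec> elts \<kappa>" using Ak0(2) k0\<kappa> by (rule lesspoll_trans2)
  have "(UNIV :: nat set) \<lesssim> elts (omega :: 'v)" using infinite_omega by (simp add: infinite_le_lepoll)
  then have inf: "infinite (elts \<kappa>)"
    unfolding infinite_le_lepoll using lesspoll_imp_lepoll[OF \<omega>\<kappa>] by (rule lepoll_trans)
  have "almost_strongly_compact \<kappa>"
    unfolding almost_strongly_compact_def limit_card_def
  proof (intro conjI C\<kappa> inf \<omega>\<kappa> ballI impI allI; (elim conjE)?)
    fix \<nu> assume \<nu>: "\<nu> \<in> elts \<kappa>" "Card \<nu>"
    then obtain n where "\<nu> \<in> elts (ks n)" by (auto simp: e\<kappa>)
    then show "\<exists>\<nu>'\<in>elts \<kappa>. Card \<nu>' \<and> \<nu> \<in> elts \<nu>'" using ks\<kappa> Cks by blast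
  next
    fix \<nu> X F assume \<nu>: "\<nu> \<in> elts \<kappa>" "Card \<nu>" and F: "small X" "filter_on_set X F" "complete_family \<kappa> F"
    obtain n where n: "\<nu> \<in> elts (ks n)" using \<nu>(1) by (auto simp: e\<kappa>)
    have "complete_family (g (ks n)) F"
      using complete_family_mono[OF F(3) subset_imp_lepoll[OF sub[of "Suc n"]]] by (simp add: ks_def)
    then obtain U where U: "F \<subseteq> U" "ultrafilter_on_set X U" "complete_family (ks n) U" using g F(1,2) by blast
    have "elts \<nu> \<lesssim> elts (ks n)" using Card_mem_lesspoll[OF Cks n] by (rule lesspoll_imp_lepoll)
    then show "\<exists>U. F \<subseteq> U \<and> ultrafilter_on_set X U \<and> complete_family \<nu> U"
      using U complete_family_mono by blast
  qed
  then have "elts \<kappa> \<lesssim> A" unfolding A_def by (intro subset_imp_lepoll) blast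
  then have "elts k0 \<prec> elts k0" using k0\<kappa> Ak0(1) lepoll_trans lesspoll_trans1 by blast
  then show False by simp
qed

section \<open>The equivalence\<close>

lemma fully_tame_and_short_imp_tame:
  assumes "aec K" "fully_tame_and_short \<kappa> K" shows "tame \<kappa> K"
proof -
  interpret mu_class omega K using assms(1) by unfold_locales (simp add: aec_def)
  have Ord1: "Ord (ord_one :: 'a)" by (auto simp: Ord_def ord_one_def elts_vset)
  show ?thesis
    unfolding tame_def
  proof (intro ballI impI)
    fix M p q assume M: "M \<in> models K" and p: "p \<in> gS K ord_one M" and q: "q \<in> gS K ord_one M" and "p \<noteq> q"
    then obtain I A where IA: "I \<subseteq> elts ord_one" "A \<subseteq> univ M" "I <+> A \<prec> elts \<kappa>"
      and ne: "gtp_restrict K I A p \<noteq> gtp_restrict K I A q"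
      using assms(2)[unfolded fully_tame_and_short_def, rule_format, OF M Ord1 p q] by blast
    \<comment> \<open>Restriction to \<open>I\<close> factors through restriction to the whole
      one-element index set, so a difference visible at \<open>I\<close> is already visible
      there.\<close>
    have r: "gtp_restrict K I A (gtp_restrict K (elts ord_one) A t) = gtp_restrict K I A t" if t: "t \<in> gS K ord_one M" for t
    proof -
      obtain a N where a: "t = gtp K (elts ord_one) a (univ M) N" "leK K M N" "a \<in> elts ord_one \<rightarrow>\<^sub>E univ N"
        using t unfolding gS_def by blast
      have N: "N \<in> models K" "univ M \<subseteq> univ N" using leK_models(2)[OF a(2)] leK_substruc[OF a(2)] by (simp_all add: substruc_def)
      note R = gtp_restrict_gtp[OF E_at_refl[OF N a(3)]]
      have ax: "restrict a (elts ord_one) = a" using a(3) by (rule PiE_restrict)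
      have "A \<subseteq> univ N" using IA(2) N(2) by blast
      from gtp_restrict_gtp[OF E_at_refl[OF N(1) this a(3)] IA(1) order_refl] show ?thesis
        unfolding a(1) R[OF order_refl IA(2)] R[OF IA(1,2)] ax .
    qed
    have "A \<prec> elts \<kappa>" using lepoll_Plus2 IA(3) by (rule lesspoll_trans1)
    moreover have "gtp_restrict K (elts ord_one) A p \<noteq> gtp_restrict K (elts ord_one) A q" using ne r[OF p] r[OF q] by metis
    ultimately show "\<exists>A\<subseteq>univ M. A \<prec> elts \<kappa> \<and> gtp_restrict K (elts ord_one) A p \<noteq> gtp_restrict K (elts ord_one) A q"
      using IA(2) by blast
  qed
qed

theorem theorem5p6:
  shows
    "((\<forall>\<mu> :: 'v::zfc_universe. regular_card \<mu> \<longrightarrow>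
         (\<forall>K. mu_aec \<mu> K \<longrightarrow> (\<exists>\<kappa>. Card \<kappa> \<and> fully_tame_and_short \<kappa> K)))
      \<longleftrightarrow> (\<forall>K :: 'v absclass. aec K \<longrightarrow> (\<exists>\<kappa>. Card \<kappa> \<and> tame \<kappa> K)))
     \<and>
     ((\<forall>K :: 'v absclass. aec K \<longrightarrow> (\<exists>\<kappa>. Card \<kappa> \<and> tame \<kappa> K))
      \<longleftrightarrow> \<not> small {\<kappa> :: 'v. almost_strongly_compact \<kappa>})"
proof -
  let ?one = "\<forall>\<mu> :: 'v. regular_card \<mu> \<longrightarrow> (\<forall>K. mu_aec \<mu> K \<longrightarrow> (\<exists>\<kappa>. Card \<kappa> \<and> fully_tame_and_short \<kappa> K))"
  let ?two = "\<forall>K :: 'v absclass. aec K \<longrightarrow> (\<exists>\<kappa>. Card \<kappa> \<and> tame \<kappa> K)"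
  let ?three = "\<not> small {\<kappa> :: 'v. almost_strongly_compact \<kappa>}"
  have 12: ?two if one: ?one
  proof (intro allI impI)
    fix K :: "'v absclass" assume K: "aec K"
    then obtain \<kappa> where "Card \<kappa>" "fully_tame_and_short \<kappa> K"
      using one regular_omega unfolding aec_def by blast
    then show "\<exists>\<kappa>. Card \<kappa> \<and> tame \<kappa> K" using fully_tame_and_short_imp_tame[OF K] by blast
  qed
  have 23: ?three if ?two using that by (rule not_small_almost_strongly_compact)
  have 31: ?one if three: ?three
  proof (intro allI impI)
    fix \<mu> :: 'v and K assume "mu_aec \<mu> K"
    then interpret mu_class \<mu> K by unfold_locales
    show "\<exists>\<kappa>. Card \<kappa> \<and> fully_tame_and_short \<kappa> K" using three by (rule fully_tame_and_short)
  qed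
  show ?thesis using 12 23 31 by blast
qed

end
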